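(* Let $(P,\le_P)$ be a finite (3+1)-free poset. The map \[\varphi:\bigsqcup_{T\text{ two-row }P\text{-tableau}}\{(T,D)\mid D\in\mathcal D(T)\}\to \mathrm{DFA}_P,\qquad (T,D)\mapsto \mathrm{array}(L_T(D)),\] is a bijection, and $\mathbf{wt}(D)=\mathbf{wt}(\varphi(T,D))$. Additionally, $\mathrm{DFA}_{P,T}$ is a connected subset of the $P$-array crystal $\mathcal A_P$ for each two-row $P$-tableau $T$.
   Context: A poset is (3+1)-free if it does not contain as an induced subposet the disjoint union of a 3-element chain and a 1-element chain. $\mathbb Z_+$ is the set of positive integers. Positions $(i,j)\in\mathbb Z_+\times\mathbb Z_+$ use matrix convention (row $i$, column $j$; row 1 on top). $P$-arrays. A $P$-array is an indexing $A=\{A_{i,j}\}$ of the elements of $P$ (each element of $P$ occurs exactly once) by positions $(i,j)$ such that if $A_{i,j}$ is defined with $j>1$ then $A_{i,j-1}$ is defined and $A_{i,j-1}<_P A_{i,j}$. So a $P$-array amounts to an assignment of the elements of $P$ to rows indexed by $\mathbb Z_+$, each row being a chain listed in increasing order. $\mathcal A_P$ is the set of $P$-arrays. $\mathbf{wt}(A)_i$ is the number of elements in row $i$. A $P$-tableau is a $P$-array such that whenever $A_{i,j}$ is defined with $i>1$, then $A_{i-1,j}$ is defined and $A_{i-1,j}\not>_P A_{i,j}$. A two-row $P$-tableau is a $P$-tableau $T$ with $\mathbf{wt}(T)_i=0$ for all $i>2$. The $r$ alignment. Let $A$ be a $P$-array, $r\ge1$, and let $a_1<_P\cdots<_Pa_m$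 and $b_1<_P\cdots<_Pb_n$ be the elements of rows $r$ and $r+1$ of $A$. Define $C(b_k)=k$ and, inductively, $C(a_k)=\max(\{C(b_i)\mid b_i<_Pa_k\}\cup\{C(a_i)\mid 1\le i<k\})+1$ (with $\max\emptyset=0$). The $r$ pre-alignment $\phi_0:\{a_1,\dots,a_m,b_1,\dots,b_n\}\to\{r,r+1\}\times\mathbb Z_+$ sends $a_k\mapsto(r,C(a_k))$, $b_k\mapsto(r+1,C(b_k))$. Given $\phi_k$, select the rightmost element $x$, say mapped to $(i,c)$, such that column $c+1$ of $\phi_k$ is nonempty and contains no $y>_Px$, if such $x$ exists; then $\phi_{k+1}(x)=(i,c+1)$ and $\phi_{k+1}=\phi_k$ elsewhere. If no such $x$ exists, $\phi_k$ is the $r$ alignment of $A$. $P$-array crystal. With this notation ("column" meaning column in the $r$ alignment of $A$): if every column with an entry in row $r$ also contains an entry in row $r+1$, then $f_r(A)=0$. Otherwise let $p$ be minimal such that $a_p$ does not share a column with an element of row $r+1$, let $t\ge0$ be minimal such that there is no $b_i\not>_Pa_{p+t}$ one column right of $a_{p+t}$, and let $f_r(A)$ be obtained from $A$ by moving $a_p,\dots,a_{p+t}$ to row $r+1$ and any $b_i$ sharing a column with one of these to row $r$. If every column with an entry in row $r+1$ also contains an entry in row $r$, then $e_r(A)=0$. Otherwise let $p$ be maximal such that $b_p$ does not share a column with an entry of row $r$, let $t\ge0$ be minimal such that there is no $a_i\not>_Pb_{p+t}$ one column right of $b_{p+t}$, and let $e_r(A)$ be obtained from $A$ by moving $b_p,\dots,b_{p+t}$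 to row $r$ and any $a_i$ sharing a column with one of these to row $r+1$. The $P$-array crystal is the graph on $\mathcal A_P$ with an edge of color $r$ from $A$ to $f_r(A)$ whenever $f_r(A)\ne0$ (equivalently from $e_r(A)$ to $A$ whenever $e_r(A)\neq 0$). A subset of $\mathcal A_P$ is connected if the induced subgraph, viewed as undirected, is connected. Diagram crystal. A diagram is a finite subset of $\mathbb Z_+\times\mathbb Z_+$, whose elements are called cells; $\mathbf{wt}(D)_i$ is the number of cells in row $i$. The $r$-pairs of a diagram $D$ are defined iteratively: unpaired cells $x$ in row $r$ and $y$ in row $r+1$, with $x$ weakly left of $y$, form an $r$-pair whenever every other cell in rows $r,r+1$ in a column weakly between $x$ and $y$ is already part of an $r$-pair. If every cell in row $r+1$ of $D$ is $r$-paired then $e_r(D)=0$; otherwise, with $(r+1,c)$ the rightmost non-$r$-paired cell in row $r+1$, $e_r(D)=(D\setminus\{(r+1,c)\})\cup\{(r,c)\}$. If every cell in row $r$ is $r$-paired then $f_r(D)=0$; otherwise, with $(r,c)$ the leftmost non-$r$-paired cell in row $r$, $f_r(D)=(D\setminus\{(r,c)\})\cup\{(r+1,c)\}$. The diagram crystal is the graph on all diagrams with an edge of color $r$ from $D$ to $f_r(D)$ whenever $f_r(D)\ne0$. For a two-row $P$-tableau $T$, let $\mathbb D(T)$ be the image of the 1 alignment of $T$, and let $\mathcal D(T)$ be the set of diagrams in the connected component of $\mathbb D(T)$ in the diagram crystal. Diagram filling. For $D\in\mathcal D(T)$, the filling $L_T(D):P\to D$ is the bijection constructed column by column from left to right as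 follows (each column of $D$ has the same number of cells, at most 2, as the same column of $\mathbb D(T)$). Suppose all entries mapped to cells strictly left of column $c$ are determined. If column $c$ of the 1 alignment of $T$ contains a unique entry, map it to the unique cell in column $c$ of $D$. Otherwise column $c$ of the 1 alignment contains two entries $x_1,x_2$ in rows 1 and 2 respectively; assign them to the two cells in column $c$ of $D$ by the first of the following rules whose prerequisites are met. (1) Suppose some $y\in P$ is mapped to the topmost cell $(r,c-1)$ in column $c-1$ of $D$, and exactly one $x_i$ is greater than $y$ in $P$. Then let $s\le r$ be maximal such that $(s,c)\in D$, map $x_i$ to $(s,c)$ and the remaining element to the remaining cell. (2) The same with "topmost" replaced by "lowest": suppose some $y\in P$ is mapped to the lowest cell $(r,c-1)$ in column $c-1$ of $D$, and exactly one $x_i$ is greater than $y$; then let $s\le r$ be maximal such that $(s,c)\in D$, map $x_i$ to $(s,c)$ and the remaining element to the remaining cell. (3) Map $x_1$ and $x_2$ to the upper and lower cells in column $c$ of $D$ respectively. For a filling $L=L_T(D)$, $\mathrm{array}(L)$ is the $P$-array $\{A_{i,j}\}$ where $L(A_{i,j})$ is the $j$th cell from the left in row $i$ of $\operatorname{Im}(L)=D$. Set $\mathrm{DFA}_{P,T}=\{\mathrm{array}(L_T(D))\mid D\in\mathcal D(T)\}$ and $\mathrm{DFA}_P=\bigcup_T\mathrm{DFA}_{P,T}$ over all two-row $P$-tableaux $T$. *)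

theory Defs
  imports Main
begin

text \<open>
  Positions and cells are pairs \<open>(row, column)\<close> of natural numbers; rows and columns are numbered
  from 1 (matrix convention, row 1 on top).  A poset is a carrier \<open>P\<close> with a relation \<open>le\<close> such
  that \<open>partial_order_on P le\<close>.
\<close>

type_synonym 'a array = "nat \<times> nat \<rightharpoonup> 'a"
type_synonym diagram = "(nat \<times> nat) set"
type_synonym 'a filling = "'a \<rightharpoonup> nat \<times> nat"

definition lt :: "'a rel \<Rightarrow> 'a \<Rightarrow> 'a \<Rightarrow> bool" where
  "lt le x y \<longleftrightarrow> (x, y) \<in> le \<and> x \<noteq> y"

definition incomparable :: "'a rel \<Rightarrow> 'a \<Rightarrow> 'a \<Rightarrow> bool" where
  "incomparable le x y \<longleftrightarrow> (x, y) \<notin> le \<and> (y, x) \<notin> le"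

definition three_plus_one_free :: "'a set \<Rightarrow> 'a rel \<Rightarrow> bool" where
  "three_plus_one_free P le \<longleftrightarrow>
     \<not> (\<exists>a\<in>P. \<exists>b\<in>P. \<exists>c\<in>P. \<exists>d\<in>P. lt le a b \<and> lt le b c \<and>
          incomparable le a d \<and> incomparable le b d \<and> incomparable le c d)"

definition unique_opt :: "('a \<Rightarrow> bool) \<Rightarrow> 'a option" where
  "unique_opt Q = (if \<exists>!x. Q x then Some (THE x. Q x) else None)"

definition P_arrays :: "'a set \<Rightarrow> 'a rel \<Rightarrow> 'a array set" where
  "P_arrays P le = {A.
     dom A \<subseteq> {1..} \<times> {1..} \<and>
     ran A = P \<and> inj_on A (dom A) \<and>
     (\<forall>i j x. A (i, j) = Some x \<and> j > 1 \<longrightarrow>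
        (\<exists>y. A (i, j - 1) = Some y \<and> lt le y x))}"

definition wt_array :: "'a array \<Rightarrow> nat \<Rightarrow> nat" where
  "wt_array A i = card {j. A (i, j) \<noteq> None}"

definition P_tableaux :: "'a set \<Rightarrow> 'a rel \<Rightarrow> 'a array set" where
  "P_tableaux P le = {T \<in> P_arrays P le.
     \<forall>i j x. T (i, j) = Some x \<and> i > 1 \<longrightarrow>
       (\<exists>y. T (i - 1, j) = Some y \<and> \<not> lt le x y)}"

definition two_row_tableaux :: "'a set \<Rightarrow> 'a rel \<Rightarrow> 'a array set" where
  "two_row_tableaux P le = {T \<in> P_tableaux P le. \<forall>i>2. wt_array T i = 0}"

text \<open>\<open>upper_col le A r k\<close> is the number \<open>C(a\<^sub>k)\<close> for the \<open>k\<close>-th element \<open>a\<^sub>k\<close> of row \<open>r\<close>; the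
  element 0 accounts for the convention that the maximum of the empty set is 0.\<close>

fun upper_col :: "'a rel \<Rightarrow> 'a array \<Rightarrow> nat \<Rightarrow> nat \<Rightarrow> nat" where
  "upper_col le A r k =
     Max ({0} \<union> {i. \<exists>b. A (Suc r, i) = Some b \<and> lt le b (the (A (r, k)))}
              \<union> (\<lambda>i. upper_col le A r i) ` {1..<k}) + 1"

declare upper_col.simps [simp del]

definition pre_alignment :: "'a rel \<Rightarrow> 'a array \<Rightarrow> nat \<Rightarrow> 'a filling" where
  "pre_alignment le A r x =
     (case unique_opt (\<lambda>p. A p = Some x) of
        None \<Rightarrow> None
      | Some (i, k) \<Rightarrow>
          if i = r then Some (r, upper_col le A r k)
          else if i = Suc r then Some (Suc r, k)
          else None)"

definition movable :: "'a rel \<Rightarrow> 'a filling \<Rightarrow> 'a \<Rightarrow> bool" where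
  "movable le \<phi> x \<longleftrightarrow> (\<exists>i c. \<phi> x = Some (i, c) \<and>
     (\<exists>y j. \<phi> y = Some (j, c + 1)) \<and>
     (\<forall>y j. \<phi> y = Some (j, c + 1) \<longrightarrow> \<not> lt le x y))"

definition rightmost_movable :: "'a rel \<Rightarrow> 'a filling \<Rightarrow> 'a \<Rightarrow> bool" where
  "rightmost_movable le \<phi> x \<longleftrightarrow> movable le \<phi> x \<and>
     (\<forall>y. movable le \<phi> y \<longrightarrow> snd (the (\<phi> y)) \<le> snd (the (\<phi> x)))"

text \<open>In the iteration below each row stays strictly increasing from left to right.  An element of
  the next column in the same row therefore blocks a move, so two elements of one column are never
  both movable and the choice of \<open>x\<close> is unique.\<close>

definition align_step :: "'a rel \<Rightarrow> 'a filling \<Rightarrow> 'a filling" where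
  "align_step le \<phi> =
     (if \<exists>x. movable le \<phi> x
      then let x = (SOME x. rightmost_movable le \<phi> x); (i, c) = the (\<phi> x)
           in \<phi>(x \<mapsto> (i, c + 1))
      else \<phi>)"

definition alignment :: "'a rel \<Rightarrow> 'a array \<Rightarrow> nat \<Rightarrow> 'a filling" where
  "alignment le A r =
     (let \<phi> = (\<lambda>k. (align_step le ^^ k) (pre_alignment le A r))
      in \<phi> (LEAST k. \<not> (\<exists>x. movable le (\<phi> k) x)))"

text \<open>The array on the elements of \<open>P\<close> in which \<open>x\<close> lies in row \<open>\<rho> x\<close>, rows being listed in
  increasing order.\<close>

definition array_of_rows :: "'a set \<Rightarrow> 'a rel \<Rightarrow> ('a \<Rightarrow> nat) \<Rightarrow> 'a array" where
  "array_of_rows P le \<rho> = (\<lambda>(i, j).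
     unique_opt (\<lambda>x. x \<in> P \<and> \<rho> x = i \<and> card {y \<in> P. \<rho> y = i \<and> (y, x) \<in> le} = j))"

definition row_of :: "'a array \<Rightarrow> 'a \<Rightarrow> nat" where
  "row_of A x = fst (THE p. A p = Some x)"

text \<open>The value \<open>None\<close> stands for \<open>f\<^sub>r(A) = 0\<close>.  Below, \<open>\<phi> x = Some (r, c)\<close> says that \<open>x\<close> belongs to
  row \<open>r\<close> of \<open>A\<close> and lies in column \<open>c\<close> of the alignment.\<close>

definition f_array :: "'a rel \<Rightarrow> nat \<Rightarrow> 'a array \<Rightarrow> 'a array option" where
  "f_array le r A =
     (let \<phi> = alignment le A r in
      if \<forall>c. (\<exists>x. \<phi> x = Some (r, c)) \<longrightarrow> (\<exists>y. \<phi> y = Some (r + 1, c)) then None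
      else
        let p = (LEAST p. \<exists>x c. A (r, p) = Some x \<and> \<phi> x = Some (r, c) \<and>
                            \<not> (\<exists>y. \<phi> y = Some (r + 1, c)));
            t = (LEAST t. \<exists>x c. A (r, p + t) = Some x \<and> \<phi> x = Some (r, c) \<and>
                            \<not> (\<exists>y. \<phi> y = Some (r + 1, c + 1) \<and> \<not> lt le x y));
            down = {x. \<exists>k. p \<le> k \<and> k \<le> p + t \<and> A (r, k) = Some x};
            up = {y. \<exists>x\<in>down. \<exists>c. \<phi> x = Some (r, c) \<and> \<phi> y = Some (r + 1, c)}
        in Some (array_of_rows (ran A) le
             (\<lambda>x. if x \<in> down then r + 1 else if x \<in> up then r else row_of A x)))"

definition array_crystal_edges :: "'a set \<Rightarrow> 'a rel \<Rightarrow> ('a array \<times> 'a array) set" where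
  "array_crystal_edges P le =
     {(A, B). A \<in> P_arrays P le \<and> B \<in> P_arrays P le \<and> (\<exists>r\<ge>1. f_array le r A = Some B)}"

definition connected_subset :: "'v set \<Rightarrow> ('v \<times> 'v) set \<Rightarrow> 'v set \<Rightarrow> bool" where
  "connected_subset V E S \<longleftrightarrow> S \<subseteq> V \<and>
     (\<forall>x\<in>S. \<forall>y\<in>S. (x, y) \<in> ((E \<union> E\<inverse>) \<inter> S \<times> S)\<^sup>*)"

definition is_diagram :: "diagram \<Rightarrow> bool" where
  "is_diagram D \<longleftrightarrow> finite D \<and> D \<subseteq> {1..} \<times> {1..}"

definition wt_diagram :: "diagram \<Rightarrow> nat \<Rightarrow> nat" where
  "wt_diagram D i = card {c. (i, c) \<in> D}"

text \<open>\<open>pairing D r M\<close>: the set of pairs \<open>M\<close> is reached at some stage of the iterative pairing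
  process.  The process is confluent, so an \<open>r\<close>-pair is a pair formed at some stage.\<close>

inductive pairing :: "diagram \<Rightarrow> nat \<Rightarrow> ((nat \<times> nat) \<times> (nat \<times> nat)) set \<Rightarrow> bool"
  for D :: diagram and r :: nat where
  empty: "pairing D r {}"
| pair: "pairing D r M \<Longrightarrow>
    (r, c) \<in> D \<Longrightarrow> (r + 1, d) \<in> D \<Longrightarrow> c \<le> d \<Longrightarrow>
    (r, c) \<notin> Field M \<Longrightarrow> (r + 1, d) \<notin> Field M \<Longrightarrow>
    (\<And>i e. (i, e) \<in> D \<Longrightarrow> i \<in> {r, r + 1} \<Longrightarrow> c \<le> e \<Longrightarrow> e \<le> d \<Longrightarrow>
        (i, e) \<noteq> (r, c) \<Longrightarrow> (i, e) \<noteq> (r + 1, d) \<Longrightarrow> (i, e) \<in> Field M) \<Longrightarrow>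
    pairing D r (insert ((r, c), (r + 1, d)) M)"

definition r_paired :: "diagram \<Rightarrow> nat \<Rightarrow> nat \<times> nat \<Rightarrow> bool" where
  "r_paired D r z \<longleftrightarrow> (\<exists>M. pairing D r M \<and> z \<in> Field M)"

definition f_diagram :: "nat \<Rightarrow> diagram \<Rightarrow> diagram option" where
  "f_diagram r D =
     (if \<forall>c. (r, c) \<in> D \<longrightarrow> r_paired D r (r, c) then None
      else let c = (LEAST c. (r, c) \<in> D \<and> \<not> r_paired D r (r, c))
           in Some ((D - {(r, c)}) \<union> {(r + 1, c)}))"

definition diagram_crystal_edges :: "(diagram \<times> diagram) set" where
  "diagram_crystal_edges =
     {(D, E). is_diagram D \<and> is_diagram E \<and> (\<exists>r\<ge>1. f_diagram r D = Some E)}"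

definition tableau_diagram :: "'a rel \<Rightarrow> 'a array \<Rightarrow> diagram" where
  "tableau_diagram le T = ran (alignment le T 1)"

definition diagram_component :: "'a rel \<Rightarrow> 'a array \<Rightarrow> diagram set" where
  "diagram_component le T =
     {D. (tableau_diagram le T, D) \<in> (diagram_crystal_edges \<union> diagram_crystal_edges\<inverse>)\<^sup>*}"

definition singles_out :: "'a rel \<Rightarrow> 'a filling \<Rightarrow> nat \<times> nat \<Rightarrow> 'a \<Rightarrow> 'a \<Rightarrow> bool" where
  "singles_out le L q u v \<longleftrightarrow> (\<exists>y. L y = Some q \<and> lt le y u \<and> \<not> lt le y v)"

definition place_pair :: "diagram \<Rightarrow> nat \<Rightarrow> nat \<Rightarrow> 'a \<Rightarrow> 'a \<Rightarrow> 'a filling \<Rightarrow> 'a filling" where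
  "place_pair D c r u v L =
     (let s = Max {s. s \<le> r \<and> (s, c) \<in> D}; s' = (THE s'. (s', c) \<in> D \<and> s' \<noteq> s)
      in L(u \<mapsto> (s, c), v \<mapsto> (s', c)))"

definition fill_column :: "'a rel \<Rightarrow> 'a filling \<Rightarrow> diagram \<Rightarrow> nat \<Rightarrow> 'a filling \<Rightarrow> 'a filling" where
  "fill_column le \<phi> D c L =
     (if \<exists>!x. \<exists>i. \<phi> x = Some (i, c) then
        L((THE x. \<exists>i. \<phi> x = Some (i, c)) \<mapsto> ((THE s. (s, c) \<in> D), c))
      else if \<exists>x1 x2. \<phi> x1 = Some (1, c) \<and> \<phi> x2 = Some (2, c) then
        let x1 = (THE x. \<phi> x = Some (1, c));
            x2 = (THE x. \<phi> x = Some (2, c));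
            top = Min {s. (s, c - 1) \<in> D};
            low = Max {s. (s, c - 1) \<in> D}
        in if singles_out le L (top, c - 1) x1 x2 then place_pair D c top x1 x2 L
           else if singles_out le L (top, c - 1) x2 x1 then place_pair D c top x2 x1 L
           else if singles_out le L (low, c - 1) x1 x2 then place_pair D c low x1 x2 L
           else if singles_out le L (low, c - 1) x2 x1 then place_pair D c low x2 x1 L
           else L(x1 \<mapsto> (Min {s. (s, c) \<in> D}, c), x2 \<mapsto> (Max {s. (s, c) \<in> D}, c))
      else L)"

primrec fill_columns :: "'a rel \<Rightarrow> 'a filling \<Rightarrow> diagram \<Rightarrow> nat \<Rightarrow> 'a filling" where
  "fill_columns le \<phi> D 0 = Map.empty"
| "fill_columns le \<phi> D (Suc c) = fill_column le \<phi> D (Suc c) (fill_columns le \<phi> D c)"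

definition diagram_filling :: "'a rel \<Rightarrow> 'a array \<Rightarrow> diagram \<Rightarrow> 'a filling" where
  "diagram_filling le T D =
     fill_columns le (alignment le T 1) D (Max (insert 0 (snd ` D)))"

text \<open>The entry in position \<open>(i, j)\<close> is the element placed in the \<open>j\<close>-th cell from the left in row \<open>i\<close>
  of the image of \<open>L\<close>.\<close>

definition array_of_filling :: "'a filling \<Rightarrow> 'a array" where
  "array_of_filling L = (\<lambda>(i, j). unique_opt (\<lambda>x. \<exists>c. L x = Some (i, c) \<and>
     card {c'. (i, c') \<in> ran L \<and> c' \<le> c} = j))"

definition DFA_of :: "'a rel \<Rightarrow> 'a array \<Rightarrow> 'a array set" where
  "DFA_of le T = {array_of_filling (diagram_filling le T D) | D. D \<in> diagram_component le T}"

definition DFA :: "'a set \<Rightarrow> 'a rel \<Rightarrow> 'a array set" where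
  "DFA P le = (\<Union>T\<in>two_row_tableaux P le. DFA_of le T)"

end

theory Submission
  imports Defs
begin

text \<open>
  The first row of a two-row tableau \<open>T\<close> does not move during the 1 alignment: its last entry lies in
  the last column, and every other entry is blocked by its right neighbour.  The alignment therefore
  consists of a chain \<open>a 1, \<dots>, a m\<close>, one entry in each column, and a chain of entries \<open>b c\<close> in the
  columns \<open>c\<close> of some set \<open>S\<close> (locale \<open>aligned\<close>).  Being (3+1)-free leaves few possibilities for the
  relations between neighbouring columns, and the rules for \<open>L\<^sub>T(D)\<close> reduce to one bit for each
  two-element column: \<open>flip D c\<close> tells whether \<open>a c\<close> lies in the lower cell.  This gives a formula
  \<open>row D\<close> for the row of each element (\<open>fill_column_fill\<close>), and each row turns out to be a chain
  increasing from left to right (\<open>row_increasing\<close>).  An array is determined by its row function, so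
  everything else is a comparison of row functions; weights are preserved because the filling is a
  bijection onto \<open>D\<close>.

  On the side of diagrams, let \<open>D\<^sub>T\<close> be the image of the alignment of \<open>T\<close>.  Every member \<open>D\<close> of its
  component has the column sizes of \<open>D\<^sub>T\<close>, contains no three cells that go strictly down and weakly to
  the right, and has a choice of one cell in each column that goes weakly up from left to right
  (\<open>good\<close>).  The last two conditions are the part of Greene's theorem which says that the shape of
  \<open>D\<close> has at most two rows, the first of length \<open>m\<close>.  They survive the crystal operators, and \<open>D\<^sub>T\<close> is the only diagram
  satisfying them to which no raising operator applies (\<open>good_eq_highest\<close>).

  The map from diagrams to arrays does not commute with \<open>f\<^sub>r\<close> in general.  If the only relations of
  \<open>P\<close> are \<open>a\<^sub>1 < a\<^sub>2\<close>, \<open>b\<^sub>1 < a\<^sub>2\<close> and \<open>b\<^sub>1 < b\<^sub>2\<close>, and \<open>T\<close> has the rows \<open>a\<^sub>1, a\<^sub>2\<close> and \<open>b\<^sub>1, b\<^sub>2\<close>,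
  then it fails for \<open>r = 2\<close> and the diagram with columns \<open>{2, 3}\<close> and \<open>{1, 2}\<close>.  It does commute on
  enough edges to climb from any diagram to \<open>D\<^sub>T\<close>.  As long as \<open>e\<^sub>1\<close> applies, the
  climb uses it; along such an edge the run of entries that \<open>f\<^sub>1\<close> exchanges is exactly the run of
  columns whose bit changes (locale \<open>raised_first\<close>).  Once \<open>e\<^sub>1\<close> does not apply, the first nonempty
  row \<open>r + 1\<close> below row 2 lies entirely to the left of row \<open>r\<close>, and raising its last cell moves a
  single entry (\<open>raised_last\<close>).  All arrays of one tableau are thus connected to the array of
  \<open>D\<^sub>T\<close>, which is \<open>T\<close>.

  The same climb proves injectivity, because each step can be read off from the array alone.  The
  entry moved in the second kind of step is the greatest one of its row.  For the first kind, the
  function \<open>Gamma\<close>, computed from the array, detects whether \<open>e\<^sub>1\<close> applies and where the exchanged run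
  ends, and \<open>shifted_by_unique\<close> recovers its length.  Equal arrays therefore climb together to equal
  tableaux (\<open>rows_determine_highest\<close>), and with \<open>T\<close> known, \<open>D\<close> is read off from rows and columns.
\<close>

section \<open>Arrays with prescribed rows\<close>

lemma unique_opt_eq_Some: "unique_opt Q = Some x \<longleftrightarrow> Q x \<and> (\<forall>y. Q y \<longrightarrow> y = x)"
proof
  assume h: "unique_opt Q = Some x"
  then have ex: "\<exists>!x. Q x" unfolding unique_opt_def by (auto split: if_splits)
  with h have "x = (THE x. Q x)" unfolding unique_opt_def by simp
  with ex show "Q x \<and> (\<forall>y. Q y \<longrightarrow> y = x)" by (metis theI')
next
  assume h: "Q x \<and> (\<forall>y. Q y \<longrightarrow> y = x)"
  then have "\<exists>!x. Q x" by blast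
  moreover have "(THE x. Q x) = x" using h by blast
  ultimately show "unique_opt Q = Some x" unfolding unique_opt_def by simp
qed

locale finite_poset =
  fixes P :: "'a set" and le :: "'a rel"
  assumes finP: "finite P" and po: "partial_order_on P le"
begin

abbreviation less (infix "\<prec>" 50) where "x \<prec> y \<equiv> lt le x y"

lemma le_trans: "(x, y) \<in> le \<Longrightarrow> (y, z) \<in> le \<Longrightarrow> (x, z) \<in> le"
  using po unfolding partial_order_on_def preorder_on_def by (meson transD)

lemma le_antisym: "(x, y) \<in> le \<Longrightarrow> (y, x) \<in> le \<Longrightarrow> x = y"
  using po unfolding partial_order_on_def by (meson antisymD)

lemma le_refl: "x \<in> P \<Longrightarrow> (x, x) \<in> le"
  using po unfolding partial_order_on_def preorder_on_def by (meson refl_onD)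

lemma lt_irrefl [simp]: "\<not> x \<prec> x" by (simp add: lt_def)

lemma lt_trans: "x \<prec> y \<Longrightarrow> y \<prec> z \<Longrightarrow> x \<prec> z"
  unfolding lt_def using le_trans le_antisym by blast

lemma lt_asym: "x \<prec> y \<Longrightarrow> \<not> y \<prec> x"
  using lt_trans lt_irrefl by blast

lemma le_iff: "x \<in> P \<Longrightarrow> (x, y) \<in> le \<longleftrightarrow> x = y \<or> x \<prec> y"
  using le_refl by (auto simp: lt_def)

text \<open>A function \<open>\<rho>\<close> assigning rows to elements describes an array precisely when its fibres are chains;
  the position of \<open>x\<close> in its row is then \<open>rank \<rho> x\<close>.\<close>

definition row_chains :: "('a \<Rightarrow> nat) \<Rightarrow> bool" where
  "row_chains \<rho> \<longleftrightarrow> (\<forall>x\<in>P. 1 \<le> \<rho> x) \<and>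
     (\<forall>x\<in>P. \<forall>y\<in>P. \<rho> x = \<rho> y \<longrightarrow> x = y \<or> x \<prec> y \<or> y \<prec> x)"

definition rank :: "('a \<Rightarrow> nat) \<Rightarrow> 'a \<Rightarrow> nat" where
  "rank \<rho> x = card {y \<in> P. \<rho> y = \<rho> x \<and> (y, x) \<in> le}"

abbreviation arr :: "('a \<Rightarrow> nat) \<Rightarrow> 'a array" where
  "arr \<rho> \<equiv> array_of_rows P le \<rho>"

lemma rank_less:
  assumes "x \<in> P" "y \<in> P" "\<rho> x = \<rho> y" "x \<prec> y" shows "rank \<rho> x < rank \<rho> y"
  unfolding rank_def
proof (rule psubset_card_mono)
  show "finite {z \<in> P. \<rho> z = \<rho> y \<and> (z, y) \<in> le}" using finP by simp
  have "(x, y) \<in> le" using assms(4) by (simp add: lt_def)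
  moreover have "(y, x) \<notin> le" using assms(4) le_antisym by (auto simp: lt_def)
  ultimately show "{z \<in> P. \<rho> z = \<rho> x \<and> (z, x) \<in> le} \<subset> {z \<in> P. \<rho> z = \<rho> y \<and> (z, y) \<in> le}"
    using assms le_refl by (auto intro: le_trans)
qed

lemma rank_less_iff:
  assumes "row_chains \<rho>" "x \<in> P" "y \<in> P" "\<rho> x = \<rho> y"
  shows "rank \<rho> x < rank \<rho> y \<longleftrightarrow> x \<prec> y"
  using assms rank_less[of x y \<rho>] rank_less[of y x \<rho>] unfolding row_chains_def
  by (metis less_asym less_irrefl)

lemma rank_inj:
  assumes "row_chains \<rho>" "x \<in> P" "y \<in> P" "\<rho> x = \<rho> y" "rank \<rho> x = rank \<rho> y"
  shows "x = y"
  using assms rank_less[of x y \<rho>] rank_less[of y x \<rho>] unfolding row_chains_def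
  by (metis less_irrefl)

lemma rank_image:
  assumes "row_chains \<rho>"
  shows "rank \<rho> ` {x \<in> P. \<rho> x = i} = {1..card {x \<in> P. \<rho> x = i}}"
proof (rule card_subset_eq)
  let ?F = "{x \<in> P. \<rho> x = i}"
  have fin: "finite ?F" using finP by simp
  show "finite {1..card ?F}" by simp
  show "rank \<rho> ` ?F \<subseteq> {1..card ?F}"
  proof
    fix k assume "k \<in> rank \<rho> ` ?F"
    then obtain x where x: "x \<in> P" "\<rho> x = i" "k = rank \<rho> x" by auto
    have "k \<le> card ?F" unfolding x rank_def by (rule card_mono) (use fin x in auto)
    moreover have "{y \<in> P. \<rho> y = \<rho> x \<and> (y, x) \<in> le} \<noteq> {}" using x le_refl by auto
    hence "k \<ge> 1" unfolding x(3) rank_def using finP by (simp add: Suc_le_eq card_gt_0_iff)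
    ultimately show "k \<in> {1..card ?F}" by simp
  qed
  have "inj_on (rank \<rho>) ?F" using rank_inj[OF assms] by (auto intro!: inj_onI)
  thus "card (rank \<rho> ` ?F) = card {1..card ?F}" by (simp add: card_image)
qed

lemma arr_eq_Some:
  assumes "row_chains \<rho>"
  shows "arr \<rho> (i, j) = Some x \<longleftrightarrow> x \<in> P \<and> \<rho> x = i \<and> rank \<rho> x = j"
  unfolding array_of_rows_def using rank_inj[OF assms]
  by (auto simp: unique_opt_eq_Some rank_def)

lemma arr_defined_iff:
  assumes "row_chains \<rho>"
  shows "arr \<rho> (i, j) \<noteq> None \<longleftrightarrow> 1 \<le> j \<and> j \<le> card {x \<in> P. \<rho> x = i}"
proof -
  have "arr \<rho> (i, j) \<noteq> None \<longleftrightarrow> j \<in> rank \<rho> ` {x \<in> P. \<rho> x = i}"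
    using arr_eq_Some[OF assms] by (auto simp: image_iff)
  thus ?thesis unfolding rank_image[OF assms] by simp
qed

lemma arr_in_P_arrays:
  assumes "row_chains \<rho>" shows "arr \<rho> \<in> P_arrays P le"
  unfolding P_arrays_def
proof (intro CollectI conjI allI impI)
  note S = arr_eq_Some[OF assms]
  show "dom (arr \<rho>) \<subseteq> {1..} \<times> {1..}"
  proof clarsimp
    fix i j x assume h: "arr \<rho> (i, j) = Some x"
    have "1 \<le> j" using arr_defined_iff[OF assms, of i j] h by simp
    moreover have "1 \<le> i" using h assms S by (auto simp: row_chains_def)
    ultimately show "Suc 0 \<le> i \<and> Suc 0 \<le> j" by simp
  qed
  show "ran (arr \<rho>) = P" using S by (auto simp: ran_def)
  show "inj_on (arr \<rho>) (dom (arr \<rho>))"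
  proof (rule inj_onI)
    fix p q assume h: "p \<in> dom (arr \<rho>)" "q \<in> dom (arr \<rho>)" "arr \<rho> p = arr \<rho> q"
    obtain x where "arr \<rho> p = Some x" using h(1) by auto
    then show "p = q" using h(3) S[of "fst p" "snd p" x] S[of "fst q" "snd q" x]
      by (auto simp: prod_eq_iff)
  qed
  fix i j x assume h: "arr \<rho> (i, j) = Some x \<and> 1 < j"
  then have "arr \<rho> (i, j) \<noteq> None" by simp
  then have "1 \<le> j - 1 \<and> j - 1 \<le> card {x \<in> P. \<rho> x = i}"
    unfolding arr_defined_iff[OF assms] using h by linarith
  then have "arr \<rho> (i, j - 1) \<noteq> None" unfolding arr_defined_iff[OF assms] .
  then obtain y where y: "arr \<rho> (i, j - 1) = Some y" by auto
  have "rank \<rho> y < rank \<rho> x" using h y S by auto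
  then have "y \<prec> x" using rank_less_iff[OF assms, of y x] h y S by auto
  thus "\<exists>y. arr \<rho> (i, j - 1) = Some y \<and> y \<prec> x" using y by blast
qed

lemma wt_arr: "row_chains \<rho> \<Longrightarrow> wt_array (arr \<rho>) i = card {x \<in> P. \<rho> x = i}"
proof -
  assume "row_chains \<rho>"
  then have "{j. arr \<rho> (i, j) \<noteq> None} = {1..card {x \<in> P. \<rho> x = i}}"
    using arr_defined_iff[of \<rho> i] by auto
  thus ?thesis by (simp add: wt_array_def)
qed

lemma row_of_eq:
  assumes "inj_on A (dom A)" "A (i, j) = Some x" shows "row_of A x = i"
proof -
  have "(THE p. A p = Some x) = (i, j)"
  proof (rule the_equality)
    show "A (i, j) = Some x" by fact
    fix p assume "A p = Some x"
    thus "p = (i, j)" using assms by (intro inj_onD[OF assms(1)]) auto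
  qed
  thus ?thesis by (simp add: row_of_def)
qed

lemma row_of_arr: "row_chains \<rho> \<Longrightarrow> x \<in> P \<Longrightarrow> row_of (arr \<rho>) x = \<rho> x"
proof -
  assume a: "row_chains \<rho>" "x \<in> P"
  have "arr \<rho> (\<rho> x, rank \<rho> x) = Some x" using arr_eq_Some[OF a(1)] a(2) by simp
  moreover have "inj_on (arr \<rho>) (dom (arr \<rho>))"
    using arr_in_P_arrays[OF a(1)] by (simp add: P_arrays_def)
  ultimately show ?thesis by (rule row_of_eq[rotated])
qed

lemma array_of_rows_cong: "(\<And>x. x \<in> P \<Longrightarrow> \<rho> x = \<rho>' x) \<Longrightarrow> arr \<rho> = arr \<rho>'"
proof -
  assume h: "\<And>x. x \<in> P \<Longrightarrow> \<rho> x = \<rho>' x"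
  have "(\<lambda>x. x \<in> P \<and> \<rho> x = i \<and> card {y \<in> P. \<rho> y = i \<and> (y, x) \<in> le} = j)
      = (\<lambda>x. x \<in> P \<and> \<rho>' x = i \<and> card {y \<in> P. \<rho>' y = i \<and> (y, x) \<in> le} = j)" for i j
  proof -
    have "{y \<in> P. \<rho> y = i \<and> (y, x) \<in> le} = {y \<in> P. \<rho>' y = i \<and> (y, x) \<in> le}" for x
      using h by auto
    thus ?thesis using h by auto
  qed
  thus ?thesis unfolding array_of_rows_def by simp
qed

text \<open>Since every entry beyond the first has a left neighbour, a row has no gaps and can be listed as a
  finite sequence, indexed from 1 like the columns.\<close>

lemma row_enumeration:
  assumes A: "A \<in> P_arrays P le"
  obtains \<alpha> M where "\<And>k. A (i, k) = (if 1 \<le> k \<and> k \<le> M then Some (\<alpha> k) else None)"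
    and "\<And>k l. 1 \<le> k \<Longrightarrow> k < l \<Longrightarrow> l \<le> M \<Longrightarrow> \<alpha> k \<prec> \<alpha> l"
proof -
  define J where "J = {k. A (i, k) \<noteq> None}"
  have domA: "dom A \<subseteq> {1..} \<times> {1..}" and ranA: "ran A = P" and inj: "inj_on A (dom A)"
    and step: "\<And>j x. A (i, j) = Some x \<Longrightarrow> j > 1 \<Longrightarrow> \<exists>y. A (i, j - 1) = Some y \<and> y \<prec> x"
    using A unfolding P_arrays_def by auto
  have i1: "inj_on (\<lambda>k. the (A (i, k))) J" and i2: "(\<lambda>k. the (A (i, k))) ` J \<subseteq> P"
  proof -
    show "inj_on (\<lambda>k. the (A (i, k))) J"
    proof (rule inj_onI)
      fix k l assume h: "k \<in> J" "l \<in> J" "the (A (i, k)) = the (A (i, l))"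
      then obtain y z where "A (i, k) = Some y" "A (i, l) = Some z" by (auto simp: J_def)
      with h have "A (i, k) = A (i, l)" "(i, k) \<in> dom A" "(i, l) \<in> dom A" by auto
      thus "k = l" using inj_onD[OF inj] by blast
    qed
    show "(\<lambda>k. the (A (i, k))) ` J \<subseteq> P" unfolding ranA[symmetric] by (auto simp: J_def intro: ranI)
  qed
  have finJ: "finite J" by (rule inj_on_finite[OF i1 i2 finP])
  define M where "M = Max (insert 0 J)"
  have le: "k \<in> J \<Longrightarrow> k \<le> M" for k using finJ by (simp add: M_def)
  have pos: "k \<in> J \<Longrightarrow> 1 \<le> k" for k using domA by (auto simp: J_def)
  have down: "k \<in> J \<Longrightarrow> 1 < k \<Longrightarrow> k - 1 \<in> J" for k
  proof -
    assume "k \<in> J" "1 < k"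
    then obtain x where "A (i, k) = Some x" by (auto simp: J_def)
    from step[OF this \<open>1 < k\<close>] show "k - 1 \<in> J" by (auto simp: J_def)
  qed
  have all: "1 \<le> l \<Longrightarrow> l \<le> k \<Longrightarrow> k \<in> J \<Longrightarrow> l \<in> J" for k l
  proof (induction k)
    case (Suc k)
    show ?case
    proof (cases "l = Suc k")
      case False
      with Suc.prems have "1 < Suc k" "l \<le> k" by auto
      with Suc.IH Suc.prems down[of "Suc k"] show ?thesis by simp
    qed (use Suc in simp)
  qed simp
  have J: "k \<in> J \<longleftrightarrow> 1 \<le> k \<and> k \<le> M" for k
  proof
    assume "1 \<le> k \<and> k \<le> M"
    moreover have "M \<in> insert 0 J" unfolding M_def using finJ by (intro Max_in) auto
    ultimately show "k \<in> J" using all[of k M] by auto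
  qed (use le pos in auto)
  define \<alpha> where "\<alpha> k = the (A (i, k))" for k
  have e: "A (i, k) = (if 1 \<le> k \<and> k \<le> M then Some (\<alpha> k) else None)" for k
    using J[of k] by (auto simp: J_def \<alpha>_def)
  have mono: "1 \<le> k \<Longrightarrow> k < l \<Longrightarrow> l \<le> M \<Longrightarrow> \<alpha> k \<prec> \<alpha> l" for k l
  proof (induction l)
    case (Suc l)
    have "\<alpha> l \<prec> \<alpha> (Suc l)"
      using step[of "Suc l" "\<alpha> (Suc l)"] e[of "Suc l"] e[of l] Suc.prems by (auto split: if_splits)
    then show ?case using Suc.IH Suc.prems lt_trans[of "\<alpha> k" "\<alpha> l"] by (cases "k = l") (auto simp del: One_nat_def)
  qed simp
  show thesis by (rule that[OF e mono])
qed

text \<open>Each row being a chain, the order of its entries is forced, and nothing but the row function is left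
  of an array.\<close>

lemma P_array_eq_arr:
  assumes A: "A \<in> P_arrays P le"
  shows "row_chains (row_of A)" "A = arr (row_of A)"
proof -
  have domA: "dom A \<subseteq> {1..} \<times> {1..}" and ranA: "ran A = P" and inj: "inj_on A (dom A)"
    using A unfolding P_arrays_def by auto
  have key: "x \<in> P \<and> row_of A x = i \<and> rank (row_of A) x = j" if h: "A (i, j) = Some x" for i j x
  proof -
    obtain \<alpha> M where e: "\<And>k. A (i, k) = (if 1 \<le> k \<and> k \<le> M then Some (\<alpha> k) else None)"
      and mono: "\<And>k l. 1 \<le> k \<Longrightarrow> k < l \<Longrightarrow> l \<le> M \<Longrightarrow> \<alpha> k \<prec> \<alpha> l"
      by (rule row_enumeration[OF A, of i]) (rule that; assumption)
    have j: "1 \<le> j" "j \<le> M" "x = \<alpha> j" using h e[of j] by (auto split: if_splits)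
    have xP: "x \<in> P" using h unfolding ranA[symmetric] by (rule ranI)
    have r: "row_of A x = i" using row_of_eq[OF inj h] .
    have "{y \<in> P. row_of A y = row_of A x \<and> (y, x) \<in> le} = \<alpha> ` {1..j}"
    proof (intro equalityI subsetI)
      fix y assume "y \<in> {y \<in> P. row_of A y = row_of A x \<and> (y, x) \<in> le}"
      then have y: "y \<in> P" "row_of A y = i" "(y, x) \<in> le" using r by auto
      then obtain i' k where "A (i', k) = Some y" unfolding ranA[symmetric] by (auto simp: ran_def)
      then have "A (i, k) = Some y" using row_of_eq[OF inj, of i' k y] y(2) by simp
      then have k: "1 \<le> k" "k \<le> M" "y = \<alpha> k" using e[of k] by (auto split: if_splits)
      have "k \<le> j"
      proof (rule ccontr)
        assume "\<not> k \<le> j"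
        then have "x \<prec> y" using mono[of j k] j k by auto
        thus False using y(3) le_antisym by (auto simp: lt_def)
      qed
      thus "y \<in> \<alpha> ` {1..j}" using k by auto
    next
      fix y assume "y \<in> \<alpha> ` {1..j}"
      then obtain k where k: "1 \<le> k" "k \<le> j" "y = \<alpha> k" by auto
      then have "A (i, k) = Some y" using e[of k] j by auto
      then have "y \<in> P" "row_of A y = i" using row_of_eq[OF inj, of i k y]
        unfolding ranA[symmetric] by (auto intro: ranI)
      moreover have "y = x \<or> y \<prec> x" using mono[of k j] k j by (cases "k = j") auto
      ultimately show "y \<in> {y \<in> P. row_of A y = row_of A x \<and> (y, x) \<in> le}"
        using r le_iff by auto
    qed
    moreover have "inj_on \<alpha> {1..j}"
    proof (rule inj_onI)
      fix k l assume "k \<in> {1..j}" "l \<in> {1..j}" "\<alpha> k = \<alpha> l"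
      thus "k = l" using mono[of k l] mono[of l k] j by (cases k l rule: linorder_cases) auto
    qed
    ultimately have "rank (row_of A) x = j" unfolding rank_def by (simp add: card_image)
    thus ?thesis using r xP by simp
  qed
  show rc: "row_chains (row_of A)"
    unfolding row_chains_def
  proof (intro conjI ballI impI)
    fix x assume "x \<in> P"
    then obtain i k where "A (i, k) = Some x" unfolding ranA[symmetric] by (auto simp: ran_def)
    moreover then have "(i, k) \<in> dom A" by auto
    ultimately show "1 \<le> row_of A x" using key domA by auto
  next
    fix x y assume xy: "x \<in> P" "y \<in> P" "row_of A x = row_of A y"
    obtain i k where ik: "A (i, k) = Some x" using xy unfolding ranA[symmetric] by (auto simp: ran_def)
    obtain i' l where il': "A (i', l) = Some y" using xy unfolding ranA[symmetric] by (auto simp: ran_def)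
    have "i' = i" using key[OF ik] key[OF il'] xy by simp
    with il' have il: "A (i, l) = Some y" by simp
    obtain \<alpha> M where e: "\<And>k. A (i, k) = (if 1 \<le> k \<and> k \<le> M then Some (\<alpha> k) else None)"
      and mono: "\<And>k l. 1 \<le> k \<Longrightarrow> k < l \<Longrightarrow> l \<le> M \<Longrightarrow> \<alpha> k \<prec> \<alpha> l"
      by (rule row_enumeration[OF A, of i]) (rule that; assumption)
    have "1 \<le> k" "k \<le> M" "x = \<alpha> k" "1 \<le> l" "l \<le> M" "y = \<alpha> l"
      using ik il e[of k] e[of l] by (auto split: if_splits)
    thus "x = y \<or> x \<prec> y \<or> y \<prec> x" using mono[of k l] mono[of l k] by (metis linorder_neqE_nat)
  qed
  show "A = arr (row_of A)"
  proof
    fix q :: "nat \<times> nat" obtain i j where q: "q = (i, j)" by force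
    have "A (i, j) = Some x \<longleftrightarrow> arr (row_of A) (i, j) = Some x" for x
    proof
      assume "A (i, j) = Some x" thus "arr (row_of A) (i, j) = Some x"
        using key arr_eq_Some[OF rc] by auto
    next
      assume "arr (row_of A) (i, j) = Some x"
      then have x: "x \<in> P" "row_of A x = i" "rank (row_of A) x = j" using arr_eq_Some[OF rc] by auto
      obtain i' k where "A (i', k) = Some x" using x(1) unfolding ranA[symmetric] by (auto simp: ran_def)
      thus "A (i, j) = Some x" using key x by auto
    qed
    thus "A q = arr (row_of A) q" unfolding q by (metis not_Some_eq)
  qed
qed

end

section \<open>The alignment of two chains\<close>

text \<open>
  The chains \<open>\<alpha>\<close> and \<open>\<beta>\<close> in rows \<open>r\<close> and \<open>r + 1\<close> are cut at a place which no element crosses during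
  the alignment: \<open>\<beta> 1, \<dots>, \<beta> B\<close> fill the columns up to \<open>B\<close>, \<open>\<alpha> 1, \<dots>, \<alpha> (p - 1)\<close> stay within these
  columns, and \<open>\<alpha> p, \<alpha> (p + 1), \<dots>\<close> occupy the columns from \<open>B + 1\<close> on.  The conditions \<open>prefix\<close> and
  \<open>suffix\<close> say that the numbers \<open>C(\<alpha> k)\<close> respect this division.  With \<open>p = 1\<close> and \<open>B = 0\<close> the locale
  covers tableaux; for the operator \<open>f\<^sub>r\<close>, the element \<open>\<alpha> p\<close> is the one at which the moved run starts.
\<close>

locale two_chains = finite_poset P le for P :: "'a set" and le +
  fixes A :: "'a array" and r :: nat and \<alpha> \<beta> :: "nat \<Rightarrow> 'a" and M n p B :: nat
  assumes injA: "inj_on A (dom A)"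
    and row_upper: "\<And>k. A (r, k) = (if 1 \<le> k \<and> k \<le> M then Some (\<alpha> k) else None)"
    and row_lower: "\<And>k. A (Suc r, k) = (if 1 \<le> k \<and> k \<le> n then Some (\<beta> k) else None)"
    and upper_mono: "\<And>k l. 1 \<le> k \<Longrightarrow> k < l \<Longrightarrow> l \<le> M \<Longrightarrow> lt le (\<alpha> k) (\<alpha> l)"
    and lower_mono: "\<And>k l. 1 \<le> k \<Longrightarrow> k < l \<Longrightarrow> l \<le> n \<Longrightarrow> lt le (\<beta> k) (\<beta> l)"
    and p: "1 \<le> p" "p \<le> M + 1" and B: "B \<le> n"
    and before: "p \<le> M \<Longrightarrow> 1 \<le> B \<Longrightarrow> lt le (\<beta> B) (\<alpha> p)"
    and prefix: "\<And>k j. 1 \<le> k \<Longrightarrow> k < p \<Longrightarrow> 1 \<le> j \<Longrightarrow> j \<le> n \<Longrightarrow> lt le (\<beta> j) (\<alpha> k) \<Longrightarrow> j + (p - k) \<le> B"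
    and prefix_len: "p \<le> B + 1"
    and suffix: "\<And>k j. p \<le> k \<Longrightarrow> k \<le> M \<Longrightarrow> 1 \<le> j \<Longrightarrow> j \<le> n \<Longrightarrow> lt le (\<beta> j) (\<alpha> k) \<Longrightarrow> j + p \<le> B + k"
    and suffix_len: "n + p \<le> B + M + 1"
begin

definition elems where "elems = \<alpha> ` {1..M} \<union> \<beta> ` {1..n}"

text \<open>Elements keep their rows during the alignment, so its stages are given by column functions \<open>\<gamma>\<close>.\<close>

definition placed :: "('a \<Rightarrow> nat) \<Rightarrow> 'a filling" where
  "placed \<gamma> x = (if x \<in> \<alpha> ` {1..M} then Some (r, \<gamma> x)
             else if x \<in> \<beta> ` {1..n} then Some (Suc r, \<gamma> x) else None)"

definition can_move :: "('a \<Rightarrow> nat) \<Rightarrow> 'a \<Rightarrow> bool" where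
  "can_move \<gamma> x \<longleftrightarrow> x \<in> elems \<and> (\<exists>y\<in>elems. \<gamma> y = \<gamma> x + 1) \<and> (\<forall>y\<in>elems. \<gamma> y = \<gamma> x + 1 \<longrightarrow> \<not> x \<prec> y)"

lemma finite_elems: "finite elems" by (simp add: elems_def)

lemma upper_inj: "\<lbrakk>1 \<le> i; i \<le> M; 1 \<le> j; j \<le> M; \<alpha> i = \<alpha> j\<rbrakk> \<Longrightarrow> i = j"
  using upper_mono[of i j] upper_mono[of j i] by (cases i j rule: linorder_cases) auto

lemma lower_inj: "\<lbrakk>1 \<le> i; i \<le> n; 1 \<le> j; j \<le> n; \<beta> i = \<beta> j\<rbrakk> \<Longrightarrow> i = j"
  using lower_mono[of i j] lower_mono[of j i] by (cases i j rule: linorder_cases) auto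

lemma rows_disjoint: "\<lbrakk>1 \<le> i; i \<le> M; 1 \<le> j; j \<le> n\<rbrakk> \<Longrightarrow> \<alpha> i \<noteq> \<beta> j"
proof
  assume h: "1 \<le> i" "i \<le> M" "1 \<le> j" "j \<le> n" "\<alpha> i = \<beta> j"
  then have "A (r, i) = A (Suc r, j)" "(r, i) \<in> dom A" "(Suc r, j) \<in> dom A"
    using row_upper[of i] row_lower[of j] by auto
  thus False using inj_onD[OF injA] by fastforce
qed

lemma placed_upper: "1 \<le> i \<Longrightarrow> i \<le> M \<Longrightarrow> placed \<gamma> (\<alpha> i) = Some (r, \<gamma> (\<alpha> i))"
  by (auto simp: placed_def)

lemma placed_lower: "1 \<le> j \<Longrightarrow> j \<le> n \<Longrightarrow> placed \<gamma> (\<beta> j) = Some (Suc r, \<gamma> (\<beta> j))"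
proof -
  assume j: "1 \<le> j" "j \<le> n"
  then have "\<beta> j \<notin> \<alpha> ` {1..M}" using rows_disjoint[of _ j] by fastforce
  then show ?thesis using j by (simp add: placed_def)
qed

lemma placed_eq_Some: "placed \<gamma> x = Some (i, c) \<Longrightarrow> x \<in> elems \<and> \<gamma> x = c"
  by (auto simp: placed_def elems_def split: if_splits)

lemma placed_defined: "x \<in> elems \<Longrightarrow> \<exists>i. placed \<gamma> x = Some (i, \<gamma> x)"
  by (auto simp: placed_def elems_def)

lemma movable_placed: "movable le (placed \<gamma>) x \<longleftrightarrow> can_move \<gamma> x"
  proof -
  have "(\<exists>y j. placed \<gamma> y = Some (j, c)) \<longleftrightarrow> (\<exists>y\<in>elems. \<gamma> y = c)" for c
    using placed_eq_Some[of \<gamma>] placed_defined[of _ \<gamma>] by blast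
  moreover have "(\<forall>y j. placed \<gamma> y = Some (j, c) \<longrightarrow> \<not> x \<prec> y) \<longleftrightarrow> (\<forall>y\<in>elems. \<gamma> y = c \<longrightarrow> \<not> x \<prec> y)" for c
    using placed_eq_Some[of \<gamma>] placed_defined[of _ \<gamma>] by blast
  moreover have "(\<exists>i c. placed \<gamma> x = Some (i, c) \<and> Q c) \<longleftrightarrow> x \<in> elems \<and> Q (\<gamma> x)" for Q
    using placed_eq_Some[of \<gamma> x] placed_defined[of x \<gamma>] by blast
  ultimately show ?thesis unfolding movable_def can_move_def by simp
qed

lemma placed_update: "x \<in> elems \<Longrightarrow> placed \<gamma> x = Some (i, c) \<Longrightarrow> (placed \<gamma>)(x \<mapsto> (i, c')) = placed (\<gamma>(x := c'))"
  by (rule ext) (auto simp: placed_def split: if_splits)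

lemma align_step_placed:
  assumes "\<exists>x. can_move \<gamma> x"
  shows "\<exists>x. can_move \<gamma> x \<and> align_step le (placed \<gamma>) = placed (\<gamma>(x := \<gamma> x + 1))"
proof -
  let ?x = "SOME x. rightmost_movable le (placed \<gamma>) x"
  let ?S = "{x. can_move \<gamma> x}"
  have fin: "finite ?S" by (rule finite_subset[OF _ finite_elems]) (auto simp: can_move_def)
  have "?S \<noteq> {}" using assms by simp
  then have "Max (\<gamma> ` ?S) \<in> \<gamma> ` ?S" using fin by (intro Max_in) auto
  then obtain x where x: "can_move \<gamma> x" "Max (\<gamma> ` ?S) = \<gamma> x" by auto
  have xmax: "\<gamma> y \<le> \<gamma> x" if "can_move \<gamma> y" for y
    unfolding x(2)[symmetric] using fin that by (intro Max_ge) auto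
  have col: "can_move \<gamma> y \<Longrightarrow> snd (the (placed \<gamma> y)) = \<gamma> y" for y
    using placed_defined[of y \<gamma>] by (auto simp: can_move_def)
  have "rightmost_movable le (placed \<gamma>) x"
    unfolding rightmost_movable_def movable_placed using x(1) xmax col by auto
  then have "rightmost_movable le (placed \<gamma>) ?x" by (rule someI)
  then have m: "can_move \<gamma> ?x" by (simp add: rightmost_movable_def movable_placed)
  then have xX: "?x \<in> elems" by (simp add: can_move_def)
  obtain i where i: "placed \<gamma> ?x = Some (i, \<gamma> ?x)" using placed_defined[OF xX] by blast
  have "align_step le (placed \<gamma>) = (placed \<gamma>)(?x \<mapsto> (i, \<gamma> ?x + 1))"
    unfolding align_step_def movable_placed using assms i by (simp add: Let_def)
  also have "\<dots> = placed (\<gamma>(?x := \<gamma> ?x + 1))" by (rule placed_update[OF xX i])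
  finally show ?thesis using m by blast
qed

text \<open>The upper chain from \<open>p\<close> on and the lower chain up to \<open>B\<close> never move, being blocked by their right
  neighbours and, at column \<open>B\<close>, by \<open>\<alpha> p\<close>.  An element \<open>\<beta> j\<close> with \<open>B < j\<close> can only enter a column
  whose upper entry it is not below; this is the last condition.\<close>

definition invariant :: "('a \<Rightarrow> nat) \<Rightarrow> bool" where
  "invariant \<gamma> \<longleftrightarrow>
     (\<forall>i. p \<le> i \<and> i \<le> M \<longrightarrow> \<gamma> (\<alpha> i) + p = B + 1 + i) \<and>
     (\<forall>i. 1 \<le> i \<and> i < p \<longrightarrow> 1 \<le> \<gamma> (\<alpha> i) \<and> \<gamma> (\<alpha> i) \<le> B) \<and>
     (\<forall>i. 1 \<le> i \<and> i + 1 < p \<longrightarrow> \<gamma> (\<alpha> i) < \<gamma> (\<alpha> (i + 1))) \<and>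
     (\<forall>j. 1 \<le> j \<and> j \<le> B \<longrightarrow> \<gamma> (\<beta> j) = j) \<and>
     (\<forall>j. B < j \<and> j \<le> n \<longrightarrow> j \<le> \<gamma> (\<beta> j) \<and> \<gamma> (\<beta> j) + p \<le> B + 1 + M) \<and>
     (\<forall>j. B < j \<and> j + 1 \<le> n \<longrightarrow> \<gamma> (\<beta> j) < \<gamma> (\<beta> (j + 1))) \<and>
     (\<forall>j k. B < j \<and> j \<le> n \<and> p \<le> k \<and> k \<le> M \<and> k + B + 1 = p + \<gamma> (\<beta> j) \<longrightarrow> \<not> \<beta> j \<prec> \<alpha> k)"

lemma invariantD:
  assumes "invariant \<gamma>"
  shows "\<And>i. p \<le> i \<Longrightarrow> i \<le> M \<Longrightarrow> \<gamma> (\<alpha> i) + p = B + 1 + i"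
    and "\<And>i. 1 \<le> i \<Longrightarrow> i < p \<Longrightarrow> 1 \<le> \<gamma> (\<alpha> i) \<and> \<gamma> (\<alpha> i) \<le> B"
    and "\<And>i. 1 \<le> i \<Longrightarrow> i + 1 < p \<Longrightarrow> \<gamma> (\<alpha> i) < \<gamma> (\<alpha> (i + 1))"
    and "\<And>j. 1 \<le> j \<Longrightarrow> j \<le> B \<Longrightarrow> \<gamma> (\<beta> j) = j"
    and "\<And>j. B < j \<Longrightarrow> j \<le> n \<Longrightarrow> j \<le> \<gamma> (\<beta> j) \<and> \<gamma> (\<beta> j) + p \<le> B + 1 + M"
    and "\<And>j. B < j \<Longrightarrow> j + 1 \<le> n \<Longrightarrow> \<gamma> (\<beta> j) < \<gamma> (\<beta> (j + 1))"
    and "\<And>j k. B < j \<Longrightarrow> j \<le> n \<Longrightarrow> p \<le> k \<Longrightarrow> k \<le> M \<Longrightarrow> k + B + 1 = p + \<gamma> (\<beta> j) \<Longrightarrow> \<not> \<beta> j \<prec> \<alpha> k"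
  using assms by (simp_all add: invariant_def)

lemma elems_cases:
  assumes "x \<in> elems"
  obtains (U1) i where "1 \<le> i" "i < p" "i \<le> M" "x = \<alpha> i"
  | (U2) i where "p \<le> i" "i \<le> M" "x = \<alpha> i"
  | (L1) j where "1 \<le> j" "j \<le> B" "x = \<beta> j"
  | (L2) j where "B < j" "j \<le> n" "x = \<beta> j"
proof -
  consider i where "1 \<le> i" "i \<le> M" "x = \<alpha> i" | j where "1 \<le> j" "j \<le> n" "x = \<beta> j"
    using assms by (auto simp: elems_def)
  then show thesis
  proof cases
    case (1 i) then show thesis using U1[of i] U2[of i] by (cases "i < p") auto
  next
    case (2 j) then show thesis using L1[of j] L2[of j] by (cases "j \<le> B") auto
  qed
qed

lemma in_elems: "1 \<le> i \<Longrightarrow> i \<le> M \<Longrightarrow> \<alpha> i \<in> elems" "1 \<le> j \<Longrightarrow> j \<le> n \<Longrightarrow> \<beta> j \<in> elems"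
  by (auto simp: elems_def)

lemma invariant_col_bound:
  assumes "invariant \<gamma>" "x \<in> elems" shows "\<gamma> x + p \<le> B + 1 + M"
using assms(2) proof (cases rule: elems_cases)
  case (U1 i) then show ?thesis using invariantD(2)[OF assms(1), of i] p by simp
next
  case (U2 i) then show ?thesis using invariantD(1)[OF assms(1), of i] by simp
next
  case (L1 j) then show ?thesis using invariantD(4)[OF assms(1), of j] p prefix_len suffix_len B by simp
next
  case (L2 j) then show ?thesis using invariantD(5)[OF assms(1), of j] by simp
qed

text \<open>Every admissible move preserves the invariant, in particular the one selected by \<open>align_step\<close>.\<close>

lemma invariant_step:
  assumes I: "invariant \<gamma>" and m: "can_move \<gamma> x" shows "invariant (\<gamma>(x := \<gamma> x + 1))"
proof -
  note I1 = invariantD(1)[OF I] and I2 = invariantD(2)[OF I] and I3 = invariantD(3)[OF I] and I4 = invariantD(4)[OF I]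
    and I5 = invariantD(5)[OF I] and I6 = invariantD(6)[OF I] and I7 = invariantD(7)[OF I]
  have xX: "x \<in> elems" using m by (simp add: can_move_def)
  obtain y where y: "y \<in> elems" "\<gamma> y = \<gamma> x + 1" using m by (auto simp: can_move_def)
  have ng: "\<And>z. z \<in> elems \<Longrightarrow> \<gamma> z = \<gamma> x + 1 \<Longrightarrow> \<not> x \<prec> z" using m by (auto simp: can_move_def)
  have nbound: "\<gamma> x + 1 + p \<le> B + 1 + M" using invariant_col_bound[OF I y(1)] y(2) by simp
  show ?thesis
  using xX proof (cases rule: elems_cases)
    case (U1 i)
    \<comment> \<open>An early element of the upper chain moves, but cannot enter column \<open>B + 1\<close>: that column
      contains \<open>\<alpha> p\<close>, which is larger, or is empty.\<close>
    have "\<gamma> (\<alpha> i) \<noteq> B"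
    proof
      assume h: "\<gamma> (\<alpha> i) = B"
      have "p \<le> M" using nbound h U1 by simp
      then have "\<gamma> (\<alpha> p) = B + 1" using I1[of p] by simp
      then show False using ng[of "\<alpha> p"] in_elems(1)[of p] upper_mono[of i p] U1 h p \<open>p \<le> M\<close> by simp
    qed
    then have c: "\<gamma> (\<alpha> i) + 1 \<le> B" using I2[of i] U1 by simp
    have nx: "\<gamma> (\<alpha> (i+1)) \<noteq> \<gamma> (\<alpha> i) + 1" if "i + 1 < p"
      using ng[of "\<alpha> (i+1)"] in_elems(1)[of "i+1"] upper_mono[of i "i+1"] that p U1 by auto
    have eq: "k = i" if "1 \<le> k" "k \<le> M" "\<alpha> k = x" for k using upper_inj[of k i] that U1 by simp
    have neq: "\<beta> j \<noteq> x" if "1 \<le> j" "j \<le> n" for j using rows_disjoint[of i j] that U1 by auto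
    show ?thesis unfolding invariant_def
    proof (intro conjI allI impI)
      fix k assume k: "p \<le> k \<and> k \<le> M"
      then have "\<alpha> k \<noteq> x" using eq[of k] U1 p by auto
      then show "(\<gamma>(x := \<gamma> x + 1)) (\<alpha> k) + p = B + 1 + k" using I1 k by simp
    next
      fix k assume k: "1 \<le> k \<and> k < p"
      show "1 \<le> (\<gamma>(x := \<gamma> x + 1)) (\<alpha> k)" using I2 k by simp
      show "(\<gamma>(x := \<gamma> x + 1)) (\<alpha> k) \<le> B" using I2 k c U1 by simp
    next
      fix k assume k: "1 \<le> k \<and> k + 1 < p"
      have "\<gamma> (\<alpha> k) < \<gamma> (\<alpha> (k+1))" using I3 k by simp
      moreover have "\<alpha> k = x \<Longrightarrow> k = i" using eq[of k] k p by simp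
      moreover have "\<alpha> (k+1) = x \<Longrightarrow> k + 1 = i" using eq[of "k+1"] k p by simp
      ultimately show "(\<gamma>(x := \<gamma> x + 1)) (\<alpha> k) < (\<gamma>(x := \<gamma> x + 1)) (\<alpha> (k + 1))"
        using nx k U1 by auto
    qed (use neq I4 I5 I6 I7 B in auto)
  next
    case (U2 i)
    show ?thesis
    proof (cases "i = M")
      case True then show ?thesis using nbound I1[of i] U2 by simp
    next
      case False
      then have "\<gamma> (\<alpha> (i+1)) = \<gamma> x + 1" using I1[of i] I1[of "i+1"] U2 by simp
      then show ?thesis using ng[of "\<alpha> (i+1)"] in_elems(1)[of "i+1"] upper_mono[of i "i+1"] U2 p False by simp
    qed
  next
    case (L1 j)
    show ?thesis
    proof (cases "j = B")
      case True
      have "p \<le> M" using nbound True L1 I4[of j] by simp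
      then have "\<gamma> (\<alpha> p) = B + 1" using I1[of p] by simp
      then show ?thesis using ng[of "\<alpha> p"] in_elems(1)[of p] before L1 True p \<open>p \<le> M\<close> I4[of j] by simp
    next
      case False
      then show ?thesis
        using ng[of "\<beta> (j+1)"] in_elems(2)[of "j+1"] lower_mono[of j "j+1"] L1 B I4[of j] I4[of "j+1"] by simp
    qed
  next
    case (L2 j)
    have nx: "\<gamma> (\<beta> (j+1)) \<noteq> \<gamma> (\<beta> j) + 1" if "j + 1 \<le> n"
      using ng[of "\<beta> (j+1)"] in_elems(2)[of "j+1"] lower_mono[of j "j+1"] that L2 by auto
    have eq: "k = j" if "1 \<le> k" "k \<le> n" "\<beta> k = x" for k using lower_inj[of k j] that L2 by simp
    have neq: "\<alpha> i \<noteq> x" if "1 \<le> i" "i \<le> M" for i using rows_disjoint[of i j] that L2 by auto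
    show ?thesis unfolding invariant_def
    proof (intro conjI allI impI)
      fix i assume "p \<le> i \<and> i \<le> M"
      then show "(\<gamma>(x := \<gamma> x + 1)) (\<alpha> i) + p = B + 1 + i" using I1 neq[of i] p by simp
    next
      fix i assume "1 \<le> i \<and> i < p"
      then show "1 \<le> (\<gamma>(x := \<gamma> x + 1)) (\<alpha> i)" "(\<gamma>(x := \<gamma> x + 1)) (\<alpha> i) \<le> B"
        using I2 neq[of i] p by simp_all
    next
      fix i assume "1 \<le> i \<and> i + 1 < p"
      then show "(\<gamma>(x := \<gamma> x + 1)) (\<alpha> i) < (\<gamma>(x := \<gamma> x + 1)) (\<alpha> (i + 1))"
        using I3 neq[of i] neq[of "i+1"] p by simp
    next
      fix k assume k: "1 \<le> k \<and> k \<le> B"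
      then have "\<beta> k \<noteq> x" using eq[of k] L2 B by auto
      then show "(\<gamma>(x := \<gamma> x + 1)) (\<beta> k) = k" using I4 k by simp
    next
      fix k assume k: "B < k \<and> k \<le> n"
      show "k \<le> (\<gamma>(x := \<gamma> x + 1)) (\<beta> k)" using I5[of k] k by auto
      show "(\<gamma>(x := \<gamma> x + 1)) (\<beta> k) + p \<le> B + 1 + M" using I5[of k] k nbound by auto
    next
      fix k assume k: "B < k \<and> k + 1 \<le> n"
      have "\<gamma> (\<beta> k) < \<gamma> (\<beta> (k+1))" using I6 k by simp
      moreover have "\<beta> k = x \<Longrightarrow> k = j" using eq[of k] k by simp
      moreover have "\<beta> (k+1) = x \<Longrightarrow> k + 1 = j" using eq[of "k+1"] k by simp
      ultimately show "(\<gamma>(x := \<gamma> x + 1)) (\<beta> k) < (\<gamma>(x := \<gamma> x + 1)) (\<beta> (k + 1))"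
        using nx k L2 by auto
    next
      fix k l assume h: "B < k \<and> k \<le> n \<and> p \<le> l \<and> l \<le> M \<and> l + B + 1 = p + (\<gamma>(x := \<gamma> x + 1)) (\<beta> k)"
      show "\<not> \<beta> k \<prec> \<alpha> l"
      proof (cases "\<beta> k = x")
        case True
        then have "\<gamma> (\<alpha> l) = \<gamma> x + 1" using I1[of l] h by simp
        then show ?thesis using ng[of "\<alpha> l"] in_elems(1)[of l] h p True by simp
      qed (use I7 h in auto)
    qed
  qed
qed

lemma invariant_iterate:
  assumes "invariant \<gamma>" "\<And>i. i < k \<Longrightarrow> \<exists>x. movable le ((align_step le ^^ i) (placed \<gamma>)) x"
  shows "\<exists>\<gamma>'. invariant \<gamma>' \<and> (align_step le ^^ k) (placed \<gamma>) = placed \<gamma>' \<and> k \<le> (\<Sum>x\<in>elems. \<gamma>' x)"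
  using assms(2)
proof (induction k)
  case 0 then show ?case using assms(1) by auto
next
  case (Suc k)
  then obtain \<gamma>' where g: "invariant \<gamma>'" "(align_step le ^^ k) (placed \<gamma>) = placed \<gamma>'" "k \<le> (\<Sum>x\<in>elems. \<gamma>' x)"
    by force
  have "\<exists>x. can_move \<gamma>' x" using Suc.prems[of k] g(2) movable_placed by simp
  then obtain x where x: "can_move \<gamma>' x" "align_step le (placed \<gamma>') = placed (\<gamma>'(x := \<gamma>' x + 1))"
    using align_step_placed by blast
  have xX: "x \<in> elems" using x(1) by (simp add: can_move_def)
  have "(\<Sum>z\<in>elems - {x}. (\<gamma>'(x := \<gamma>' x + 1)) z) = (\<Sum>z\<in>elems - {x}. \<gamma>' z)"
    by (rule sum.cong) auto
  then have "(\<Sum>z\<in>elems. (\<gamma>'(x := \<gamma>' x + 1)) z) = Suc (\<Sum>z\<in>elems. \<gamma>' z)"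
    unfolding sum.remove[OF finite_elems xX] by simp
  then show ?case using invariant_step[OF g(1) x(1)] x(2) g by (intro exI[of _ "\<gamma>'(x := \<gamma>' x + 1)"]) (simp add: fun_upd_def)
qed

text \<open>A step increases the sum of the columns by one, and the invariant bounds the columns, so the
  iteration reaches a stage without admissible moves.\<close>

lemma alignment_from:
  assumes "invariant \<gamma>" "pre_alignment le A r = placed \<gamma>"
  shows "\<exists>\<gamma>'. invariant \<gamma>' \<and> alignment le A r = placed \<gamma>' \<and> (\<forall>x. \<not> can_move \<gamma>' x)"
proof -
  let ?Q = "\<lambda>k. \<not> (\<exists>x. movable le ((align_step le ^^ k) (placed \<gamma>)) x)"
  have ex: "\<exists>k. ?Q k"
  proof (rule ccontr)
    assume "\<not> ?thesis"
    then obtain \<gamma>' where g: "invariant \<gamma>'" "Suc (card elems * (B + 1 + M)) \<le> (\<Sum>x\<in>elems. \<gamma>' x)"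
      using invariant_iterate[OF assms(1), of "Suc (card elems * (B + 1 + M))"] by blast
    have "(\<Sum>x\<in>elems. \<gamma>' x) \<le> of_nat (card elems) * (B + 1 + M)"
      by (rule sum_bounded_above) (use invariant_col_bound[OF g(1)] in force)
    then show False using g(2) by simp
  qed
  define K where "K = (LEAST k. ?Q k)"
  have K: "?Q K" unfolding K_def using ex by (rule LeastI_ex)
  have "\<exists>x. movable le ((align_step le ^^ i) (placed \<gamma>)) x" if "i < K" for i
    using not_less_Least[of i ?Q] that unfolding K_def by blast
  from invariant_iterate[OF assms(1) this]
  obtain \<gamma>' where g: "invariant \<gamma>'" "(align_step le ^^ K) (placed \<gamma>) = placed \<gamma>'" by blast
  have "alignment le A r = placed \<gamma>'"
    unfolding alignment_def Let_def assms(2) using g(2) by (simp add: K_def)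
  moreover have "\<forall>x. \<not> can_move \<gamma>' x" using K g(2) by (simp add: movable_placed)
  ultimately show ?thesis using g(1) by blast
qed

lemma pre_alignment_eq:
  "\<exists>\<gamma>. pre_alignment le A r = placed \<gamma> \<and> (\<forall>k. 1 \<le> k \<and> k \<le> M \<longrightarrow> \<gamma> (\<alpha> k) = upper_col le A r k)
     \<and> (\<forall>j. 1 \<le> j \<and> j \<le> n \<longrightarrow> \<gamma> (\<beta> j) = j)"
proof -
  define \<gamma> where "\<gamma> x = snd (the (pre_alignment le A r x))" for x
  have uq: "unique_opt (\<lambda>q. A q = Some x) = Some q" if "A q = Some x" for q x
    unfolding unique_opt_eq_Some using that by (auto intro: inj_onD[OF injA])
  have U: "pre_alignment le A r (\<alpha> k) = Some (r, upper_col le A r k)" if "1 \<le> k" "k \<le> M" for k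
    unfolding pre_alignment_def using uq[of "(r, k)" "\<alpha> k"] row_upper[of k] that by simp
  have L: "pre_alignment le A r (\<beta> k) = Some (Suc r, k)" if "1 \<le> k" "k \<le> n" for k
    unfolding pre_alignment_def using uq[of "(Suc r, k)" "\<beta> k"] row_lower[of k] that by simp
  have N: "pre_alignment le A r x = None" if "x \<notin> elems" for x
  proof (cases "unique_opt (\<lambda>q. A q = Some x)")
    case (Some q)
    obtain i k where q: "q = (i, k)" by force
    have Ax: "A (i, k) = Some x" using Some by (simp add: unique_opt_eq_Some q)
    have "i \<noteq> r" "i \<noteq> Suc r"
      using Ax that row_upper[of k] row_lower[of k] by (auto simp: elems_def split: if_splits)
    then show ?thesis by (simp add: pre_alignment_def Some q)
  qed (simp add: pre_alignment_def)
  have "pre_alignment le A r = placed \<gamma>"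
  proof
    fix x
    show "pre_alignment le A r x = placed \<gamma> x"
    proof (cases "x \<in> elems")
      case True
      then consider k where "1 \<le> k" "k \<le> M" "x = \<alpha> k" | j where "1 \<le> j" "j \<le> n" "x = \<beta> j"
        by (auto simp: elems_def)
      then show ?thesis using U L placed_upper placed_lower by cases (auto simp: \<gamma>_def)
    next
      case False
      then show ?thesis using N by (auto simp: placed_def elems_def)
    qed
  qed
  then show ?thesis using U L by (intro exI[of _ \<gamma>]) (auto simp: \<gamma>_def)
qed

lemma upper_col_unfold:
  assumes "1 \<le> k" "k \<le> M"
  shows "upper_col le A r k =
    Max ({0} \<union> {i. 1 \<le> i \<and> i \<le> n \<and> \<beta> i \<prec> \<alpha> k} \<union> upper_col le A r ` {1..<k}) + 1"
proof -
  have "{i. \<exists>b. A (Suc r, i) = Some b \<and> b \<prec> the (A (r, k))} = {i. 1 \<le> i \<and> i \<le> n \<and> \<beta> i \<prec> \<alpha> k}"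
    using row_lower row_upper[of k] assms by (auto split: if_splits)
  then show ?thesis by (subst upper_col.simps) simp
qed

lemma upper_col_le:
  assumes "1 \<le> k" "k \<le> M" "\<And>i. 1 \<le> i \<Longrightarrow> i \<le> n \<Longrightarrow> \<beta> i \<prec> \<alpha> k \<Longrightarrow> i \<le> b"
    "\<And>i. 1 \<le> i \<Longrightarrow> i < k \<Longrightarrow> upper_col le A r i \<le> b"
  shows "upper_col le A r k \<le> b + 1"
proof -
  have "finite {i. 1 \<le> i \<and> i \<le> n \<and> \<beta> i \<prec> \<alpha> k}" by (rule finite_subset[of _ "{..n}"]) auto
  then show ?thesis unfolding upper_col_unfold[OF assms(1,2)] using assms(3,4) by (auto simp: Max_le_iff)
qed

lemma upper_col_ge:
  assumes "1 \<le> k" "k \<le> M"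
  shows "1 \<le> upper_col le A r k"
    "1 \<le> i \<Longrightarrow> i \<le> n \<Longrightarrow> \<beta> i \<prec> \<alpha> k \<Longrightarrow> i < upper_col le A r k"
    "1 \<le> i \<Longrightarrow> i < k \<Longrightarrow> upper_col le A r i < upper_col le A r k"
proof -
  have fin: "finite ({0} \<union> {i. 1 \<le> i \<and> i \<le> n \<and> \<beta> i \<prec> \<alpha> k} \<union> upper_col le A r ` {1..<k})"
    using finite_subset[of "{i. 1 \<le> i \<and> i \<le> n \<and> \<beta> i \<prec> \<alpha> k}" "{..n}"] by auto
  show "1 \<le> upper_col le A r k" by (simp add: upper_col_unfold[OF assms])
  show "1 \<le> i \<Longrightarrow> i \<le> n \<Longrightarrow> \<beta> i \<prec> \<alpha> k \<Longrightarrow> i < upper_col le A r k"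
    unfolding upper_col_unfold[OF assms] by (rule le_imp_less_Suc[THEN order_less_le_trans, OF Max_ge[OF fin]]) auto
  show "1 \<le> i \<Longrightarrow> i < k \<Longrightarrow> upper_col le A r i < upper_col le A r k"
    unfolding upper_col_unfold[OF assms] by (rule le_imp_less_Suc[THEN order_less_le_trans, OF Max_ge[OF fin]]) auto
qed

lemma upper_col_early: "1 \<le> k \<Longrightarrow> k < p \<Longrightarrow> upper_col le A r k + p \<le> B + k + 1"
proof (induction k rule: less_induct)
  case (less k)
  have "upper_col le A r k \<le> (B + k - p) + 1"
  proof (rule upper_col_le)
    show "1 \<le> k" "k \<le> M" using less.prems p by auto
    fix i assume "1 \<le> i" "i \<le> n" "\<beta> i \<prec> \<alpha> k"
    then show "i \<le> B + k - p" using prefix[of k i] less.prems by simp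
  next
    fix i assume "1 \<le> i" "i < k"
    then show "upper_col le A r i \<le> B + k - p" using less.IH[of i] less.prems by simp
  qed
  then show ?case using prefix_len less.prems by simp
qed

lemma upper_col_late: "p \<le> k \<Longrightarrow> k \<le> M \<Longrightarrow> upper_col le A r k + p = B + 1 + k"
proof (induction k rule: less_induct)
  case (less k)
  have k: "1 \<le> k" "k \<le> M" using less.prems p by auto
  have "upper_col le A r k \<le> (B + k - p) + 1"
  proof (rule upper_col_le[OF k])
    fix i assume "1 \<le> i" "i \<le> n" "\<beta> i \<prec> \<alpha> k"
    then show "i \<le> B + k - p" using suffix[of k i] less.prems by simp
  next
    fix i assume i: "1 \<le> i" "i < k"
    show "upper_col le A r i \<le> B + k - p"
    proof (cases "i < p")
      case True then show ?thesis using upper_col_early[of i] i less.prems by simp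
    next
      case False then show ?thesis using less.IH[of i] i less.prems by simp
    qed
  qed
  moreover have "B + 1 + k \<le> upper_col le A r k + p"
  proof (cases "k = p")
    case True
    show ?thesis
    proof (cases "1 \<le> B")
      case t: True
      have "\<beta> B \<prec> \<alpha> k" using before t True k by simp
      then have "B < upper_col le A r k" using upper_col_ge(2)[OF k] t B by simp
      then show ?thesis using True by simp
    next
      case False then show ?thesis using upper_col_ge(1)[OF k] True by simp
    qed
  next
    case False
    then have "p \<le> k - 1" using less.prems by simp
    then have "upper_col le A r (k - 1) + p = B + 1 + (k - 1)" using less.IH[of "k-1"] k by simp
    moreover have "upper_col le A r (k - 1) < upper_col le A r k"
      using upper_col_ge(3)[OF k, of "k-1"] \<open>p \<le> k - 1\<close> p by simp
    ultimately show ?thesis using k by simp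
  qed
  ultimately show ?case using less.prems by simp
qed

lemma alignment_invariant:
  "\<exists>\<gamma>. invariant \<gamma> \<and> alignment le A r = placed \<gamma> \<and> (\<forall>x. \<not> can_move \<gamma> x)"
proof -
  obtain \<gamma> where g: "pre_alignment le A r = placed \<gamma>"
    "\<And>k. 1 \<le> k \<Longrightarrow> k \<le> M \<Longrightarrow> \<gamma> (\<alpha> k) = upper_col le A r k"
    "\<And>j. 1 \<le> j \<Longrightarrow> j \<le> n \<Longrightarrow> \<gamma> (\<beta> j) = j"
    using pre_alignment_eq by blast
  have "invariant \<gamma>" unfolding invariant_def
  proof (intro conjI allI impI)
    fix i assume "p \<le> i \<and> i \<le> M"
    then show "\<gamma> (\<alpha> i) + p = B + 1 + i" using g(2)[of i] upper_col_late[of i] p by simp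
  next
    fix i assume i: "1 \<le> i \<and> i < p"
    then show "1 \<le> \<gamma> (\<alpha> i)" "\<gamma> (\<alpha> i) \<le> B"
      using g(2)[of i] upper_col_early[of i] upper_col_ge(1)[of i] p by auto
  next
    fix i assume i: "1 \<le> i \<and> i + 1 < p"
    then show "\<gamma> (\<alpha> i) < \<gamma> (\<alpha> (i + 1))"
      using g(2)[of i] g(2)[of "i+1"] upper_col_ge(3)[of "i+1" i] p by simp
  next
    fix j k assume h: "B < j \<and> j \<le> n \<and> p \<le> k \<and> k \<le> M \<and> k + B + 1 = p + \<gamma> (\<beta> j)"
    then have "k + B + 1 = p + j" using g(3)[of j] by simp
    then show "\<not> \<beta> j \<prec> \<alpha> k" using suffix[of k j] h by auto
  qed (use g(3) B suffix_len in auto)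
  then show ?thesis using alignment_from g(1) by blast
qed

lemma placed_eq_lower: "placed \<gamma> y = Some (Suc r, c) \<longleftrightarrow> (\<exists>j. 1 \<le> j \<and> j \<le> n \<and> y = \<beta> j \<and> \<gamma> y = c)"
proof
  assume "placed \<gamma> y = Some (Suc r, c)"
  then show "\<exists>j. 1 \<le> j \<and> j \<le> n \<and> y = \<beta> j \<and> \<gamma> y = c" by (auto simp: placed_def split: if_splits)
next
  assume "\<exists>j. 1 \<le> j \<and> j \<le> n \<and> y = \<beta> j \<and> \<gamma> y = c"
  then show "placed \<gamma> y = Some (Suc r, c)" using placed_lower by auto
qed

text \<open>
  Under the strict form of the suffix conditions, each \<open>\<beta> j\<close> with \<open>B < j\<close> has a free column to move to,
  so column \<open>B + 1\<close> is left to \<open>\<alpha> p\<close> alone, while all earlier upper elements share a column with some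
  \<open>\<beta> j\<close>.  Hence \<open>p\<close> is the index from which \<open>f\<^sub>r\<close> starts.  The elements \<open>\<beta> (B + 1), \<dots>, \<beta> (B + t)\<close>
  move by exactly one column, because of \<open>blocked\<close>; then \<open>linked\<close> and \<open>stop\<close> identify \<open>t\<close> as the
  number of further elements that \<open>f\<^sub>r\<close> takes down.
\<close>

lemma f_array_pivot:
  assumes pM: "p \<le> M"
    and suffix': "\<And>k j. p < k \<Longrightarrow> k \<le> M \<Longrightarrow> 1 \<le> j \<Longrightarrow> j \<le> n \<Longrightarrow> \<beta> j \<prec> \<alpha> k \<Longrightarrow> j + p < B + k"
    and suffix_len': "n + p \<le> B + M"
    and t: "p + t \<le> M" "B + t \<le> n"
    and linked: "\<And>i. 1 \<le> i \<Longrightarrow> i \<le> t \<Longrightarrow> \<not> \<alpha> (p + i - 1) \<prec> \<beta> (B + i)"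
    and blocked: "\<And>i. 1 \<le> i \<Longrightarrow> i \<le> t \<Longrightarrow> p + i + 1 \<le> M \<Longrightarrow> \<beta> (B + i) \<prec> \<alpha> (p + i + 1)"
    and stop: "B + t + 1 \<le> n \<Longrightarrow> \<alpha> (p + t) \<prec> \<beta> (B + t + 1)"
  shows "f_array le r A = Some (array_of_rows (ran A) le
    (\<lambda>x. if x \<in> \<alpha> ` {p..p + t} then r + 1 else if x \<in> \<beta> ` {B + 1..B + t} then r else row_of A x))"
proof -
  obtain \<gamma> where I: "invariant \<gamma>" and al: "alignment le A r = placed \<gamma>" and no_move: "\<And>x. \<not> can_move \<gamma> x"
    using alignment_invariant by blast
  note I1 = invariantD(1)[OF I] and I2 = invariantD(2)[OF I] and I4 = invariantD(4)[OF I]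
    and I5 = invariantD(5)[OF I] and I7 = invariantD(7)[OF I]
  \<comment> \<open>Otherwise the last such \<open>\<beta> j\<close> could still move into the column of \<open>\<alpha> (p + j - B)\<close>.\<close>
  have E1: "j < \<gamma> (\<beta> j)" if "B < j" "j \<le> n" for j
    using that
  proof (induction "n - j" arbitrary: j rule: less_induct)
    case less
    have IH: "l < \<gamma> (\<beta> l)" if "j < l" "l \<le> n" for l using less.hyps[of l] less.prems that by simp
    show ?case
    proof (rule ccontr)
      assume "\<not> j < \<gamma> (\<beta> j)"
      then have g: "\<gamma> (\<beta> j) = j" using I5[of j] less.prems by simp
      define k where "k = p + j - B"
      have k: "p < k" "k \<le> M" "k + B = p + j" using less.prems suffix_len' by (auto simp: k_def)
      have gk: "\<gamma> (\<alpha> k) = j + 1" using I1[of k] k by simp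
      have "can_move \<gamma> (\<beta> j)" unfolding can_move_def
      proof (intro conjI ballI impI)
        show "\<beta> j \<in> elems" using in_elems(2)[of j] less.prems by simp
        show "\<exists>y\<in>elems. \<gamma> y = \<gamma> (\<beta> j) + 1" using in_elems(1)[of k] k gk g p by (intro bexI[of _ "\<alpha> k"]) auto
      next
        fix y assume y: "y \<in> elems" "\<gamma> y = \<gamma> (\<beta> j) + 1"
        from y(1) show "\<not> \<beta> j \<prec> y"
        proof (cases rule: elems_cases)
          case (U1 i) then show ?thesis using I2[of i] y(2) g less.prems by simp
        next
          case (U2 i)
          then have "i = k" using I1[of i] y(2) g k by simp
          then show ?thesis using suffix'[of k j] k U2 less.prems by auto
        next
          case (L1 l) then show ?thesis using I4[of l] y(2) g less.prems by simp
        next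
          case (L2 l)
          show ?thesis
          proof (cases "j < l")
            case True then show ?thesis using IH[of l] L2 y(2) g by simp
          next
            case False
            then show ?thesis using lower_mono[of l j] L2 less.prems lt_asym by (cases "l = j") auto
          qed
        qed
      qed
      then show False using no_move by blast
    qed
  qed
  have E2: "\<gamma> (\<beta> (B + i)) = B + i + 1" if i: "1 \<le> i" "i \<le> t" for i
  proof (rule ccontr)
    assume "\<gamma> (\<beta> (B + i)) \<noteq> B + i + 1"
    moreover have "B + i < \<gamma> (\<beta> (B + i))" using E1[of "B + i"] i t by simp
    ultimately have ge: "B + i + 2 \<le> \<gamma> (\<beta> (B + i))" by simp
    define k where "k = p + \<gamma> (\<beta> (B + i)) - B - 1"
    have up: "\<gamma> (\<beta> (B + i)) + p \<le> B + 1 + M" using I5[of "B + i"] i t by simp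
    have k: "k + B + 1 = p + \<gamma> (\<beta> (B + i))" "p + i + 1 \<le> k" "k \<le> M" using ge up by (auto simp: k_def)
    have "\<beta> (B + i) \<prec> \<alpha> (p + i + 1)" using blocked[of i] i k by simp
    moreover have "k = p + i + 1 \<or> \<alpha> (p + i + 1) \<prec> \<alpha> k" using upper_mono[of "p + i + 1" k] k by (cases "k = p + i + 1") auto
    ultimately have "\<beta> (B + i) \<prec> \<alpha> k" using lt_trans by auto
    then show False using I7[of "B + i" k] k i t by simp
  qed
  let ?\<phi> = "placed \<gamma>"
  have noL: "\<not> (\<exists>y. ?\<phi> y = Some (r + 1, B + 1))"
  proof
    assume "\<exists>y. ?\<phi> y = Some (r + 1, B + 1)"
    then obtain j where j: "1 \<le> j" "j \<le> n" "\<gamma> (\<beta> j) = B + 1" using placed_eq_lower by auto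
    show False
    proof (cases "j \<le> B")
      case True then show ?thesis using I4[of j] j by simp
    next
      case False then show ?thesis using E1[of j] j by simp
    qed
  qed
  have early: "\<exists>y. ?\<phi> y = Some (r + 1, \<gamma> (\<alpha> i))" if i: "1 \<le> i" "i < p" for i
  proof -
    have c: "1 \<le> \<gamma> (\<alpha> i)" "\<gamma> (\<alpha> i) \<le> B" using I2[OF i] by auto
    then have "?\<phi> (\<beta> (\<gamma> (\<alpha> i))) = Some (Suc r, \<gamma> (\<alpha> i))"
      using placed_lower[of "\<gamma> (\<alpha> i)" \<gamma>] I4[of "\<gamma> (\<alpha> i)"] B by simp
    then show ?thesis by auto
  qed
  have ap: "?\<phi> (\<alpha> i) = Some (r, B + 1 + i - p)" if "p \<le> i" "i \<le> M" for i
    using placed_upper[of i \<gamma>] I1[of i] that p by (simp add: eq_diff_iff)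
  have Ar: "A (r, i) = Some x \<longleftrightarrow> 1 \<le> i \<and> i \<le> M \<and> x = \<alpha> i" for i x using row_upper[of i] by auto
  have notall: "\<not> (\<forall>c. (\<exists>x. ?\<phi> x = Some (r, c)) \<longrightarrow> (\<exists>y. ?\<phi> y = Some (r + 1, c)))"
    using noL ap[of p] pM by auto
  have least_p: "(LEAST q. \<exists>x c. A (r, q) = Some x \<and> ?\<phi> x = Some (r, c) \<and>
      \<not> (\<exists>y. ?\<phi> y = Some (r + 1, c))) = p"
  proof (rule Least_equality)
    show "\<exists>x c. A (r, p) = Some x \<and> ?\<phi> x = Some (r, c) \<and> \<not> (\<exists>y. ?\<phi> y = Some (r + 1, c))"
      using noL ap[of p] pM p Ar by auto
  next
    fix q assume "\<exists>x c. A (r, q) = Some x \<and> ?\<phi> x = Some (r, c) \<and> \<not> (\<exists>y. ?\<phi> y = Some (r + 1, c))"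
    then obtain c where q: "1 \<le> q" "q \<le> M" "?\<phi> (\<alpha> q) = Some (r, c)" "\<not> (\<exists>y. ?\<phi> y = Some (r + 1, c))"
      using Ar by auto
    then have "c = \<gamma> (\<alpha> q)" using placed_upper[of q \<gamma>] by simp
    then show "p \<le> q" using early[of q] q by (meson not_le)
  qed
  have least_t: "(LEAST s. \<exists>x c. A (r, p + s) = Some x \<and> ?\<phi> x = Some (r, c) \<and>
      \<not> (\<exists>y. ?\<phi> y = Some (r + 1, c + 1) \<and> \<not> x \<prec> y)) = t"
  proof (rule Least_equality)
    have "\<not> (\<exists>y. ?\<phi> y = Some (r + 1, B + 1 + t + 1) \<and> \<not> \<alpha> (p + t) \<prec> y)"
    proof
      assume "\<exists>y. ?\<phi> y = Some (r + 1, B + 1 + t + 1) \<and> \<not> \<alpha> (p + t) \<prec> y"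
      then obtain j where j: "1 \<le> j" "j \<le> n" "\<gamma> (\<beta> j) = B + t + 2" "\<not> \<alpha> (p + t) \<prec> \<beta> j"
        using placed_eq_lower by auto
      have "B < j" using I4[of j] j by (cases "j \<le> B") auto
      then have "j \<le> B + t + 1" using E1[of j] j by simp
      moreover have "j \<noteq> B + t + 1" using stop j by auto
      moreover have "\<not> j \<le> B + t"
      proof
        assume "j \<le> B + t"
        then have d: "1 \<le> j - B" "j - B \<le> t" "B + (j - B) = j" using \<open>B < j\<close> by arith+
        then show False using E2[of "j - B"] j(3) d \<open>j \<le> B + t\<close> by simp
      qed
      ultimately show False by simp
    qed
    then show "\<exists>x c. A (r, p + t) = Some x \<and> ?\<phi> x = Some (r, c) \<and>
      \<not> (\<exists>y. ?\<phi> y = Some (r + 1, c + 1) \<and> \<not> x \<prec> y)"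
      using ap[of "p + t"] t p Ar by (intro exI[of _ "\<alpha> (p + t)"] exI[of _ "B + 1 + t"]) simp
  next
    fix s assume "\<exists>x c. A (r, p + s) = Some x \<and> ?\<phi> x = Some (r, c) \<and>
      \<not> (\<exists>y. ?\<phi> y = Some (r + 1, c + 1) \<and> \<not> x \<prec> y)"
    then obtain c where s: "p + s \<le> M" "?\<phi> (\<alpha> (p + s)) = Some (r, c)"
      "\<not> (\<exists>y. ?\<phi> y = Some (r + 1, c + 1) \<and> \<not> \<alpha> (p + s) \<prec> y)"
      using Ar by auto
    have c: "c = B + 1 + s" using ap[of "p + s"] s by simp
    show "t \<le> s"
    proof (rule ccontr)
      assume "\<not> t \<le> s"
      then have s1: "1 \<le> s + 1" "s + 1 \<le> t" by auto
      have "?\<phi> (\<beta> (B + (s + 1))) = Some (r + 1, c + 1)"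
        using placed_lower[of "B + (s + 1)" \<gamma>] E2[OF s1] s1 t c by simp
      then show False using s(3) linked[OF s1] by auto
    qed
  qed
  have down: "{x. \<exists>k. p \<le> k \<and> k \<le> p + t \<and> A (r, k) = Some x} = \<alpha> ` {p..p + t}"
    using Ar p t by (auto simp: image_iff Bex_def)
  have up: "{y. \<exists>x\<in>\<alpha> ` {p..p + t}. \<exists>c. ?\<phi> x = Some (r, c) \<and> ?\<phi> y = Some (r + 1, c)}
     = \<beta> ` {B + 1..B + t}"
  proof (intro equalityI subsetI)
    fix y assume "y \<in> {y. \<exists>x\<in>\<alpha> ` {p..p + t}. \<exists>c. ?\<phi> x = Some (r, c) \<and> ?\<phi> y = Some (r + 1, c)}"
    then obtain k c where k: "p \<le> k" "k \<le> p + t" "?\<phi> (\<alpha> k) = Some (r, c)" "?\<phi> y = Some (r + 1, c)"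
      by auto
    then obtain j where j: "1 \<le> j" "j \<le> n" "y = \<beta> j" "\<gamma> (\<beta> j) = c" using placed_eq_lower by auto
    have c: "c = B + 1 + k - p" using ap[of k] k t by simp
    have "B < j" using I4[of j] j c k by (cases "j \<le> B") auto
    moreover have "j + 1 \<le> c" using E1[of j] j \<open>B < j\<close> by simp
    ultimately show "y \<in> \<beta> ` {B + 1..B + t}" using j c k by auto
  next
    fix y assume "y \<in> \<beta> ` {B + 1..B + t}"
    then obtain j where j: "B + 1 \<le> j" "j \<le> B + t" "y = \<beta> j" by auto
    define i where "i = j - B"
    have i: "1 \<le> i" "i \<le> t" "j = B + i" using j by (auto simp: i_def)
    have "?\<phi> y = Some (r + 1, B + i + 1)" using placed_lower[of j \<gamma>] E2[of i] i t j by simp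
    moreover have "?\<phi> (\<alpha> (p + i)) = Some (r, B + i + 1)" using ap[of "p + i"] i t by simp
    ultimately show "y \<in> {y. \<exists>x\<in>\<alpha> ` {p..p + t}. \<exists>c. ?\<phi> x = Some (r, c) \<and> ?\<phi> y = Some (r + 1, c)}"
      using i by (intro CollectI bexI[of _ "\<alpha> (p + i)"] exI[of _ "B + i + 1"]) auto
  qed
  show ?thesis
    unfolding f_array_def Let_def al least_p least_t down up using notall by simp
qed

end

section \<open>The diagram crystal\<close>

text \<open>The signature rule: \<open>f\<^sub>r\<close> and \<open>e\<^sub>r\<close> are governed by the excess of row \<open>r + 1\<close> over row \<open>r\<close> in the first
  columns.\<close>

definition cnt :: "diagram \<Rightarrow> nat \<Rightarrow> nat \<Rightarrow> nat" where
  "cnt D i c = card {e. e \<le> c \<and> (i, e) \<in> D}"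

definition excess :: "diagram \<Rightarrow> nat \<Rightarrow> nat \<Rightarrow> int" where
  "excess D r c = int (cnt D (Suc r) c) - int (cnt D r c)"

lemma cnt_split:
  assumes "c \<le> d" shows "cnt D i d = cnt D i c + card {e. c < e \<and> e \<le> d \<and> (i, e) \<in> D}"
proof -
  have "{e. e \<le> d \<and> (i, e) \<in> D} = {e. e \<le> c \<and> (i, e) \<in> D} \<union> {e. c < e \<and> e \<le> d \<and> (i, e) \<in> D}"
    using assms by auto
  also have "card \<dots> = cnt D i c + card {e. c < e \<and> e \<le> d \<and> (i, e) \<in> D}"
    unfolding cnt_def
    by (rule card_Un_disjoint) (auto intro: finite_subset[of _ "{..c}"] finite_subset[of _ "{..d}"])
  finally show ?thesis unfolding cnt_def .
qed

lemma cnt_mono: "c \<le> d \<Longrightarrow> cnt D i c \<le> cnt D i d"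
  using cnt_split by simp

lemma cnt_Suc: "cnt D i (Suc c) = cnt D i c + (if (i, Suc c) \<in> D then 1 else 0)"
proof -
  have "{e. c < e \<and> e \<le> Suc c \<and> (i, e) \<in> D} = (if (i, Suc c) \<in> D then {Suc c} else {})"
    by (auto simp: le_Suc_eq)
  then show ?thesis using cnt_split[of c "Suc c" D i] by simp
qed

lemma cnt_pred: "1 \<le> c \<Longrightarrow> cnt D i c = cnt D i (c - 1) + (if (i, c) \<in> D then 1 else 0)"
  using cnt_Suc[of D i "c - 1"] by simp

lemma cnt_0: "is_diagram D \<Longrightarrow> cnt D i 0 = 0"
proof -
  assume "is_diagram D"
  then have "{e. e \<le> 0 \<and> (i, e) \<in> D} = {}" by (auto simp: is_diagram_def)
  then show ?thesis unfolding cnt_def by (metis card.empty)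
qed

lemma excess_0: "is_diagram D \<Longrightarrow> excess D r 0 = 0"
  by (simp add: excess_def cnt_0)

lemma excess_pred:
  "1 \<le> c \<Longrightarrow> excess D r c = excess D r (c - 1) + (if (Suc r, c) \<in> D then 1 else 0) - (if (r, c) \<in> D then 1 else 0)"
  by (simp add: excess_def cnt_pred)

lemma excess_diff:
  "c \<le> d \<Longrightarrow> excess D r d - excess D r c =
     int (card {e. c < e \<and> e \<le> d \<and> (Suc r, e) \<in> D}) - int (card {e. c < e \<and> e \<le> d \<and> (r, e) \<in> D})"
  by (simp add: excess_def cnt_split)

subsection \<open>Pairing\<close>

lemma pairing_pairs:
  "pairing D r M \<Longrightarrow> z \<in> M \<Longrightarrow> \<exists>c d. z = ((r, c), (Suc r, d)) \<and> (r, c) \<in> D \<and> (Suc r, d) \<in> D \<and> c \<le> d"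
  by (induction rule: pairing.induct) auto

lemma Field_upper: "pairing D r M \<Longrightarrow> (r, c) \<in> Field M \<longleftrightarrow> (\<exists>d. ((r, c), (Suc r, d)) \<in> M)"
proof
  assume M: "pairing D r M" and "(r, c) \<in> Field M"
  then obtain z where z: "z \<in> M" "fst z = (r, c) \<or> snd z = (r, c)" by (auto simp: Field_def)
  with pairing_pairs[OF M z(1)] show "\<exists>d. ((r, c), (Suc r, d)) \<in> M" by auto
qed (auto intro: FieldI1)

lemma Field_lower: "pairing D r M \<Longrightarrow> (Suc r, d) \<in> Field M \<longleftrightarrow> (\<exists>c. ((r, c), (Suc r, d)) \<in> M)"
proof
  assume M: "pairing D r M" and "(Suc r, d) \<in> Field M"
  then obtain z where z: "z \<in> M" "fst z = (Suc r, d) \<or> snd z = (Suc r, d)" by (auto simp: Field_def)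
  with pairing_pairs[OF M z(1)] show "\<exists>c. ((r, c), (Suc r, d)) \<in> M" by auto
qed (auto intro: FieldI2)

lemma pairing_inside:
  "pairing D r M \<Longrightarrow> ((r, c), (Suc r, d)) \<in> M \<Longrightarrow> (i, e) \<in> D \<Longrightarrow> i \<in> {r, Suc r} \<Longrightarrow>
    c \<le> e \<Longrightarrow> e \<le> d \<Longrightarrow> (i, e) \<in> Field M"
proof (induction rule: pairing.induct)
  case (pair M c' d')
  have F: "Field (insert ((r, c'), (r + 1, d')) M) = {(r, c'), (r + 1, d')} \<union> Field M"
    by (auto simp: Field_def)
  show ?case
  proof (cases "((r, c), (Suc r, d)) \<in> M")
    case True
    then show ?thesis using pair.IH pair.prems F by blast
  next
    case False
    then have "c = c'" "d = d'" using pair.prems(1) by auto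
    then show ?thesis using pair.hyps(7)[of i e] pair.prems F by auto
  qed
qed simp

text \<open>A pair is only formed when everything between its two cells is already paired, so no later pair can
  separate a cell of the interval from its partner.\<close>

lemma pairing_noncrossing:
  "pairing D r M \<Longrightarrow> ((r, c), (Suc r, d)) \<in> M \<Longrightarrow> ((r, c'), (Suc r, d')) \<in> M \<Longrightarrow>
    (c = c' \<longleftrightarrow> d = d') \<and> (c \<le> c' \<longrightarrow> c' \<le> d \<longrightarrow> d' \<le> d) \<and> (c \<le> d' \<longrightarrow> d' \<le> d \<longrightarrow> c \<le> c')"
proof (induction rule: pairing.induct)
  case (pair M a b)
  let ?new = "\<lambda>c d. c = a \<and> d = b"
  have old: "c \<noteq> a \<and> d \<noteq> b \<and> \<not> (c \<le> a \<and> a \<le> d) \<and> \<not> (c \<le> b \<and> b \<le> d)"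
    if "((r, c), (Suc r, d)) \<in> M" for c d
    using pairing_inside[OF pair.hyps(1) that, of r a] pairing_inside[OF pair.hyps(1) that, of "Suc r" b]
      Field_upper[OF pair.hyps(1), of a] Field_lower[OF pair.hyps(1), of b] pair.hyps that by auto
  consider "((r, c), (Suc r, d)) \<in> M" "((r, c'), (Suc r, d')) \<in> M"
    | "?new c d" "((r, c'), (Suc r, d')) \<in> M" | "((r, c), (Suc r, d)) \<in> M" "?new c' d'"
    | "?new c d" "?new c' d'"
    using pair.prems by auto
  then show ?case
  proof cases
    case 1 then show ?thesis using pair.IH by blast
  next
    case 2
    have "c' \<le> d'" using pairing_pairs[OF pair.hyps(1) 2(2)] by auto
    then show ?thesis using old[OF 2(2)] 2(1) pair.hyps(4) by auto
  next
    case 3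
    then show ?thesis using old[OF 3(1)] pair.hyps(4) by auto
  next
    case 4 then show ?thesis by simp
  qed
qed simp

text \<open>All cells between the two members of a pair are matched among themselves, so both rows have equally
  many cells there.\<close>

lemma paired_balance:
  assumes "pairing D r M" "(r, c) \<in> Field M"
  shows "\<exists>d\<ge>c. card {e. c \<le> e \<and> e \<le> d \<and> (r, e) \<in> D} \<le> card {e. c \<le> e \<and> e \<le> d \<and> (Suc r, e) \<in> D}"
proof -
  obtain d where d: "((r, c), (Suc r, d)) \<in> M" using assms(2) Field_upper[OF assms(1)] by auto
  have cd: "c \<le> d" using pairing_pairs[OF assms(1) d] by simp
  define g where "g e = (SOME e'. ((r, e), (Suc r, e')) \<in> M)" for e
  have g: "((r, e), (Suc r, g e)) \<in> M" if e: "c \<le> e" "e \<le> d" "(r, e) \<in> D" for e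
  proof -
    have "(r, e) \<in> Field M" by (rule pairing_inside[OF assms(1) d e(3) _ e(1,2)]) simp
    then have "\<exists>e'. ((r, e), (Suc r, e')) \<in> M" using Field_upper[OF assms(1)] by simp
    then show ?thesis unfolding g_def by (rule someI_ex)
  qed
  have "card {e. c \<le> e \<and> e \<le> d \<and> (r, e) \<in> D} \<le> card {e. c \<le> e \<and> e \<le> d \<and> (Suc r, e) \<in> D}"
  proof (rule card_inj_on_le)
    show "inj_on g {e. c \<le> e \<and> e \<le> d \<and> (r, e) \<in> D}"
    proof (rule inj_onI)
      fix x y
      assume "x \<in> {e. c \<le> e \<and> e \<le> d \<and> (r, e) \<in> D}" "y \<in> {e. c \<le> e \<and> e \<le> d \<and> (r, e) \<in> D}" "g x = g y"
      then have "((r, x), (Suc r, g x)) \<in> M" "((r, y), (Suc r, g x)) \<in> M" using g[of x] g[of y] by auto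
      from pairing_noncrossing[OF assms(1) this] show "x = y" by simp
    qed
    show "g ` {e. c \<le> e \<and> e \<le> d \<and> (r, e) \<in> D} \<subseteq> {e. c \<le> e \<and> e \<le> d \<and> (Suc r, e) \<in> D}"
    proof
      fix x assume "x \<in> g ` {e. c \<le> e \<and> e \<le> d \<and> (r, e) \<in> D}"
      then obtain e where e: "c \<le> e" "e \<le> d" "(r, e) \<in> D" "x = g e" by auto
      have ge: "((r, e), (Suc r, g e)) \<in> M" using g e by simp
      have "g e \<le> d" using pairing_noncrossing[OF assms(1) d ge] e by simp
      moreover have "e \<le> g e" "(Suc r, g e) \<in> D" using pairing_pairs[OF assms(1) ge] by auto
      ultimately show "x \<in> {e. c \<le> e \<and> e \<le> d \<and> (Suc r, e) \<in> D}" using e by simp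
    qed
    show "finite {e. c \<le> e \<and> e \<le> d \<and> (Suc r, e) \<in> D}" by (rule finite_subset[of _ "{..d}"]) auto
  qed
  then show ?thesis using cd by blast
qed

text \<open>An unpaired cell of row \<open>r\<close> weakly left of an unpaired cell of row \<open>r + 1\<close>, chosen as close to it as
  possible, would form a further pair.\<close>

lemma maximal_pairing:
  assumes fin: "finite D"
  obtains M where "pairing D r M"
    "\<And>c d. (r, c) \<in> D \<Longrightarrow> (Suc r, d) \<in> D \<Longrightarrow> (r, c) \<notin> Field M \<Longrightarrow> (Suc r, d) \<notin> Field M \<Longrightarrow> d < c"
proof -
  have bound: "card M \<le> card (D \<times> D)" if "pairing D r M" for M
    by (rule card_mono) (use fin pairing_pairs[OF that] in auto)
  then have "\<forall>M. pairing D r M \<longrightarrow> card M < Suc (card (D \<times> D))" by (simp add: less_Suc_eq_le)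
  from ex_has_greatest_nat[of "pairing D r", OF pairing.empty this]
  obtain M where M: "pairing D r M" "\<And>M'. pairing D r M' \<Longrightarrow> card M' \<le> card M"
    by blast
  have finM: "finite M" by (rule finite_subset[of _ "D \<times> D"]) (use fin pairing_pairs[OF M(1)] in auto)
  have "d < c" if "(r, c) \<in> D" "(Suc r, d) \<in> D" "(r, c) \<notin> Field M" "(Suc r, d) \<notin> Field M" for c d
    using that
  proof (induction "d - c" arbitrary: c d rule: less_induct)
    case less
    show ?case
    proof (rule ccontr)
      assume "\<not> d < c"
      then have cd: "c \<le> d" by simp
      have "(i, e) \<in> Field M" if h: "(i, e) \<in> D" "i \<in> {r, r + 1}" "c \<le> e" "e \<le> d"
        "(i, e) \<noteq> (r, c)" "(i, e) \<noteq> (r + 1, d)" for i e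
      proof (rule ccontr)
        assume n: "(i, e) \<notin> Field M"
        have "i = r \<and> c < e \<or> i = Suc r \<and> e < d" using h by (auto simp: le_less)
        then consider "i = r" "c < e" | "i = Suc r" "e < d" by blast
        then show False
        proof cases
          case 1
          then have "d - e < d - c" using h by simp
          from less.hyps[OF this] show ?thesis using 1 h n less.prems by auto
        next
          case 2
          then have "e - c < d - c" using h by simp
          from less.hyps[OF this] show ?thesis using 2 h n less.prems by auto
        qed
      qed
      then have "pairing D r (insert ((r, c), (r + 1, d)) M)"
        using less.prems cd by (intro pairing.pair[OF M(1)]) auto
      then have "card (insert ((r, c), (r + 1, d)) M) \<le> card M" by (rule M(2))
      moreover have "((r, c), (r + 1, d)) \<notin> M" using less.prems(3) by (auto simp: Field_def)
      ultimately show False using finM by simp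
    qed
  qed
  then show thesis using that M(1) by blast
qed

text \<open>In a maximal pairing, the cells of row \<open>r + 1\<close> from column \<open>c\<close> on are paired, and their partners are
  not left of \<open>c\<close>, since otherwise \<open>(r, c)\<close> would be enclosed by a pair.\<close>

lemma unpaired_balance:
  assumes fin: "finite D" and c: "(r, c) \<in> D" "\<not> r_paired D r (r, c)" and d: "c \<le> d"
  shows "card {e. c \<le> e \<and> e \<le> d \<and> (Suc r, e) \<in> D} < card {e. c \<le> e \<and> e \<le> d \<and> (r, e) \<in> D}"
proof -
  obtain M where M: "pairing D r M"
    and mx: "\<And>c d. (r, c) \<in> D \<Longrightarrow> (Suc r, d) \<in> D \<Longrightarrow> (r, c) \<notin> Field M \<Longrightarrow> (Suc r, d) \<notin> Field M \<Longrightarrow> d < c"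
    using maximal_pairing[OF fin, of r] by blast
  have cF: "(r, c) \<notin> Field M" using c M by (auto simp: r_paired_def)
  define g where "g e = (SOME e'. ((r, e'), (Suc r, e)) \<in> M)" for e
  have g: "((r, g e), (Suc r, e)) \<in> M" if e: "c \<le> e" "(Suc r, e) \<in> D" for e
  proof -
    have "(Suc r, e) \<in> Field M" using mx[OF c(1) e(2) cF] e(1) by (metis not_le)
    then have "\<exists>e'. ((r, e'), (Suc r, e)) \<in> M" using Field_lower[OF M] by simp
    then show ?thesis unfolding g_def by (rule someI_ex)
  qed
  let ?U = "{e. c \<le> e \<and> e \<le> d \<and> (r, e) \<in> D}"
  have finU: "finite ?U" by (rule finite_subset[of _ "{..d}"]) auto
  have "card {e. c \<le> e \<and> e \<le> d \<and> (Suc r, e) \<in> D} \<le> card (?U - {c})"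
  proof (rule card_inj_on_le)
    show "inj_on g {e. c \<le> e \<and> e \<le> d \<and> (Suc r, e) \<in> D}"
    proof (rule inj_onI)
      fix x y
      assume "x \<in> {e. c \<le> e \<and> e \<le> d \<and> (Suc r, e) \<in> D}" "y \<in> {e. c \<le> e \<and> e \<le> d \<and> (Suc r, e) \<in> D}" "g x = g y"
      then have "((r, g x), (Suc r, x)) \<in> M" "((r, g x), (Suc r, y)) \<in> M" using g[of x] g[of y] by auto
      from pairing_noncrossing[OF M this] show "x = y" by simp
    qed
    show "g ` {e. c \<le> e \<and> e \<le> d \<and> (Suc r, e) \<in> D} \<subseteq> ?U - {c}"
    proof
      fix x assume "x \<in> g ` {e. c \<le> e \<and> e \<le> d \<and> (Suc r, e) \<in> D}"
      then obtain e where e: "c \<le> e" "e \<le> d" "(Suc r, e) \<in> D" "x = g e" by auto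
      have ge: "((r, x), (Suc r, e)) \<in> M" using g e by simp
      have x: "(r, x) \<in> D" "x \<le> e" using pairing_pairs[OF M ge] by auto
      have "c \<le> x" using pairing_inside[OF M ge c(1)] cF e(1) by (meson insertI1 nle_le)
      moreover have "x \<noteq> c" using ge cF by (auto simp: Field_def)
      ultimately show "x \<in> ?U - {c}" using x e by simp
    qed
    show "finite (?U - {c})" using finU by simp
  qed
  also have "\<dots> < card ?U" by (rule card_Diff1_less[OF finU]) (use c d in simp)
  finally show ?thesis .
qed

lemma paired_iff:
  assumes D: "is_diagram D" and c: "(r, c) \<in> D"
  shows "r_paired D r (r, c) \<longleftrightarrow> (\<exists>d\<ge>c. excess D r (c - 1) \<le> excess D r d)"
proof -
  have c1: "1 \<le> c" using D c by (auto simp: is_diagram_def)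
  have eq: "{e. c - 1 < e \<and> e \<le> d \<and> (i, e) \<in> D} = {e. c \<le> e \<and> e \<le> d \<and> (i, e) \<in> D}" for i d
    using c1 by auto
  have ex: "excess D r (c - 1) \<le> excess D r d \<longleftrightarrow>
      card {e. c \<le> e \<and> e \<le> d \<and> (r, e) \<in> D} \<le> card {e. c \<le> e \<and> e \<le> d \<and> (Suc r, e) \<in> D}"
    if "c \<le> d" for d
    using excess_diff[of "c - 1" d D r, unfolded eq] that by linarith
  show ?thesis
  proof
    assume "r_paired D r (r, c)"
    then show "\<exists>d\<ge>c. excess D r (c - 1) \<le> excess D r d"
      using paired_balance[of D r _ c] ex unfolding r_paired_def by blast
  next
    assume "\<exists>d\<ge>c. excess D r (c - 1) \<le> excess D r d"
    then obtain d where d: "c \<le> d" "excess D r (c - 1) \<le> excess D r d" by blast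
    have fin: "finite D" using D by (simp add: is_diagram_def)
    show "r_paired D r (r, c)"
    proof (rule ccontr)
      assume "\<not> r_paired D r (r, c)"
      from unpaired_balance[OF fin c this d(1)] ex[OF d(1)] d(2) show False by simp
    qed
  qed
qed

subsection \<open>Pivots\<close>

text \<open>The leftmost unpaired cell of row \<open>r\<close> is found one column after the last maximum of the excess, and
  the rightmost unpaired cell of row \<open>r + 1\<close> in the column of its first maximum.\<close>

definition pivot :: "diagram \<Rightarrow> nat \<Rightarrow> nat \<Rightarrow> bool" where
  "pivot D r c \<longleftrightarrow> 1 \<le> c \<and> (\<forall>d\<ge>c. excess D r d < excess D r (c - 1)) \<and>
     (\<forall>e<c. excess D r e \<le> excess D r (c - 1))"

definition copivot :: "diagram \<Rightarrow> nat \<Rightarrow> nat \<Rightarrow> bool" where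
  "copivot D r c \<longleftrightarrow> 1 \<le> c \<and> (\<forall>d>c. excess D r d \<le> excess D r c) \<and>
     (\<forall>e<c. excess D r e < excess D r c)"

definition move :: "nat \<Rightarrow> nat \<Rightarrow> nat \<Rightarrow> diagram \<Rightarrow> diagram" where
  "move i k c D = (D - {(i, c)}) \<union> {(k, c)}"

lemma pivot_cells: "pivot D r c \<Longrightarrow> (r, c) \<in> D \<and> (Suc r, c) \<notin> D"
  using excess_pred[of c D r] unfolding pivot_def by (auto split: if_splits)

lemma copivot_cells: "copivot D r c \<Longrightarrow> (Suc r, c) \<in> D \<and> (r, c) \<notin> D"
proof -
  assume h: "copivot D r c"
  then have "c - 1 < c" by (auto simp: copivot_def)
  with h have "excess D r (c - 1) < excess D r c" unfolding copivot_def by blast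
  then show ?thesis using excess_pred[of c D r] h unfolding copivot_def by (auto split: if_splits)
qed

lemma f_diagram_eq_Some_iff:
  assumes D: "is_diagram D"
  shows "f_diagram r D = Some E \<longleftrightarrow> (\<exists>c. pivot D r c \<and> E = move r (Suc r) c D)"
proof -
  have col: "1 \<le> c" if "(r, c) \<in> D" for c using D that by (auto simp: is_diagram_def)
  let ?Q = "\<lambda>c. (r, c) \<in> D \<and> \<not> r_paired D r (r, c)"
  have Q: "?Q c \<longleftrightarrow> (r, c) \<in> D \<and> (\<forall>d\<ge>c. excess D r d < excess D r (c - 1))" for c
    using paired_iff[OF D, of r c] by (metis linorder_not_le)
  have piv: "pivot D r c" if c: "?Q c" and mn: "\<And>e. ?Q e \<Longrightarrow> c \<le> e" for c
    unfolding pivot_def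
  proof (intro conjI allI impI)
    show "1 \<le> c" using c col by blast
    fix d assume "c \<le> d" then show "excess D r d < excess D r (c - 1)" using c Q by blast
  next
    \<comment> \<open>Downward induction: a cell of row \<open>r\<close> left of column \<open>c\<close> is balanced further right.\<close>
    fix e assume "e < c"
    then show "excess D r e \<le> excess D r (c - 1)"
    proof (induction "c - e" arbitrary: e rule: less_induct)
      case less
      show ?case
      proof (cases "e = c - 1")
        case False
        then have lt: "Suc e < c" using less.prems by simp
        have IH: "excess D r (Suc e) \<le> excess D r (c - 1)" using less.hyps[of "Suc e"] lt by simp
        show ?thesis
        proof (cases "(r, Suc e) \<in> D")
          case True
          then have "\<not> ?Q (Suc e)" using mn[of "Suc e"] lt by auto
          then obtain d where d: "Suc e \<le> d" "excess D r e \<le> excess D r d"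
            using Q[of "Suc e"] True by (auto simp: not_less)
          show ?thesis
          proof (cases "d < c")
            case t: True
            then have "excess D r d \<le> excess D r (c - 1)" using less.hyps[of d] d by simp
            then show ?thesis using d by simp
          next
            case f: False
            then have "excess D r d < excess D r (c - 1)" using c Q[of c] by simp
            then show ?thesis using d by simp
          qed
        next
          case False
          then show ?thesis using excess_pred[of "Suc e" D r] IH by (auto split: if_splits)
        qed
      qed simp
    qed
  qed
  have piv_Q: "?Q c \<and> (\<forall>e. ?Q e \<longrightarrow> c \<le> e)" if c: "pivot D r c" for c
  proof (intro conjI allI impI)
    show "(r, c) \<in> D" using pivot_cells[OF c] by simp
    then show "\<not> r_paired D r (r, c)" using c Q[of c] unfolding pivot_def by blast
    fix e assume e: "?Q e"
    show "c \<le> e"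
    proof (rule ccontr)
      assume "\<not> c \<le> e"
      then have "excess D r (c - 1) < excess D r (e - 1)" using e Q[of e] by simp
      moreover have "excess D r (e - 1) \<le> excess D r (c - 1)" using c \<open>\<not> c \<le> e\<close> unfolding pivot_def by simp
      ultimately show False by simp
    qed
  qed
  show ?thesis
  proof (cases "\<exists>c. ?Q c")
    case True
    define c0 where "c0 = (LEAST c. ?Q c)"
    have c0: "?Q c0" "\<And>e. ?Q e \<Longrightarrow> c0 \<le> e"
      unfolding c0_def using LeastI_ex[OF True] Least_le[of ?Q] by blast+
    have "f_diagram r D = Some (move r (Suc r) c0 D)"
      using True unfolding f_diagram_def c0_def move_def by (auto simp: Let_def)
    moreover have "pivot D r c \<longleftrightarrow> c = c0" for c
      using piv[OF c0] piv_Q[of c] c0 by (metis order_antisym)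
    ultimately show ?thesis by auto
  next
    case False
    then have "f_diagram r D = None" unfolding f_diagram_def by auto
    then show ?thesis using False piv_Q by auto
  qed
qed

lemma move_inverse:
  "(i, c) \<in> D \<Longrightarrow> (k, c) \<notin> D \<Longrightarrow> move k i c (move i k c D) = D"
  by (auto simp: move_def)

lemma cnt_move:
  assumes "(i, c) \<in> D" "(k, c) \<notin> D"
  shows "cnt (move i k c D) k e = cnt D k e + (if c \<le> e then 1 else 0)"
    "cnt D i e = cnt (move i k c D) i e + (if c \<le> e then 1 else 0)"
    "l \<noteq> i \<Longrightarrow> l \<noteq> k \<Longrightarrow> cnt (move i k c D) l e = cnt D l e"
proof -
  have ik: "i \<noteq> k" using assms by auto
  have fin: "finite {f. f \<le> e \<and> (l, f) \<in> X}" for l X by (rule finite_subset[of _ "{..e}"]) auto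
  have "{f. f \<le> e \<and> (k, f) \<in> move i k c D} =
      (if c \<le> e then insert c {f. f \<le> e \<and> (k, f) \<in> D} else {f. f \<le> e \<and> (k, f) \<in> D})"
    using ik by (auto simp: move_def)
  then show "cnt (move i k c D) k e = cnt D k e + (if c \<le> e then 1 else 0)"
    unfolding cnt_def using fin assms by simp
  have "{f. f \<le> e \<and> (i, f) \<in> D} =
      (if c \<le> e then insert c {f. f \<le> e \<and> (i, f) \<in> move i k c D} else {f. f \<le> e \<and> (i, f) \<in> move i k c D})"
    using ik assms by (auto simp: move_def)
  moreover have "(i, c) \<notin> move i k c D" using ik by (auto simp: move_def)
  ultimately show "cnt D i e = cnt (move i k c D) i e + (if c \<le> e then 1 else 0)"
    unfolding cnt_def using fin by simp
  show "l \<noteq> i \<Longrightarrow> l \<noteq> k \<Longrightarrow> cnt (move i k c D) l e = cnt D l e"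
    unfolding cnt_def by (rule arg_cong[of _ _ card]) (auto simp: move_def)
qed

lemma excess_move_down:
  assumes "(r, c) \<in> D" "(Suc r, c) \<notin> D"
  shows "excess (move r (Suc r) c D) r e = excess D r e + (if c \<le> e then 2 else 0)"
  using cnt_move(1,2)[OF assms, of e] by (auto simp: excess_def)

text \<open>Moving the cell adds 2 to the excess from column \<open>c\<close> on, which turns the last maximum, in column
  \<open>c - 1\<close>, into the first maximum, in column \<open>c\<close>.\<close>

lemma pivot_move:
  assumes "pivot D r c" shows "copivot (move r (Suc r) c D) r c"
proof -
  note cells = pivot_cells[OF assms]
  have c: "1 \<le> c" using assms by (simp add: pivot_def)
  have ec: "excess D r c = excess D r (c - 1) - 1" using excess_pred[OF c, of D r] cells by simp
  show ?thesis
    unfolding copivot_def excess_move_down[OF conjunct1[OF cells] conjunct2[OF cells]]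
  proof (intro conjI allI impI)
    fix d assume d: "c < d"
    then have "excess D r d < excess D r (c - 1)" using assms unfolding pivot_def by simp
    then show "excess D r d + (if c \<le> d then 2 else 0) \<le> excess D r c + (if c \<le> c then 2 else 0)"
      using ec d by simp
  next
    fix e assume e: "e < c"
    then have "excess D r e \<le> excess D r (c - 1)" using assms unfolding pivot_def by simp
    then show "excess D r e + (if c \<le> e then 2 else 0) < excess D r c + (if c \<le> c then 2 else 0)"
      using ec e by simp
  qed (rule c)
qed

lemma copivot_move:
  assumes "copivot E r c" shows "pivot (move (Suc r) r c E) r c"
proof -
  note cells = copivot_cells[OF assms]
  have c: "1 \<le> c" using assms by (simp add: copivot_def)
  define D where "D = move (Suc r) r c E"
  have DE: "E = move r (Suc r) c D" unfolding D_def using cells by (simp add: move_inverse)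
  have cD: "(r, c) \<in> D" "(Suc r, c) \<notin> D" using cells by (auto simp: D_def move_def)
  have ec: "excess D r c = excess D r (c - 1) - 1" using excess_pred[OF c, of D r] cD by simp
  have G: "excess E r e = excess D r e + (if c \<le> e then 2 else 0)" for e
    unfolding DE by (rule excess_move_down[OF cD])
  show ?thesis unfolding D_def[symmetric] pivot_def
  proof (intro conjI allI impI)
    fix d assume d: "c \<le> d"
    have "excess E r d \<le> excess E r c"
      using assms d unfolding copivot_def by (cases "d = c") auto
    then show "excess D r d < excess D r (c - 1)" using ec d G by simp
  next
    fix e assume e: "e < c"
    then have "excess E r e < excess E r c" using assms unfolding copivot_def by blast
    then show "excess D r e \<le> excess D r (c - 1)" using ec e G[of e] G[of c] by simp
  qed (rule c)
qed

lemma is_diagram_move: "is_diagram D \<Longrightarrow> 1 \<le> k \<Longrightarrow> (i, c) \<in> D \<Longrightarrow> is_diagram (move i k c D)"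
  by (auto simp: is_diagram_def move_def)

lemma copivot_exists:
  assumes D: "is_diagram D" and pos: "0 < excess D r c0"
  shows "\<exists>c. copivot D r c \<and> 0 < excess D r c"
proof -
  have finD: "finite D" using D by (simp add: is_diagram_def)
  obtain N where N: "\<And>i e. (i, e) \<in> D \<Longrightarrow> e \<le> N"
  proof -
    have "(i, e) \<in> D \<Longrightarrow> e \<le> Max (snd ` D)" for i e
      using finD by (intro Max_ge) (auto intro: rev_image_eqI)
    then show thesis using that by blast
  qed
  have const: "excess D r d = excess D r N" if "N \<le> d" for d
  proof -
    have "{e. N < e \<and> e \<le> d \<and> (i, e) \<in> D} = {}" for i using N by fastforce
    from excess_diff[OF that, of D r, unfolded this] show ?thesis by simp
  qed
  define mx where "mx = Max (excess D r ` {..N})"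
  have ge: "excess D r d \<le> mx" for d
  proof (cases "d \<le> N")
    case True then show ?thesis unfolding mx_def by (intro Max_ge) auto
  next
    case False
    then have eq: "excess D r d = excess D r N" using const[of d] by linarith
    show ?thesis unfolding mx_def eq by (intro Max_ge) auto
  qed
  have "mx \<in> excess D r ` {..N}" unfolding mx_def by (intro Max_in) auto
  then have ex: "\<exists>c. excess D r c = mx" by auto
  define c where "c = (LEAST c. excess D r c = mx)"
  have c: "excess D r c = mx" unfolding c_def using ex by (rule LeastI_ex)
  have lt: "excess D r e < mx" if "e < c" for e
    using not_less_Least[of e "\<lambda>c. excess D r c = mx"] that ge[of e] unfolding c_def by fastforce
  have "0 < mx" using pos ge[of c0] by simp
  moreover have "1 \<le> c" using \<open>0 < mx\<close> c excess_0[OF D, of r] by (cases c) auto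
  ultimately show ?thesis unfolding copivot_def using c ge lt by auto
qed

text \<open>This cell of row \<open>r + 1\<close> replaces the moved cell in arguments about chains of cells.\<close>

lemma pivot_partner:
  assumes "pivot D r c" "(r, e) \<in> D" "1 \<le> e" "e < c"
  shows "\<exists>e'. e \<le> e' \<and> e' < c \<and> (Suc r, e') \<in> D"
proof (rule ccontr)
  assume "\<not> ?thesis"
  then have le: "e - 1 \<le> c - 1" and emp: "{f. e - 1 < f \<and> f \<le> c - 1 \<and> (Suc r, f) \<in> D} = {}" using assms by (simp, fastforce)
  moreover have "e \<in> {f. e - 1 < f \<and> f \<le> c - 1 \<and> (r, f) \<in> D}" using assms by simp
  then have "0 < card {f. e - 1 < f \<and> f \<le> c - 1 \<and> (r, f) \<in> D}"
    using finite_subset[of "{f. e - 1 < f \<and> f \<le> c - 1 \<and> (r, f) \<in> D}" "{..c}"]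
    by (subst card_gt_0_iff) fastforce
  moreover have "excess D r (e - 1) \<le> excess D r (c - 1)" using assms unfolding pivot_def by simp
  ultimately show False using excess_diff[OF le, of D r, unfolded emp] by simp
qed

lemma copivot_partner:
  assumes "copivot D r c" "(Suc r, e) \<in> D" "c < e"
  shows "\<exists>e'. c < e' \<and> e' \<le> e \<and> (r, e') \<in> D"
proof (rule ccontr)
  assume "\<not> ?thesis"
  then have emp: "{f. c < f \<and> f \<le> e \<and> (r, f) \<in> D} = {}" by fastforce
  moreover have "e \<in> {f. c < f \<and> f \<le> e \<and> (Suc r, f) \<in> D}" using assms by simp
  then have "0 < card {f. c < f \<and> f \<le> e \<and> (Suc r, f) \<in> D}"
    using finite_subset[of "{f. c < f \<and> f \<le> e \<and> (Suc r, f) \<in> D}" "{..e}"]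
    by (subst card_gt_0_iff) fastforce
  moreover have "excess D r e \<le> excess D r c" using assms unfolding copivot_def by simp
  ultimately show False using excess_diff[of c e D r, unfolded emp] assms(3) by simp
qed

text \<open>If row \<open>i\<close> is full in an interval of columns and row \<open>k\<close> has at least as many cells there, then row
  \<open>k\<close> is full as well; this is how a run of cells of a transversal is moved to the next row.\<close>

lemma filled_interval:
  fixes D :: diagram
  assumes sub: "\<And>f. c < f \<Longrightarrow> f \<le> d \<Longrightarrow> (i, f) \<in> D"
    and card: "card {f. c < f \<and> f \<le> d \<and> (i, f) \<in> D} \<le> card {f. c < f \<and> f \<le> d \<and> (k, f) \<in> D}"
    and f: "c < f" "f \<le> d"
  shows "(k, f) \<in> D"
proof -
  have "{f. c < f \<and> f \<le> d \<and> (i, f) \<in> D} = {c<..d}" using sub by auto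
  then have "card {c<..d} \<le> card {f. c < f \<and> f \<le> d \<and> (k, f) \<in> D}" using card by simp
  then have "{f. c < f \<and> f \<le> d \<and> (k, f) \<in> D} = {c<..d}"
  proof -
    assume h: "card {c<..d} \<le> card {f. c < f \<and> f \<le> d \<and> (k, f) \<in> D}"
    have sub: "{f. c < f \<and> f \<le> d \<and> (k, f) \<in> D} \<subseteq> {c<..d}" by auto
    from card_mono[OF finite_greaterThanAtMost sub] h have "card {f. c < f \<and> f \<le> d \<and> (k, f) \<in> D} = card {c<..d}" by simp
    with sub show ?thesis by (intro card_subset_eq) auto
  qed
  then have "f \<in> {f. c < f \<and> f \<le> d \<and> (k, f) \<in> D}" using f by simp
  then show ?thesis by simp
qed

subsection \<open>The component of a highest weight diagram with two rows\<close>

text \<open>The last two conditions express that the shape of \<open>D\<close> has at most two rows, and that its first row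
  has length \<open>m\<close>.\<close>

definition good :: "nat \<Rightarrow> nat set \<Rightarrow> diagram \<Rightarrow> bool" where
  "good m S D \<longleftrightarrow> is_diagram D \<and> S \<subseteq> {1..m} \<and>
     (\<forall>c. card {i. (i, c) \<in> D} = (if c \<in> S then 2 else if 1 \<le> c \<and> c \<le> m then 1 else 0)) \<and>
     (\<nexists>i1 c1 i2 c2 i3 c3. (i1, c1) \<in> D \<and> (i2, c2) \<in> D \<and> (i3, c3) \<in> D \<and>
        i1 < i2 \<and> i2 < i3 \<and> c1 \<le> c2 \<and> c2 \<le> c3) \<and>
     (\<exists>s. (\<forall>c. 1 \<le> c \<and> c \<le> m \<longrightarrow> (s c, c) \<in> D) \<and>
        (\<forall>c d. 1 \<le> c \<and> c \<le> d \<and> d \<le> m \<longrightarrow> s d \<le> s c))"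

lemma card_column_move:
  assumes "(i, c) \<in> D" "(k, c) \<notin> D"
  shows "card {l. (l, e) \<in> move i k c D} = card {l. (l, e) \<in> D}"
proof (cases "e = c")
  case True
  have "{l. (l, e) \<in> move i k c D} = insert k ({l. (l, c) \<in> D} - {i})"
    using True assms by (auto simp: move_def)
  moreover have "card (insert k ({l. (l, c) \<in> D} - {i})) = card {l. (l, c) \<in> D}"
  proof (cases "finite {l. (l, c) \<in> D}")
    case f: True
    then have "card (insert k ({l. (l, c) \<in> D} - {i})) = Suc (card ({l. (l, c) \<in> D} - {i}))"
      using assms by (intro card_insert_disjoint) auto
    also have "\<dots> = card {l. (l, c) \<in> D}" using assms by (intro card_Suc_Diff1[OF f]) simp
    finally show ?thesis .
  next
    case False then show ?thesis by simp
  qed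
  ultimately show ?thesis using True by simp
next
  case False
  then have "{l. (l, e) \<in> move i k c D} = {l. (l, e) \<in> D}" by (auto simp: move_def)
  then show ?thesis by simp
qed

lemma two_row_column:
  assumes g: "good m S D" and ic: "(i, c) \<in> D" shows "1 \<le> i \<and> 1 \<le> c \<and> c \<le> m"
proof -
  have D: "is_diagram D" using g by (simp add: good_def)
  have "{i. (i, c) \<in> D} \<subseteq> fst ` D" by force
  then have "finite {i. (i, c) \<in> D}" using D finite_subset unfolding is_diagram_def by blast
  then have "card {i. (i, c) \<in> D} \<noteq> 0" using ic by auto
  then have "c \<in> S \<or> 1 \<le> c \<and> c \<le> m" using g unfolding good_def by (metis (full_types))
  then show ?thesis using D ic g unfolding good_def is_diagram_def by auto
qed

text \<open>
  A forbidden triple that uses the new cell can be repaired with the old cell, or, if it also contains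
  a cell of row \<open>r\<close>, with the partner of that cell.  A transversal that uses the removed cell is shifted
  down along the cells of row \<open>r\<close> that precede it.
\<close>

lemma good_move_down:
  assumes g: "good m S D" and p: "pivot D r c" and r: "1 \<le> r"
  shows "good m S (move r (Suc r) c D)"
proof -
  let ?E = "move r (Suc r) c D"
  have D: "is_diagram D" using g by (simp add: good_def)
  have col1: "1 \<le> e" if "(i, e) \<in> D" for i e using D that by (auto simp: is_diagram_def)
  note cells = pivot_cells[OF p]
  have cE: "(i, e) \<in> ?E \<longleftrightarrow> (i, e) = (Suc r, c) \<or> ((i, e) \<in> D \<and> (i, e) \<noteq> (r, c))" for i e
    by (auto simp: move_def)
  have J1: "\<not> (i1 < i2 \<and> i2 < i3 \<and> c1 \<le> c2 \<and> c2 \<le> c3)"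
    if "(i1, c1) \<in> D" "(i2, c2) \<in> D" "(i3, c3) \<in> D" for i1 c1 i2 c2 i3 c3
    using g that unfolding good_def by blast
  have J1': "\<nexists>i1 c1 i2 c2 i3 c3. (i1, c1) \<in> ?E \<and> (i2, c2) \<in> ?E \<and> (i3, c3) \<in> ?E \<and>
        i1 < i2 \<and> i2 < i3 \<and> c1 \<le> c2 \<and> c2 \<le> c3"
  proof clarify
    fix i1 c1 i2 c2 i3 c3
    assume E: "(i1, c1) \<in> ?E" "(i2, c2) \<in> ?E" "(i3, c3) \<in> ?E"
      and lt: "i1 < i2" "i2 < i3" "c1 \<le> c2" "c2 \<le> c3"
    consider (1) "(i1, c1) = (Suc r, c)" | (2) "(i2, c2) = (Suc r, c)" | (3) "(i3, c3) = (Suc r, c)"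
      | (0) "(i1, c1) \<in> D" "(i2, c2) \<in> D" "(i3, c3) \<in> D" using E cE by blast
    then show False
    proof cases
      case 0 then show ?thesis using J1 lt by blast
    next
      case 1
      then have "(i2, c2) \<in> D" "(i3, c3) \<in> D" using E cE lt by auto
      then show ?thesis using J1[of r c i2 c2 i3 c3] 1 lt cells by auto
    next
      case 2
      then have 13: "(i1, c1) \<in> D" "(i3, c3) \<in> D" "(i1, c1) \<noteq> (r, c)" using E cE lt by auto
      show ?thesis
      proof (cases "i1 = r")
        case True
        then obtain e where e: "c1 \<le> e" "e < c" "(Suc r, e) \<in> D"
          using pivot_partner[OF p, of c1] 13 col1[of i1 c1] 2 lt by (cases "c1 = c") auto
        then show ?thesis using J1[OF 13(1) e(3) 13(2)] True 2 lt by auto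
      next
        case False
        then show ?thesis using J1[of i1 c1 r c i3 c3] 13 cells 2 lt by auto
      qed
    next
      case 3
      then have 12: "(i1, c1) \<in> D" "(i2, c2) \<in> D" "(i2, c2) \<noteq> (r, c)" using E cE lt by auto
      show ?thesis
      proof (cases "i2 = r")
        case True
        then obtain e where e: "c2 \<le> e" "e < c" "(Suc r, e) \<in> D"
          using pivot_partner[OF p, of c2] 12 col1[of i2 c2] 3 lt by (cases "c2 = c") auto
        then show ?thesis using J1[OF 12(1,2) e(3)] True 3 lt by auto
      next
        case False
        then show ?thesis using J1[of i1 c1 i2 c2 r c] 12 cells 3 lt by auto
      qed
    qed
  qed
  obtain s where s: "\<And>e. 1 \<le> e \<Longrightarrow> e \<le> m \<Longrightarrow> (s e, e) \<in> D"
    and sm: "\<And>e d. 1 \<le> e \<Longrightarrow> e \<le> d \<Longrightarrow> d \<le> m \<Longrightarrow> s d \<le> s e"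
    using g unfolding good_def by blast
  \<comment> \<open>If the transversal uses the moved cell, the run of cells of row \<open>r\<close> that it uses up to
    column \<open>c\<close> is matched by cells of row \<open>r + 1\<close>, and the transversal is shifted down there.\<close>
  define s' where "s' e = (if s c = r \<and> e \<le> c \<and> s e = r then Suc r else s e)" for e
  have J2: "(s' e, e) \<in> ?E" if e: "1 \<le> e" "e \<le> m" for e
  proof (cases "s c = r \<and> e \<le> c \<and> s e = r")
    case True
    show ?thesis
    proof (cases "e = c")
      case ec: True then show ?thesis using True cE by (auto simp: s'_def)
    next
      case False
      have cm: "c \<le> m" using two_row_column[OF g conjunct1[OF cells]] by simp
      have run: "(r, f) \<in> D" if "e - 1 < f" "f \<le> c - 1" for f
      proof -
        have f: "1 \<le> f" "f \<le> m" "e \<le> f" "f \<le> c" using that cm e True by auto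
        then have "s f = r" using sm[of e f] sm[of f c] True cm e by simp
        then show ?thesis using s[of f] f by simp
      qed
      have "e - 1 < c" using True e by linarith
      then have "excess D r (e - 1) \<le> excess D r (c - 1)" using p unfolding pivot_def by blast
      then have "card {f. e - 1 < f \<and> f \<le> c - 1 \<and> (r, f) \<in> D} \<le> card {f. e - 1 < f \<and> f \<le> c - 1 \<and> (Suc r, f) \<in> D}"
        using excess_diff[of "e - 1" "c - 1" D r] \<open>e - 1 < c\<close> by linarith
      moreover have "e \<le> c - 1" using True False by linarith
      moreover have "e - 1 < e" using e by simp
      ultimately have "(Suc r, e) \<in> D"
        using filled_interval[of "e - 1" "c - 1" r D "Suc r" e, OF run] by blast
      then show ?thesis using True cE by (auto simp: s'_def)
    qed
  next
    case False
    then have "s' e = s e" by (auto simp: s'_def)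
    moreover have "(s e, e) \<noteq> (r, c)" using False by auto
    ultimately show ?thesis using s[OF e] cE by auto
  qed
  have J2': "s' d \<le> s' e" if "1 \<le> e" "e \<le> d" "d \<le> m" for e d
    using sm[OF that] that by (auto simp: s'_def)
  show ?thesis
    unfolding good_def
  proof (intro conjI allI)
    show "is_diagram ?E" using is_diagram_move[OF D _ conjunct1[OF cells]] by simp
    show "S \<subseteq> {1..m}" using g by (simp add: good_def)
    fix e show "card {i. (i, e) \<in> ?E} = (if e \<in> S then 2 else if 1 \<le> e \<and> e \<le> m then 1 else 0)"
      using card_column_move[OF conjunct1[OF cells] conjunct2[OF cells], of e] g unfolding good_def by simp
  qed (use J1' J2 J2' in blast)+
qed

lemma good_move_up:
  assumes g: "good m S D" and p: "copivot D r c" and r: "1 \<le> r"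
  shows "good m S (move (Suc r) r c D)"
proof -
  let ?E = "move (Suc r) r c D"
  have D: "is_diagram D" using g by (simp add: good_def)
  note cells = copivot_cells[OF p]
  have c1: "1 \<le> c" using p by (simp add: copivot_def)
  have cE: "(i, e) \<in> ?E \<longleftrightarrow> (i, e) = (r, c) \<or> ((i, e) \<in> D \<and> (i, e) \<noteq> (Suc r, c))" for i e
    by (auto simp: move_def)
  have J1: "\<not> (i1 < i2 \<and> i2 < i3 \<and> c1 \<le> c2 \<and> c2 \<le> c3)"
    if "(i1, c1) \<in> D" "(i2, c2) \<in> D" "(i3, c3) \<in> D" for i1 c1 i2 c2 i3 c3
    using g that unfolding good_def by blast
  have J1': "\<nexists>i1 c1 i2 c2 i3 c3. (i1, c1) \<in> ?E \<and> (i2, c2) \<in> ?E \<and> (i3, c3) \<in> ?E \<and>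
        i1 < i2 \<and> i2 < i3 \<and> c1 \<le> c2 \<and> c2 \<le> c3"
  proof clarify
    fix i1 c1 i2 c2 i3 c3
    assume E: "(i1, c1) \<in> ?E" "(i2, c2) \<in> ?E" "(i3, c3) \<in> ?E"
      and lt: "i1 < i2" "i2 < i3" "c1 \<le> c2" "c2 \<le> c3"
    consider (1) "(i1, c1) = (r, c)" | (2) "(i2, c2) = (r, c)" | (3) "(i3, c3) = (r, c)"
      | (0) "(i1, c1) \<in> D" "(i2, c2) \<in> D" "(i3, c3) \<in> D" using E cE by blast
    then show False
    proof cases
      case 0 then show ?thesis using J1 lt by blast
    next
      case 3
      then have "(i2, c2) \<in> D" "(i1, c1) \<in> D" using E cE lt by auto
      then show ?thesis using J1[of i1 c1 i2 c2 "Suc r" c] 3 lt cells by auto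
    next
      case 2
      then have 13: "(i1, c1) \<in> D" "(i3, c3) \<in> D" "(i3, c3) \<noteq> (Suc r, c)" using E cE lt by auto
      show ?thesis
      proof (cases "i3 = Suc r")
        case True
        then obtain e where e: "c < e" "e \<le> c3" "(r, e) \<in> D"
          using copivot_partner[OF p, of c3] 13 2 lt by (cases "c3 = c") auto
        then show ?thesis using J1[OF 13(1) e(3) 13(2)] True 2 lt by auto
      next
        case False
        then show ?thesis using J1[of i1 c1 "Suc r" c i3 c3] 13 cells 2 lt by auto
      qed
    next
      case 1
      then have 12: "(i2, c2) \<in> D" "(i3, c3) \<in> D" "(i2, c2) \<noteq> (Suc r, c)" using E cE lt by auto
      show ?thesis
      proof (cases "i2 = Suc r")
        case True
        then obtain e where e: "c < e" "e \<le> c2" "(r, e) \<in> D"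
          using copivot_partner[OF p, of c2] 12 1 lt by (cases "c2 = c") auto
        then show ?thesis using J1[OF e(3) 12(1,2)] True 1 lt by auto
      next
        case False
        then show ?thesis using J1[of "Suc r" c i2 c2 i3 c3] 12 cells 1 lt by auto
      qed
    qed
  qed
  obtain s where s: "\<And>e. 1 \<le> e \<Longrightarrow> e \<le> m \<Longrightarrow> (s e, e) \<in> D"
    and sm: "\<And>e d. 1 \<le> e \<Longrightarrow> e \<le> d \<Longrightarrow> d \<le> m \<Longrightarrow> s d \<le> s e"
    using g unfolding good_def by blast
  define s' where "s' e = (if s c = Suc r \<and> c \<le> e \<and> s e = Suc r then r else s e)" for e
  have J2: "(s' e, e) \<in> ?E" if e: "1 \<le> e" "e \<le> m" for e
  proof (cases "s c = Suc r \<and> c \<le> e \<and> s e = Suc r")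
    case True
    show ?thesis
    proof (cases "e = c")
      case ec: True then show ?thesis using True cE by (auto simp: s'_def)
    next
      case False
      have run: "(Suc r, f) \<in> D" if "c < f" "f \<le> e" for f
      proof -
        have "s f = Suc r" using sm[of f e] sm[of c f] True c1 that e by simp
        then show ?thesis using s[of f] that e by simp
      qed
      have "excess D r e \<le> excess D r c" using p True False unfolding copivot_def by simp
      then have "card {f. c < f \<and> f \<le> e \<and> (Suc r, f) \<in> D} \<le> card {f. c < f \<and> f \<le> e \<and> (r, f) \<in> D}"
        using excess_diff[of c e D r] True by simp
      from filled_interval[OF run this, of e] have "(r, e) \<in> D" using True False e by simp
      then show ?thesis using True cE by (auto simp: s'_def)
    qed
  next
    case False
    then have "s' e = s e" by (auto simp: s'_def)
    moreover have "(s e, e) \<noteq> (Suc r, c)" using False by auto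
    ultimately show ?thesis using s[OF e] cE by auto
  qed
  have J2': "s' d \<le> s' e" if "1 \<le> e" "e \<le> d" "d \<le> m" for e d
    using sm[OF that] sm[of c e] sm[of e d] c1 that by (cases "c \<le> e") (auto simp: s'_def)
  show ?thesis
    unfolding good_def
  proof (intro conjI allI)
    show "is_diagram ?E" by (rule is_diagram_move[OF D r conjunct1[OF cells]])
    show "S \<subseteq> {1..m}" using g by (simp add: good_def)
    fix e show "card {i. (i, e) \<in> ?E} = (if e \<in> S then 2 else if 1 \<le> e \<and> e \<le> m then 1 else 0)"
      using card_column_move[OF conjunct1[OF cells] conjunct2[OF cells], of e] g unfolding good_def by simp
  qed (use J1' J2 J2' in blast)+
qed

text \<open>This is the image of the alignment of a tableau if the alignment has the columns \<open>1, \<dots>, m\<close>, those in \<open>S\<close>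
  with two entries.\<close>

definition highest :: "nat \<Rightarrow> nat set \<Rightarrow> diagram" where
  "highest m S = Pair 1 ` {1..m} \<union> Pair 2 ` S"

lemma highest_good: "S \<subseteq> {1..m} \<Longrightarrow> good m S (highest m S)"
  unfolding good_def
proof (intro conjI allI)
  assume S: "S \<subseteq> {1..m}"
  show "is_diagram (highest m S)"
    using S finite_subset[OF S] by (auto simp: is_diagram_def highest_def)
  show "S \<subseteq> {1..m}" by (rule S)
  show "card {i. (i, c) \<in> highest m S} = (if c \<in> S then 2 else if 1 \<le> c \<and> c \<le> m then 1 else 0)" for c
  proof -
    have "{i. (i, c) \<in> highest m S} = (if c \<in> S then {1, 2} else if 1 \<le> c \<and> c \<le> m then {1} else {})"
      using S by (auto simp: highest_def)
    then show ?thesis by simp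
  qed
  show "\<nexists>i1 c1 i2 c2 i3 c3. (i1, c1) \<in> highest m S \<and> (i2, c2) \<in> highest m S \<and> (i3, c3) \<in> highest m S \<and>
        i1 < i2 \<and> i2 < i3 \<and> c1 \<le> c2 \<and> c2 \<le> c3"
    by (auto simp: highest_def)
  show "\<exists>s. (\<forall>c. 1 \<le> c \<and> c \<le> m \<longrightarrow> (s c, c) \<in> highest m S) \<and>
        (\<forall>c d. 1 \<le> c \<and> c \<le> d \<and> d \<le> m \<longrightarrow> s d \<le> s c)"
    by (rule exI[of _ "\<lambda>_. 1"]) (auto simp: highest_def)
qed

text \<open>
  A column \<open>{2}\<close> would force the transversal to use row 2 in all columns before it; as the excess is
  nonpositive, row 1 would then be full up to this column, including the column itself.
\<close>

lemma good_eq_highest: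
  assumes g: "good m S D" and rows: "\<And>i c. (i, c) \<in> D \<Longrightarrow> i \<le> 2" and ex: "\<And>c. excess D 1 c \<le> 0"
  shows "D = highest m S"
proof -
  have D: "is_diagram D" and Sm: "S \<subseteq> {1..m}" using g by (auto simp: good_def)
  have cd: "card {i. (i, c) \<in> D} = (if c \<in> S then 2 else if 1 \<le> c \<and> c \<le> m then 1 else 0)" for c
    using g by (simp add: good_def)
  have sub: "{i. (i, c) \<in> D} \<subseteq> {1, 2}" for c
  proof
    fix i assume "i \<in> {i. (i, c) \<in> D}"
    then have "(i, c) \<in> D" by simp
    then have "i \<le> 2" "1 \<le> i" using rows two_row_column[OF g] by blast+
    then show "i \<in> {1, 2}" by auto
  qed
  have dbl: "{i. (i, c) \<in> D} = {1, 2}" if "c \<in> S" for c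
    using card_subset_eq[OF _ sub[of c]] cd[of c] that by simp
  have sgl: "{i. (i, c) \<in> D} = {1}" if c: "1 \<le> c" "c \<le> m" "c \<notin> S" for c
  proof -
    obtain i where i: "{i. (i, c) \<in> D} = {i}" using cd[of c] c by (auto simp: card_1_singleton_iff)
    have "i \<noteq> 2"
    proof
      assume "i = 2"
      then have c2: "(2, c) \<in> D" "(1, c) \<notin> D"
        using eqset_imp_iff[OF i, of 1] eqset_imp_iff[OF i, of 2] by auto
      obtain s where s: "\<And>e. 1 \<le> e \<Longrightarrow> e \<le> m \<Longrightarrow> (s e, e) \<in> D"
        and sm: "\<And>e d. 1 \<le> e \<Longrightarrow> e \<le> d \<Longrightarrow> d \<le> m \<Longrightarrow> s d \<le> s e"
        using g unfolding good_def by blast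
      have "s c = 2" using s[of c] c i \<open>i = 2\<close> by auto
      then have "(2, e) \<in> D" if "0 < e" "e \<le> c" for e
        using s[of e] sm[of e c] sub[of e] that c by force
      then have "(Suc 1, e) \<in> D" if "0 < e" "e \<le> c" for e using that by (simp add: numeral_2_eq_2)
      moreover have "card {f. 0 < f \<and> f \<le> c \<and> (Suc 1, f) \<in> D} \<le> card {f. 0 < f \<and> f \<le> c \<and> (1, f) \<in> D}"
        using excess_diff[of 0 c D 1] ex[of c] excess_0[OF D, of 1] by simp
      ultimately have "(1, c) \<in> D" by (rule filled_interval) (use c in auto)
      then show False using c2 by simp
    qed
    moreover have "i \<in> {1, 2}" using sub[of c] i by auto
    ultimately show ?thesis using i by auto
  qed
  show ?thesis
  proof (intro equalityI subrelI)
    fix i c assume ic: "(i, c) \<in> D"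
    then have c: "1 \<le> c" "c \<le> m" using two_row_column[OF g] by blast+
    have "i \<in> {i. (i, c) \<in> D}" using ic by simp
    then have "i = 1 \<or> i = 2 \<and> c \<in> S" using dbl[of c] sgl[of c] c by (cases "c \<in> S") auto
    then show "(i, c) \<in> highest m S" using c by (auto simp: highest_def)
  next
    fix i c assume "(i, c) \<in> highest m S"
    then consider "i = 1" "1 \<le> c" "c \<le> m" | "i = 2" "c \<in> S" by (auto simp: highest_def)
    then show "(i, c) \<in> D" using dbl[of c] sgl[of c] by cases (cases "c \<in> S"; auto)+
  qed
qed

lemma good_component:
  assumes "(highest m S, D) \<in> (diagram_crystal_edges \<union> diagram_crystal_edges\<inverse>)\<^sup>*" "S \<subseteq> {1..m}"
  shows "good m S D"
  using assms(1)
proof (induction rule: rtrancl_induct)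
  case base then show ?case by (rule highest_good[OF assms(2)])
next
  case (step D E)
  consider "(D, E) \<in> diagram_crystal_edges" | "(E, D) \<in> diagram_crystal_edges" using step.hyps(2) by auto
  then show ?case
  proof cases
    case 1
    then obtain r where r: "is_diagram D" "1 \<le> r" "f_diagram r D = Some E"
      by (auto simp: diagram_crystal_edges_def)
    then obtain c where "pivot D r c" "E = move r (Suc r) c D" using f_diagram_eq_Some_iff by blast
    then show ?thesis using good_move_down[OF step.IH] r by simp
  next
    case 2
    then obtain r where r: "is_diagram E" "1 \<le> r" "f_diagram r E = Some D"
      by (auto simp: diagram_crystal_edges_def)
    then obtain c where c: "pivot E r c" "D = move r (Suc r) c E" using f_diagram_eq_Some_iff by blast
    have "copivot D r c" using pivot_move[OF c(1)] c(2) by simp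
    moreover have "E = move (Suc r) r c D"
      using pivot_cells[OF c(1)] c(2) by (simp add: move_inverse)
    ultimately show ?thesis using good_move_up[OF step.IH] r by simp
  qed
qed

lemma f_diagram_copivot:
  assumes "is_diagram D" "1 \<le> r" "copivot D r c"
  shows "f_diagram r (move (Suc r) r c D) = Some D" "is_diagram (move (Suc r) r c D)"
proof -
  note cells = copivot_cells[OF assms(3)]
  show E: "is_diagram (move (Suc r) r c D)"
    by (rule is_diagram_move[OF assms(1,2) conjunct1[OF cells]])
  show "f_diagram r (move (Suc r) r c D) = Some D"
    unfolding f_diagram_eq_Some_iff[OF E]
    using copivot_move[OF assms(3)] move_inverse[of "Suc r" c D r] cells by metis
qed

section \<open>The filling of a diagram\<close>

definition tp :: "diagram \<Rightarrow> nat \<Rightarrow> nat" where "tp D c = Min {i. (i, c) \<in> D}"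
definition lw :: "diagram \<Rightarrow> nat \<Rightarrow> nat" where "lw D c = Max {i. (i, c) \<in> D}"

text \<open>
  Here \<open>a c\<close> and, for \<open>c\<close> in \<open>S\<close>, \<open>b c\<close> are the entries of rows 1 and 2 in column \<open>c\<close> of the alignment of
  a two-row tableau.  The condition \<open>stuck\<close> says that \<open>b c\<close> cannot move to the next column.
\<close>

locale aligned = finite_poset P le for P :: "'a set" and le +
  fixes m :: nat and S :: "nat set" and a b :: "nat \<Rightarrow> 'a"
  assumes free: "three_plus_one_free P le"
    and P_eq: "P = a ` {1..m} \<union> b ` S"
    and S_sub: "S \<subseteq> {1..m}"
    and disj: "1 \<le> i \<Longrightarrow> i \<le> m \<Longrightarrow> j \<in> S \<Longrightarrow> a i \<noteq> b j"
    and a_mono: "1 \<le> i \<Longrightarrow> i < j \<Longrightarrow> j \<le> m \<Longrightarrow> lt le (a i) (a j)"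
    and b_mono: "i \<in> S \<Longrightarrow> j \<in> S \<Longrightarrow> i < j \<Longrightarrow> lt le (b i) (b j)"
    and same_column: "c \<in> S \<Longrightarrow> \<not> lt le (b c) (a c)"
    and stuck: "c \<in> S \<Longrightarrow> c < m \<Longrightarrow> lt le (b c) (a (c + 1)) \<or> c + 1 \<in> S"
begin

lemma S_range: "c \<in> S \<Longrightarrow> 1 \<le> c \<and> c \<le> m" using S_sub by auto

lemma aP: "1 \<le> c \<Longrightarrow> c \<le> m \<Longrightarrow> a c \<in> P" by (auto simp: P_eq)
lemma bP: "c \<in> S \<Longrightarrow> b c \<in> P" by (auto simp: P_eq)

lemma P_cases:
  assumes "x \<in> P"
  obtains (a) c where "1 \<le> c" "c \<le> m" "x = a c" | (b) c where "c \<in> S" "x = b c"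
  using assms by (auto simp: P_eq)

lemma a_inj: "\<lbrakk>1 \<le> i; i \<le> m; 1 \<le> j; j \<le> m; a i = a j\<rbrakk> \<Longrightarrow> i = j"
  using a_mono[of i j] a_mono[of j i] by (cases i j rule: linorder_cases) auto

lemma b_inj: "\<lbrakk>i \<in> S; j \<in> S; b i = b j\<rbrakk> \<Longrightarrow> i = j"
  using b_mono[of i j] b_mono[of j i] by (cases i j rule: linorder_cases) auto

lemma comparable_to_chain:
  assumes "x \<prec> y" "y \<prec> z" "x \<in> P" "y \<in> P" "z \<in> P" "w \<in> P" "w \<noteq> x" "w \<noteq> y" "w \<noteq> z"
  shows "x \<prec> w \<or> w \<prec> x \<or> y \<prec> w \<or> w \<prec> y \<or> z \<prec> w \<or> w \<prec> z"
proof (rule ccontr)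
  assume n: "\<not> ?thesis"
  have "incomparable le x w" "incomparable le y w" "incomparable le z w"
    using n assms by (auto simp: incomparable_def lt_def)
  then show False using free assms unfolding three_plus_one_free_def by blast
qed

text \<open>Because \<open>a (c - 1)\<close> lies below \<open>a c\<close>, in a linked column it singles out \<open>a c\<close>.\<close>

definition link :: "nat \<Rightarrow> bool" where
  "link c \<longleftrightarrow> 2 \<le> c \<and> c \<in> S \<and> \<not> a (c - 1) \<prec> b c"

text \<open>In a linked column \<open>b c\<close> is incomparable to \<open>a (c - 1)\<close> and \<open>a c\<close>, so it must be comparable to
  \<open>a (c + 1)\<close>.\<close>

lemma link_b_less:
  assumes l: "link c" and d: "c < d" "d \<le> m" shows "b c \<prec> a d"
proof -
  have c: "2 \<le> c" "c \<in> S" "\<not> a (c - 1) \<prec> b c" "c + 1 \<le> m"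
    using l d by (auto simp: link_def)
  have c': "1 \<le> c - 1" "c - 1 \<le> m" "c \<le> m" "1 \<le> c" "c - 1 < c" "1 \<le> c + 1" using c by arith+
  have 1: "a (c - 1) \<prec> a c" "a c \<prec> a (c + 1)" using a_mono[of "c-1" c] a_mono[of c "c+1"] c c' by auto
  have "b c \<noteq> a (c - 1)" "b c \<noteq> a c" "b c \<noteq> a (c + 1)"
    using disj[of "c-1" c] disj[of c c] disj[of "c+1" c] c c' by metis+
  with comparable_to_chain[OF 1 aP aP aP bP[OF c(2)]] c c'
  have "a (c-1) \<prec> b c \<or> b c \<prec> a (c-1) \<or> a c \<prec> b c \<or> b c \<prec> a c \<or> a (c+1) \<prec> b c \<or> b c \<prec> a (c+1)"
    by simp
  then have *: "b c \<prec> a (c + 1)" using c(3) same_column[OF c(2)] 1 lt_trans by blast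
  then show ?thesis using a_mono[of "c+1" d] d c lt_trans by (cases "d = c + 1") auto
qed

text \<open>The chain \<open>a (d - 2)\<close>, \<open>a (d - 1)\<close>, \<open>a d\<close> has an element comparable to \<open>b d\<close>, and no element of it lies
  above \<open>b d\<close>.\<close>

lemma a_less_b:
  assumes e: "1 \<le> e" "e < d" "d \<in> S" and nl: "d = e + 1 \<Longrightarrow> \<not> link d"
  shows "a e \<prec> b d"
proof (cases "d = e + 1")
  case True then show ?thesis using nl e by (auto simp: link_def)
next
  case False
  then have d: "e \<le> d - 2" "2 < d" "d \<le> m" "1 \<le> d - 2" using e S_range by auto
  have d': "1 \<le> d - 1" "d - 1 \<le> m" "d - 2 \<le> m" "1 \<le> d" "d - 2 < d - 1" "d - 1 < d" using d by arith+
  have 1: "a (d - 2) \<prec> a (d - 1)" "a (d - 1) \<prec> a d"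
    using a_mono[of "d-2" "d-1"] a_mono[of "d-1" d] d d' by auto
  have "b d \<noteq> a (d - 2)" "b d \<noteq> a (d - 1)" "b d \<noteq> a d"
    using disj[of "d-2" d] disj[of "d-1" d] disj[of d d] d d' e by metis+
  with comparable_to_chain[OF 1 aP aP aP bP[OF e(3)]] d d'
  have "a (d-2) \<prec> b d \<or> b d \<prec> a (d-2) \<or> a (d-1) \<prec> b d \<or> b d \<prec> a (d-1) \<or> a d \<prec> b d \<or> b d \<prec> a d"
    by simp
  then have "a (d - 2) \<prec> b d" using same_column[OF e(3)] 1 lt_trans by blast
  then show ?thesis using a_mono[of e "d-2"] d d' e lt_trans by (cases "e = d - 2") auto
qed

text \<open>An entry \<open>b c\<close> that is not below a later \<open>a d\<close> is stuck because of \<open>b (c + 1)\<close>, which is not below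
  \<open>a d\<close> either; so the two-element columns continue up to \<open>d\<close>.\<close>

lemma not_b_less_a:
  assumes "c \<in> S" "c \<le> d" "d \<le> m" "\<not> b c \<prec> a d" "c \<le> e" "e \<le> d"
  shows "e \<in> S \<and> \<not> b e \<prec> a d \<and> (e < d \<longrightarrow> \<not> b e \<prec> a (e + 1))"
  using assms(5,6)
proof (induction e rule: dec_induct)
  case base
  have "b c \<prec> a (c + 1) \<Longrightarrow> c < d \<Longrightarrow> b c \<prec> a d"
    using a_mono[of "c+1" d] assms(3) lt_trans by (cases "c + 1 = d") auto
  then show ?case using assms by blast
next
  case (step e)
  then have IH: "e \<in> S" "\<not> b e \<prec> a d" "\<not> b e \<prec> a (e + 1)" by auto
  then have S': "Suc e \<in> S" using stuck[of e] step.prems assms(3) by auto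
  then have nb: "\<not> b (Suc e) \<prec> a d" using b_mono[of e "Suc e"] IH lt_trans by blast
  have "b (Suc e) \<prec> a (Suc e + 1) \<Longrightarrow> Suc e < d \<Longrightarrow> b (Suc e) \<prec> a d"
    using a_mono[of "Suc e + 1" d] assms(3) lt_trans by (cases "Suc e + 1 = d") auto
  then show ?case using S' nb by blast
qed

text \<open>Otherwise \<open>a (d - 1)\<close> would be incomparable to all of \<open>b (d - 2)\<close>, \<open>b (d - 1)\<close> and \<open>b d\<close>.\<close>

lemma no_link_after:
  assumes c: "c \<in> S" "c + 2 \<le> d" "d \<le> m" "\<not> b c \<prec> a d" shows "\<not> link d"
proof
  assume l: "link d"
  define e where "e = d - 2"
  have e: "c \<le> e" "d = e + 2" using c by (auto simp: e_def)
  note N = not_b_less_a[OF c(1) _ c(3,4)]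
  have S3: "e \<in> S" "e + 1 \<in> S" "e + 2 \<in> S" "\<not> b e \<prec> a (e + 1)"
    using N[of e] N[of "e+1"] N[of "e+2"] c e by auto
  have "\<not> a (e + 1) \<prec> b (e + 2)" using l e by (simp add: link_def)
  moreover have ch: "b e \<prec> b (e + 1)" "b (e + 1) \<prec> b (e + 2)" using b_mono S3 by auto
  moreover have "a (e + 1) \<noteq> b e" "a (e + 1) \<noteq> b (e + 1)" "a (e + 1) \<noteq> b (e + 2)"
    using disj[of "e+1"] S3 S_range by auto
  ultimately show False
    using comparable_to_chain[OF ch bP bP bP aP, of "e + 1"] S3 S_range[of "e+1"] lt_trans
      b_mono[of e "e+2"] by (metis less_add_same_cancel1 zero_less_numeral)
qed

definition col :: "'a \<Rightarrow> nat" where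
  "col x = (THE c. (1 \<le> c \<and> c \<le> m \<and> x = a c) \<or> (c \<in> S \<and> x = b c))"

lemma col_a [simp]: "1 \<le> c \<Longrightarrow> c \<le> m \<Longrightarrow> col (a c) = c"
  unfolding col_def using a_inj disj by (intro the_equality) auto

lemma col_b [simp]: "c \<in> S \<Longrightarrow> col (b c) = c"
  unfolding col_def using b_inj disj by (intro the_equality) fastforce+

lemma col_range: "x \<in> P \<Longrightarrow> 1 \<le> col x \<and> col x \<le> m"
  using S_range by (auto elim!: P_cases)

text \<open>
  Once \<open>a c\<close> lies in the lower cell of its column, linked columns inherit this position: the lower cells
  of adjacent two-element columns go weakly up, so the lower cell is the last one not below \<open>a c\<close>.  From
  the upper cell, \<open>a c\<close> drags \<open>a (c + 1)\<close> into the lower cell if that cell is not in a later row.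
\<close>

primrec flip :: "diagram \<Rightarrow> nat \<Rightarrow> bool" where
  "flip D 0 = False"
| "flip D (Suc c) = (link (Suc c) \<and> (flip D c \<or> lw D (Suc c) \<le> tp D c))"

lemma flip_link: "flip D c \<Longrightarrow> link c" by (cases c) auto
lemma flip_S: "flip D c \<Longrightarrow> c \<in> S" using flip_link by (auto simp: link_def)

definition row :: "diagram \<Rightarrow> 'a \<Rightarrow> nat" where
  "row D x = (if x \<in> a ` {1..m} \<longleftrightarrow> flip D (col x) then lw D (col x) else tp D (col x))"

lemma row_a: "1 \<le> c \<Longrightarrow> c \<le> m \<Longrightarrow> row D (a c) = (if flip D c then lw D c else tp D c)"
  by (auto simp: row_def)

lemma row_b: "c \<in> S \<Longrightarrow> row D (b c) = (if flip D c then tp D c else lw D c)"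
proof -
  assume c: "c \<in> S"
  then have "b c \<notin> a ` {1..m}" using disj[of _ c] by fastforce
  then show ?thesis using c by (simp add: row_def)
qed

lemma link_not_less: "link c \<Longrightarrow> \<not> a c \<prec> b c"
proof
  assume l: "link c" and h: "a c \<prec> b c"
  have "1 \<le> c - 1" "c - 1 < c" "c \<le> m" using l S_range[of c] by (auto simp: link_def)
  then have "a (c - 1) \<prec> b c" using a_mono[of "c - 1" c] h lt_trans by blast
  then show False using l by (simp add: link_def)
qed

definition phi :: "'a filling" where
  "phi x = (if x \<in> P then Some (if x \<in> a ` {1..m} then 1 else 2, col x) else None)"

lemma phi_a: "1 \<le> c \<Longrightarrow> c \<le> m \<Longrightarrow> phi (a c) = Some (1, c)"
  by (auto simp: phi_def aP)

lemma phi_b: "c \<in> S \<Longrightarrow> phi (b c) = Some (2, c)"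
proof -
  assume c: "c \<in> S"
  then have "b c \<notin> a ` {1..m}" using disj[of _ c] by fastforce
  then show ?thesis using c by (simp add: phi_def bP)
qed

lemma phi_eq: "phi x = Some (i, c) \<longleftrightarrow>
    (1 \<le> c \<and> c \<le> m \<and> i = 1 \<and> x = a c) \<or> (c \<in> S \<and> i = 2 \<and> x = b c)"
proof
  assume h: "phi x = Some (i, c)"
  then have "x \<in> P" by (auto simp: phi_def split: if_splits)
  then show "(1 \<le> c \<and> c \<le> m \<and> i = 1 \<and> x = a c) \<or> (c \<in> S \<and> i = 2 \<and> x = b c)"
  proof (cases rule: P_cases)
    case (a d) then show ?thesis using h phi_a[of d] by simp
  next
    case (b d) then show ?thesis using h phi_b[of d] by simp
  qed
next
  assume "(1 \<le> c \<and> c \<le> m \<and> i = 1 \<and> x = a c) \<or> (c \<in> S \<and> i = 2 \<and> x = b c)"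
  then show "phi x = Some (i, c)" using phi_a[of c] phi_b[of c] by auto
qed

end

locale filled = aligned P le m S a b for P :: "'a set" and le m S a b +
  fixes D :: diagram
  assumes good: "good m S D"
begin

lemma diagram: "is_diagram D" using good by (simp add: good_def)

lemma cells_range: "(i, c) \<in> D \<Longrightarrow> 1 \<le> i \<and> 1 \<le> c \<and> c \<le> m" using two_row_column[OF good] by blast

lemma no_triple:
  "\<lbrakk>(i1, c1) \<in> D; (i2, c2) \<in> D; (i3, c3) \<in> D; i1 < i2; i2 < i3; c1 \<le> c2; c2 \<le> c3\<rbrakk> \<Longrightarrow> False"
  using good unfolding good_def by blast

lemma column_double: "c \<in> S \<Longrightarrow> {i. (i, c) \<in> D} = {tp D c, lw D c} \<and> tp D c < lw D c"
proof -
  assume c: "c \<in> S"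
  then have "card {i. (i, c) \<in> D} = 2" using good by (simp add: good_def)
  then obtain x y where "{i. (i, c) \<in> D} = {x, y}" "x \<noteq> y" by (auto simp: card_2_iff)
  then show ?thesis unfolding tp_def lw_def by (auto simp: min_def max_def)
qed

lemma column_single: "\<lbrakk>1 \<le> c; c \<le> m; c \<notin> S\<rbrakk> \<Longrightarrow> {i. (i, c) \<in> D} = {tp D c} \<and> lw D c = tp D c"
proof -
  assume c: "1 \<le> c" "c \<le> m" "c \<notin> S"
  then have "card {i. (i, c) \<in> D} = 1" using good by (simp add: good_def)
  then obtain x where "{i. (i, c) \<in> D} = {x}" by (auto simp: card_1_singleton_iff)
  then show ?thesis unfolding tp_def lw_def by auto
qed

lemma cell_iff: "(i, c) \<in> D \<longleftrightarrow> 1 \<le> c \<and> c \<le> m \<and> (i = tp D c \<or> (c \<in> S \<and> i = lw D c))"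
proof (cases "1 \<le> c \<and> c \<le> m")
  case True
  have "(i, c) \<in> D \<longleftrightarrow> i \<in> {i. (i, c) \<in> D}" by simp
  also have "\<dots> \<longleftrightarrow> i = tp D c \<or> (c \<in> S \<and> i = lw D c)"
    using column_double[of c] column_single[of c] True by (cases "c \<in> S") auto
  finally show ?thesis using True by simp
next
  case False then show ?thesis using cells_range by blast
qed

lemma tp_less_lw: "c \<in> S \<Longrightarrow> tp D c < lw D c" using column_double by blast
lemma lw_single: "\<lbrakk>1 \<le> c; c \<le> m; c \<notin> S\<rbrakk> \<Longrightarrow> lw D c = tp D c" using column_single by blast
lemma tp_cell: "1 \<le> c \<Longrightarrow> c \<le> m \<Longrightarrow> (tp D c, c) \<in> D" by (simp add: cell_iff)
lemma lw_cell: "1 \<le> c \<Longrightarrow> c \<le> m \<Longrightarrow> (lw D c, c) \<in> D"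
  using lw_single by (cases "c \<in> S") (auto simp: cell_iff)

text \<open>Otherwise the cell \<open>(i, c)\<close> and the two cells of column \<open>c + 1\<close> would form a forbidden triple.\<close>

lemma tp_le: "\<lbrakk>1 \<le> c; (i, c) \<in> D; c + 1 \<in> S\<rbrakk> \<Longrightarrow> tp D (c + 1) \<le> i"
  using no_triple[of i c "tp D (c+1)" "c+1" "lw D (c+1)" "c+1"] tp_cell[of "c+1"] lw_cell[of "c+1"]
    tp_less_lw[of "c+1"] S_range[of "c+1"] by (force simp: not_le)

lemma le_lw: "\<lbrakk>c \<in> S; (i, c + 1) \<in> D\<rbrakk> \<Longrightarrow> i \<le> lw D c"
  using no_triple[of "tp D c" c "lw D c" c i "c+1"] tp_cell[of "c"] lw_cell[of "c"]
    tp_less_lw[of "c"] S_range[of "c"] by (force simp: not_le)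

lemma lw_decreasing: "c \<le> d \<Longrightarrow> (\<And>e. c \<le> e \<Longrightarrow> e \<le> d \<Longrightarrow> e \<in> S) \<Longrightarrow> lw D d \<le> lw D c"
proof (induction d rule: dec_induct)
  case (step d)
  have "lw D (Suc d) \<le> lw D d"
    using le_lw[of d "lw D (Suc d)"] lw_cell[of "Suc d"] step.prems[of d] step.prems[of "Suc d"]
      S_range[of "Suc d"] step.hyps by simp
  moreover have "lw D d \<le> lw D c" using step.IH step.prems by simp
  ultimately show ?case by simp
qed simp

abbreviation "\<rho> \<equiv> row D"

lemma row_cell: "x \<in> P \<Longrightarrow> (\<rho> x, col x) \<in> D"
proof (erule P_cases)
  fix c assume "1 \<le> c" "c \<le> m" "x = a c" then show ?thesis by (simp add: row_a tp_cell lw_cell)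
next
  fix c assume "c \<in> S" "x = b c"
  then show ?thesis using S_range[of c] by (simp add: row_b tp_cell lw_cell)
qed

lemma row_col_inj: "\<lbrakk>x \<in> P; y \<in> P; \<rho> x = \<rho> y; col x = col y\<rbrakk> \<Longrightarrow> x = y"
proof (erule P_cases; erule P_cases)
  fix c d assume "1 \<le> c" "c \<le> m" "x = a c" "d \<in> S" "y = b d" "\<rho> x = \<rho> y" "col x = col y"
  then show ?thesis using tp_less_lw[of c] by (auto simp: row_a row_b split: if_splits)
next
  fix c d assume "1 \<le> d" "d \<le> m" "y = a d" "c \<in> S" "x = b c" "\<rho> x = \<rho> y" "col x = col y"
  then show ?thesis using tp_less_lw[of c] by (auto simp: row_a row_b split: if_splits)
qed auto

lemma cell_element: "(i, c) \<in> D \<Longrightarrow> \<exists>x\<in>P. \<rho> x = i \<and> col x = c"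
proof -
  assume ic: "(i, c) \<in> D"
  then have c: "1 \<le> c" "c \<le> m" "i = tp D c \<or> c \<in> S \<and> i = lw D c" by (auto simp: cell_iff)
  show ?thesis
  proof (cases "c \<in> S")
    case True
    then show ?thesis using c aP[of c] bP[of c]
      by (cases "flip D c") (auto simp: row_a row_b intro: bexI[of _ "a c"] bexI[of _ "b c"])
  next
    case False
    then have "\<not> flip D c" using flip_S by blast
    then show ?thesis using c False aP[of c] by (auto simp: row_a intro!: bexI[of _ "a c"])
  qed
qed

text \<open>
  An entry \<open>a c\<close> can fail to be below a later entry only in the next column, and only if that column is
  linked; the rule for \<open>flip\<close> then keeps the two entries in different rows.  An entry \<open>b c\<close> that is not
  below some later \<open>a d\<close> starts a run of two-element columns reaching up to \<open>d\<close>.  It is not flipped,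
  hence in the lower cell of its column.  As the lower cells go weakly up along the run, \<open>a d\<close> could
  meet it in a row only if \<open>d\<close> were flipped, which \<open>no_link_after\<close> allows only for \<open>d = c + 1\<close>; but a
  flip there lifts \<open>a d\<close> strictly above the lower cell of column \<open>c\<close>.
\<close>

lemma row_increasing:
  assumes x: "x \<in> P" and y: "y \<in> P" and r: "\<rho> x = \<rho> y" and c: "col x < col y"
  shows "x \<prec> y"
  using x
proof (cases rule: P_cases)
  case xa: (a c)
  from y show ?thesis
  proof (cases rule: P_cases)
    case (a d) then show ?thesis using a_mono[of c d] c xa by simp
  next
    case yb: (b d)
    have cd: "c < d" using c xa yb by simp
    show ?thesis
    proof (rule ccontr)
      assume n: "\<not> x \<prec> y"
      then have d: "d = c + 1" "link d" using a_less_b[of c d] xa yb cd by auto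
      have dS: "c + 1 \<in> S" using d yb by simp
      have rc: "(if flip D c then lw D c else tp D c) = (if flip D d then tp D d else lw D d)"
        using r xa yb by (simp add: row_a row_b)
      show False
      proof (cases "flip D c")
        case True
        then have "c \<in> S" using flip_S by blast
        moreover have "flip D d" using True d by simp
        moreover have "lw D d \<le> lw D c" using le_lw[OF \<open>c \<in> S\<close>] lw_cell[of d] S_range[of d] dS d by simp
        ultimately show False using rc True tp_less_lw[of d] dS d by simp
      next
        case False
        then have "flip D d \<longleftrightarrow> lw D d \<le> tp D c" using d by simp
        then show False using rc False tp_less_lw[of d] dS d by (auto split: if_splits)
      qed
    qed
  qed
next
  case xb: (b c)
  from y show ?thesis
  proof (cases rule: P_cases)
    case (b d) then show ?thesis using b_mono[of c d] c xb by simp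
  next
    case ya: (a d)
    have cd: "c < d" using c xb ya by simp
    show ?thesis
    proof (rule ccontr)
      assume n: "\<not> x \<prec> y"
      then have nb: "\<not> b c \<prec> a d" using xb ya by simp
      note N = not_b_less_a[OF xb(1) less_imp_le[OF cd] ya(2) nb]
      have nf: "\<not> flip D c" using link_b_less[of c d] flip_link nb cd ya by blast
      have le: "lw D d \<le> lw D c" using lw_decreasing[of c d] N cd by simp
      have dS: "d \<in> S" using N[of d] cd by simp
      have rc: "lw D c = (if flip D d then lw D d else tp D d)"
        using r xb ya nf by (simp add: row_a row_b)
      have fd: "flip D d" using rc le tp_less_lw[OF dS] by (auto split: if_splits)
      then have "\<not> c + 2 \<le> d" using no_link_after[OF xb(1) _ ya(2) nb] flip_link by blast
      then have d: "d = Suc c" using cd by simp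
      then have "lw D d \<le> tp D c" using fd nf by simp
      then show False using rc fd tp_less_lw[OF xb(1)] by simp
    qed
  qed
qed

lemma row_chains_row: "row_chains \<rho>"
  unfolding row_chains_def
proof (intro conjI ballI impI)
  fix x assume "x \<in> P" then show "1 \<le> \<rho> x" using row_cell cells_range by blast
next
  fix x y assume xy: "x \<in> P" "y \<in> P" "\<rho> x = \<rho> y"
  then show "x = y \<or> x \<prec> y \<or> y \<prec> x"
    using row_increasing[of x y] row_increasing[of y x] row_col_inj[of x y]
    by (cases "col x" "col y" rule: linorder_cases) auto
qed

lemma le_iff_col: "\<lbrakk>x \<in> P; y \<in> P; \<rho> x = \<rho> y\<rbrakk> \<Longrightarrow> (y, x) \<in> le \<longleftrightarrow> col y \<le> col x"
  using row_increasing[of x y] row_increasing[of y x] row_col_inj[of x y] le_iff[of y x] lt_asym[of x y]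
  by (cases "col x" "col y" rule: linorder_cases) auto

lemma less_iff_col: "\<lbrakk>x \<in> P; y \<in> P; \<rho> x = \<rho> y\<rbrakk> \<Longrightarrow> x \<prec> y \<longleftrightarrow> col x < col y"
  using row_increasing[of x y] row_increasing[of y x] row_col_inj[of x y] lt_asym[of x y]
  by (cases "col x" "col y" rule: linorder_cases) auto

lemma bij_col: "bij_betw col {y \<in> P. \<rho> y = i \<and> col y \<le> c} {e. e \<le> c \<and> (i, e) \<in> D}"
proof (rule bij_betwI')
  show "\<And>x y. \<lbrakk>x \<in> {y \<in> P. \<rho> y = i \<and> col y \<le> c}; y \<in> {y \<in> P. \<rho> y = i \<and> col y \<le> c}\<rbrakk>
      \<Longrightarrow> (col x = col y) = (x = y)"
    using row_col_inj by auto
  show "\<And>x. x \<in> {y \<in> P. \<rho> y = i \<and> col y \<le> c} \<Longrightarrow> col x \<in> {e. e \<le> c \<and> (i, e) \<in> D}"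
    using row_cell by auto
  show "\<And>e. e \<in> {e. e \<le> c \<and> (i, e) \<in> D} \<Longrightarrow> \<exists>x\<in>{y \<in> P. \<rho> y = i \<and> col y \<le> c}. e = col x"
    using cell_element by fastforce
qed

lemma card_row_prefix: "card {y \<in> P. \<rho> y = i \<and> col y \<le> c} = cnt D i c"
  unfolding cnt_def by (rule bij_betw_same_card[OF bij_col])

text \<open>Rows increase from left to right, so the position of an element in its row of the array is the number
  of cells of the row up to its column.\<close>

lemma rank_eq_cnt: "x \<in> P \<Longrightarrow> rank \<rho> x = cnt D (\<rho> x) (col x)"
proof -
  assume x: "x \<in> P"
  have "{y \<in> P. \<rho> y = \<rho> x \<and> (y, x) \<in> le} = {y \<in> P. \<rho> y = \<rho> x \<and> col y \<le> col x}"
    using le_iff_col[OF x] by auto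
  then show ?thesis unfolding rank_def by (simp add: card_row_prefix)
qed

lemma card_row: "card {x \<in> P. \<rho> x = i} = wt_diagram D i"
proof -
  have "{x \<in> P. \<rho> x = i} = {x \<in> P. \<rho> x = i \<and> col x \<le> m}" using col_range by auto
  moreover have "{c. (i, c) \<in> D} = {e. e \<le> m \<and> (i, e) \<in> D}" using cells_range by auto
  ultimately show ?thesis using card_row_prefix[of i m] by (simp add: wt_diagram_def cnt_def)
qed

definition fill :: "nat \<Rightarrow> 'a filling" where
  "fill c x = (if x \<in> P \<and> col x \<le> c then Some (\<rho> x, col x) else None)"

lemma fill_eq: "fill c x = Some (i, e) \<longleftrightarrow> x \<in> P \<and> e \<le> c \<and> \<rho> x = i \<and> col x = e"
  by (auto simp: fill_def)

lemma fill_Suc: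
  assumes c: "Suc c \<le> m"
  shows "fill (Suc c) = (if Suc c \<in> S
     then (fill c)(a (Suc c) \<mapsto> (\<rho> (a (Suc c)), Suc c), b (Suc c) \<mapsto> (\<rho> (b (Suc c)), Suc c))
     else (fill c)(a (Suc c) \<mapsto> (\<rho> (a (Suc c)), Suc c)))"
proof
  fix x
  show "fill (Suc c) x = (if Suc c \<in> S
     then (fill c)(a (Suc c) \<mapsto> (\<rho> (a (Suc c)), Suc c), b (Suc c) \<mapsto> (\<rho> (b (Suc c)), Suc c))
     else (fill c)(a (Suc c) \<mapsto> (\<rho> (a (Suc c)), Suc c))) x"
  proof (cases "x \<in> P")
    case True
    then show ?thesis
    proof (cases rule: P_cases)
      case (a d)
      then show ?thesis using c disj[of d "Suc c"] aP[of d] a_inj[of d "Suc c"]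
        by (cases "d = Suc c") (auto simp: fill_def)
    next
      case (b d)
      then show ?thesis using c disj[of "Suc c" d] bP[of d] b_inj[of d "Suc c"]
        by (cases "d = Suc c") (auto simp: fill_def)
    qed
  next
    case False then show ?thesis using aP[of "Suc c"] bP[of "Suc c"] c by (auto simp: fill_def)
  qed
qed

lemma place_pair_low:
  assumes "c \<in> S" "lw D c \<le> r" shows "place_pair D c r u v L = L(u \<mapsto> (lw D c, c), v \<mapsto> (tp D c, c))"
proof -
  have "{s. s \<le> r \<and> (s, c) \<in> D} = {tp D c, lw D c}"
    using assms tp_less_lw[of c] S_range[of c] by (auto simp: cell_iff)
  then have "Max {s. s \<le> r \<and> (s, c) \<in> D} = lw D c" using tp_less_lw[OF assms(1)] by simp
  moreover have "(THE s'. (s', c) \<in> D \<and> s' \<noteq> lw D c) = tp D c"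
    by (rule the_equality) (use assms tp_less_lw[of c] S_range[of c] in \<open>auto simp: cell_iff\<close>)
  ultimately show ?thesis unfolding place_pair_def by simp
qed

lemma place_pair_top:
  assumes "c \<in> S" "tp D c \<le> r" "r < lw D c"
  shows "place_pair D c r u v L = L(u \<mapsto> (tp D c, c), v \<mapsto> (lw D c, c))"
proof -
  have "{s. s \<le> r \<and> (s, c) \<in> D} = {tp D c}"
    using assms tp_less_lw[of c] S_range[of c] by (auto simp: cell_iff)
  then have "Max {s. s \<le> r \<and> (s, c) \<in> D} = tp D c" by simp
  moreover have "(THE s'. (s', c) \<in> D \<and> s' \<noteq> tp D c) = lw D c"
    by (rule the_equality) (use assms tp_less_lw[of c] S_range[of c] in \<open>auto simp: cell_iff\<close>)
  ultimately show ?thesis unfolding place_pair_def by simp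
qed

text \<open>
  If column \<open>c + 1\<close> is linked, its entry in the alignment's first row is singled out by \<open>a c\<close>, from the
  upper cell by the first rule, or from the lower cell by the second one; in the latter case the first
  rule does not interfere, because column \<open>c\<close> is then linked as well, so that \<open>b c\<close> is below both entries.  If column \<open>c + 1\<close> is
  not linked, then \<open>a c\<close> is below both of its entries.  Either \<open>b c\<close> is so too and the third rule
  applies, or \<open>b c\<close>, which then lies in the lower cell, singles out \<open>b (c + 1)\<close>, with the same outcome.
\<close>

lemma fill_column_fill:
  assumes c: "Suc c \<le> m" shows "fill_column le phi D (Suc c) (fill c) = fill (Suc c)"
proof (cases "Suc c \<in> S")
  case False
  have ph: "(\<exists>i. phi x = Some (i, Suc c)) \<longleftrightarrow> x = a (Suc c)" for x
    unfolding phi_eq using False c by auto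
  have ex: "\<exists>!x. \<exists>i. phi x = Some (i, Suc c)" unfolding ph by blast
  have the: "(THE x. \<exists>i. phi x = Some (i, Suc c)) = a (Suc c)" unfolding ph by simp
  have cell: "(s, Suc c) \<in> D \<longleftrightarrow> s = tp D (Suc c)" for s using False c by (auto simp: cell_iff)
  have "\<not> flip D (Suc c)" using False flip_S by blast
  then have ra: "\<rho> (a (Suc c)) = tp D (Suc c)" using c by (simp add: row_a del: flip.simps)
  have "fill_column le phi D (Suc c) (fill c) =
      (fill c)((THE x. \<exists>i. phi x = Some (i, Suc c)) \<mapsto> ((THE s. (s, Suc c) \<in> D), Suc c))"
    unfolding fill_column_def using ex by (rule if_P)
  also have "\<dots> = fill (Suc c)" unfolding the cell fill_Suc[OF c] using False ra by simp
  finally show ?thesis .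
next
  case True
  let ?C = "Suc c" let ?L = "fill c"
  have C: "1 \<le> ?C" using c by simp
  have ab: "a ?C \<noteq> b ?C" using disj[of ?C ?C] True c by simp
  have phs: "phi (a ?C) = Some (1, ?C)" "phi (b ?C) = Some (2, ?C)" using phi_eq True c by auto
  then have nu: "\<not> (\<exists>!x. \<exists>i. phi x = Some (i, ?C))" using ab by metis
  have ex: "\<exists>x1 x2. phi x1 = Some (1, ?C) \<and> phi x2 = Some (2, ?C)" using phs by blast
  have the1: "(THE x. phi x = Some (1, ?C)) = a ?C" by (rule the_equality) (use phs in \<open>auto simp: phi_eq\<close>)
  have the2: "(THE x. phi x = Some (2, ?C)) = b ?C" by (rule the_equality) (use phs in \<open>auto simp: phi_eq\<close>)
  define top where "top = Min {s. (s, c) \<in> D}"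
  define low where "low = Max {s. (s, c) \<in> D}"
  have fc: "fill_column le phi D ?C ?L =
      (if singles_out le ?L (top, c) (a ?C) (b ?C) then place_pair D ?C top (a ?C) (b ?C) ?L
       else if singles_out le ?L (top, c) (b ?C) (a ?C) then place_pair D ?C top (b ?C) (a ?C) ?L
       else if singles_out le ?L (low, c) (a ?C) (b ?C) then place_pair D ?C low (a ?C) (b ?C) ?L
       else if singles_out le ?L (low, c) (b ?C) (a ?C) then place_pair D ?C low (b ?C) (a ?C) ?L
       else ?L(a ?C \<mapsto> (tp D ?C, ?C), b ?C \<mapsto> (lw D ?C, ?C)))"
    unfolding fill_column_def using nu ex the1 the2 by (simp add: Let_def top_def low_def tp_def lw_def)
  have fs: "fill ?C = ?L(a ?C \<mapsto> (\<rho> (a ?C), ?C), b ?C \<mapsto> (\<rho> (b ?C), ?C))" using fill_Suc[OF c] True by simp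
  have unfl: "fill ?C = ?L(a ?C \<mapsto> (tp D ?C, ?C), b ?C \<mapsto> (lw D ?C, ?C))" if "\<not> flip D ?C"
    unfolding fs using that c True C by (simp add: row_a row_b del: flip.simps)
  have unfl': "fill ?C = ?L(b ?C \<mapsto> (lw D ?C, ?C), a ?C \<mapsto> (tp D ?C, ?C))" if "\<not> flip D ?C"
    unfolding unfl[OF that] using ab by (rule fun_upd_twist)
  have fl: "fill ?C = ?L(a ?C \<mapsto> (lw D ?C, ?C), b ?C \<mapsto> (tp D ?C, ?C))" if "flip D ?C"
    unfolding fs using that c True C by (simp add: row_a row_b del: flip.simps)
  show ?thesis
  proof (cases "c = 0")
    case c0: True
    have "\<not> singles_out le ?L (i, c) u v" for i u v
      unfolding singles_out_def fill_eq using c0 col_range by fastforce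
    moreover have "\<not> flip D ?C" using c0 by (simp add: link_def)
    ultimately show ?thesis using fc unfl by simp
  next
    case False
    then have c1: "1 \<le> c" "c \<le> m" using c by auto
    have top: "top = tp D c" and low: "low = lw D c" by (simp_all add: top_def low_def tp_def lw_def)
    have so: "singles_out le ?L (\<rho> y, c) u v \<longleftrightarrow> y \<prec> u \<and> \<not> y \<prec> v" if y: "y \<in> P" "col y = c" for y u v
    proof -
      have "z = y" if "z \<in> P" "\<rho> z = \<rho> y" "col z = c" for z
        using row_col_inj[of z y] that y by simp
      then show ?thesis unfolding singles_out_def fill_eq using y by auto
    qed
    have aa: "a c \<prec> a ?C" using a_mono[of c ?C] c1 c by simp
    have bb: "b c \<prec> b ?C" if "c \<in> S" using b_mono[of c ?C] that True by simp
    have soa: "singles_out le ?L (\<rho> (a c), c) u v \<longleftrightarrow> a c \<prec> u \<and> \<not> a c \<prec> v" for u v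
      using so[of "a c"] aP c1 by simp
    have sob: "singles_out le ?L (\<rho> (b c), c) u v \<longleftrightarrow> b c \<prec> u \<and> \<not> b c \<prec> v" if "c \<in> S" for u v
      using so[of "b c"] bP that by simp
    have ltC: "tp D ?C \<le> tp D c" using tp_le[of c "tp D c"] tp_cell[of c] c1 True by simp
    have lwC: "lw D ?C \<le> lw D c" if "c \<in> S"
      using le_lw[OF that, of "lw D ?C"] lw_cell[of ?C] c by simp
    have lk: "link ?C \<longleftrightarrow> \<not> a c \<prec> b ?C" using True c1 by (simp add: link_def)
    show ?thesis
    proof (cases "link ?C")
      case l: True
      then have nab: "\<not> a c \<prec> b ?C" using lk by simp
      show ?thesis
      proof (cases "flip D c")
        case f: True
        then have cS: "c \<in> S" using flip_S by blast
        have ba: "b c \<prec> a ?C" using link_b_less[OF flip_link[OF f], of ?C] c by simp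
        have rt: "\<rho> (b c) = tp D c" "\<rho> (a c) = lw D c" using f cS c1 by (simp_all add: row_a row_b)
        have "fill_column le phi D ?C ?L = place_pair D ?C low (a ?C) (b ?C) ?L"
          unfolding fc top low using soa[unfolded rt] sob[OF cS, unfolded rt] ba bb[OF cS] aa nab by simp
        also have "\<dots> = fill ?C" using place_pair_low[OF True, of low] lwC[OF cS] fl l f low by simp
        finally show ?thesis .
      next
        case f: False
        then have rt: "\<rho> (a c) = tp D c" using c1 by (simp add: row_a)
        have "fill_column le phi D ?C ?L = place_pair D ?C top (a ?C) (b ?C) ?L"
          unfolding fc top low using soa[unfolded rt] aa nab by simp
        also have "\<dots> = fill ?C"
        proof (cases "lw D ?C \<le> tp D c")
          case t: True
          then show ?thesis using place_pair_low[OF True, of top] fl l top by simp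
        next
          case t: False
          then show ?thesis using place_pair_top[OF True, of top] ltC unfl f top by simp
        qed
        finally show ?thesis .
      qed
    next
      case l: False
      then have ab': "a c \<prec> b ?C" using lk by simp
      have nf: "\<not> flip D ?C" using l by simp
      show ?thesis
      proof (cases "c \<in> S")
        case cS: False
        then have "\<not> flip D c" using flip_S by blast
        then have rt: "\<rho> (a c) = tp D c" "lw D c = tp D c" using c1 cS lw_single by (simp_all add: row_a)
        show ?thesis unfolding fc top low rt(2) using soa[unfolded rt(1)] aa ab' unfl[OF nf] by simp
      next
        case cS: True
        show ?thesis
        proof (cases "b c \<prec> a ?C")
          case t: True
          have n: "\<not> singles_out le ?L (\<rho> (a c), c) (a ?C) (b ?C)" "\<not> singles_out le ?L (\<rho> (a c), c) (b ?C) (a ?C)"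
            "\<not> singles_out le ?L (\<rho> (b c), c) (a ?C) (b ?C)" "\<not> singles_out le ?L (\<rho> (b c), c) (b ?C) (a ?C)"
            using soa sob[OF cS] aa ab' t bb[OF cS] by auto
          have "\<rho> (a c) = tp D c \<and> \<rho> (b c) = lw D c \<or> \<rho> (a c) = lw D c \<and> \<rho> (b c) = tp D c"
            using c1 cS by (auto simp: row_a row_b)
          then show ?thesis unfolding fc top low using n unfl[OF nf] by auto
        next
          case t: False
          have "\<not> flip D c" using t link_b_less[of c ?C] flip_link c by auto
          then have rt: "\<rho> (a c) = tp D c" "\<rho> (b c) = lw D c" using c1 cS by (simp_all add: row_a row_b)
          have "fill_column le phi D ?C ?L = place_pair D ?C low (b ?C) (a ?C) ?L"
            unfolding fc top low using soa[unfolded rt] sob[OF cS, unfolded rt] aa ab' t bb[OF cS] by simp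
          also have "\<dots> = fill ?C" using place_pair_low[OF True, of low] lwC[OF cS] unfl'[OF nf] low by simp
          finally show ?thesis .
        qed
      qed
    qed
  qed
qed

lemma fill_columns_fill: "c \<le> m \<Longrightarrow> fill_columns le phi D c = fill c"
proof (induction c)
  case 0
  have "fill 0 x = None" for x using col_range[of x] by (auto simp: fill_def)
  then show ?case by (simp add: fun_eq_iff)
next
  case (Suc c) then show ?case using fill_column_fill by simp
qed

lemma diagram_filling_eq:
  assumes "alignment le T 1 = phi" shows "diagram_filling le T D = fill m"
proof -
  have "snd ` D = {1..m}"
  proof (intro equalityI subsetI)
    fix c assume "c \<in> snd ` D"
    then obtain i where "(i, c) \<in> D" by force
    from cells_range[OF this] show "c \<in> {1..m}" by simp
  next
    fix c assume "c \<in> {1..m}"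
    then have "(tp D c, c) \<in> D" using tp_cell[of c] by simp
    then show "c \<in> snd ` D" by (rule rev_image_eqI) simp
  qed
  moreover have "Max (insert 0 {1..m}) = m" by (rule Max_eqI) (cases m; auto)+
  ultimately show ?thesis unfolding diagram_filling_def assms using fill_columns_fill[of m] by simp
qed

lemma ran_fill: "ran (fill m) = D"
proof (intro equalityI subrelI)
  fix i c assume "(i, c) \<in> ran (fill m)"
  then obtain x where "fill m x = Some (i, c)" by (auto simp: ran_def)
  then have "x \<in> P" "\<rho> x = i" "col x = c" using fill_eq by auto
  then show "(i, c) \<in> D" using row_cell[of x] by simp
next
  fix i c assume ic: "(i, c) \<in> D"
  obtain x where "x \<in> P" "\<rho> x = i" "col x = c" using cell_element[OF ic] by blast
  then have "fill m x = Some (i, c)" using fill_eq cells_range[OF ic] by simp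
  then show "(i, c) \<in> ran (fill m)" by (rule ranI)
qed

lemma array_of_fill: "array_of_filling (fill m) = arr \<rho>"
proof -
  have "(\<lambda>x. \<exists>c. fill m x = Some (i, c) \<and> card {c'. (i, c') \<in> ran (fill m) \<and> c' \<le> c} = j)
      = (\<lambda>x. x \<in> P \<and> \<rho> x = i \<and> card {y \<in> P. \<rho> y = i \<and> (y, x) \<in> le} = j)" for i j
  proof
    fix x
    have "card {c'. (i, c') \<in> D \<and> c' \<le> c} = cnt D i c" for c
      unfolding cnt_def by (rule arg_cong[of _ _ card]) auto
    moreover have "card {y \<in> P. \<rho> y = i \<and> (y, x) \<in> le} = cnt D i (col x)" if "x \<in> P" "\<rho> x = i"
      using rank_eq_cnt[OF that(1)] that(2) by (simp add: rank_def)
    ultimately show "(\<exists>c. fill m x = Some (i, c) \<and> card {c'. (i, c') \<in> ran (fill m) \<and> c' \<le> c} = j)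
        = (x \<in> P \<and> \<rho> x = i \<and> card {y \<in> P. \<rho> y = i \<and> (y, x) \<in> le} = j)"
      unfolding ran_fill fill_eq using col_range[of x] by auto
  qed
  then show ?thesis unfolding array_of_filling_def array_of_rows_def by simp
qed

lemma array_eq:
  assumes "alignment le T 1 = phi" shows "array_of_filling (diagram_filling le T D) = arr \<rho>"
  using diagram_filling_eq[OF assms] array_of_fill by simp

end

section \<open>Edges of the array crystal\<close>

context finite_poset begin

text \<open>This is the excess of a diagram as far as its array shows it: the entries of row 1 weakly left of an
  entry \<open>y\<close> of row 2 are not above \<open>y\<close>, and usually those to the right of \<open>y\<close> are.\<close>

definition Gamma :: "('a \<Rightarrow> nat) \<Rightarrow> 'a \<Rightarrow> int" where
  "Gamma \<rho> y = int (rank \<rho> y) - int (card {x \<in> P. \<rho> x = 1 \<and> \<not> y \<prec> x})"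

text \<open>
  How the row function \<open>\<rho>'\<close> of an array is recovered from the row function \<open>\<rho>\<close> of its image under \<open>f\<^sub>1\<close>.
  The operator has exchanged \<open>X 0, \<dots>, X t\<close> and \<open>Y 1, \<dots>, Y t\<close>, which are consecutive in rows 2 and 1 of
  the image.  The last of the \<open>X i\<close> is the first maximum of \<open>Gamma\<close>, at rank \<open>q\<close>, and \<open>u\<close> is the rank
  of the last of the \<open>Y i\<close>.
\<close>

definition shifted_by ::
  "('a \<Rightarrow> nat) \<Rightarrow> ('a \<Rightarrow> nat) \<Rightarrow> nat \<Rightarrow> nat \<Rightarrow> nat \<Rightarrow> (nat \<Rightarrow> 'a) \<Rightarrow> (nat \<Rightarrow> 'a) \<Rightarrow> bool" where
  "shifted_by \<rho> \<rho>' q u t X Y \<longleftrightarrow>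
     (\<forall>i\<le>t. X i \<in> P \<and> \<rho> (X i) = 2 \<and> rank \<rho> (X i) + t = q + i) \<and>
     (\<forall>i. 1 \<le> i \<and> i \<le> t \<longrightarrow> Y i \<in> P \<and> \<rho> (Y i) = 1 \<and> rank \<rho> (Y i) + t = u + i \<and> \<not> Y i \<prec> X i) \<and>
     (\<forall>z\<in>P. \<rho>' z = (if z \<in> X ` {0..t} then 1 else if z \<in> Y ` {1..t} then 2 else \<rho> z)) \<and>
     (\<forall>z\<in>P. \<rho> z = 1 \<and> rank \<rho> z + t \<le> u \<longrightarrow> z \<prec> X 0) \<and>
     (\<forall>y\<in>P. \<rho> y = 2 \<longrightarrow> Gamma \<rho> y \<le> Gamma \<rho> (X t) \<and> (rank \<rho> y < q \<longrightarrow> Gamma \<rho> y < Gamma \<rho> (X t))) \<and>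
     card {x \<in> P. \<rho> x = 1 \<and> \<not> X t \<prec> x} = u"

lemma shifted_byD:
  assumes "shifted_by \<rho> \<rho>' q u t X Y"
  shows "\<And>i. i \<le> t \<Longrightarrow> X i \<in> P \<and> \<rho> (X i) = 2 \<and> rank \<rho> (X i) + t = q + i"
    and "\<And>i. 1 \<le> i \<Longrightarrow> i \<le> t \<Longrightarrow> Y i \<in> P \<and> \<rho> (Y i) = 1 \<and> rank \<rho> (Y i) + t = u + i \<and> \<not> Y i \<prec> X i"
    and "\<And>z. z \<in> P \<Longrightarrow> \<rho>' z = (if z \<in> X ` {0..t} then 1 else if z \<in> Y ` {1..t} then 2 else \<rho> z)"
    and "\<And>z. z \<in> P \<Longrightarrow> \<rho> z = 1 \<Longrightarrow> rank \<rho> z + t \<le> u \<Longrightarrow> z \<prec> X 0"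
    and "\<And>y. y \<in> P \<Longrightarrow> \<rho> y = 2 \<Longrightarrow>
      Gamma \<rho> y \<le> Gamma \<rho> (X t) \<and> (rank \<rho> y < q \<longrightarrow> Gamma \<rho> y < Gamma \<rho> (X t))"
    and "card {x \<in> P. \<rho> x = 1 \<and> \<not> X t \<prec> x} = u"
  using assms unfolding shifted_by_def by blast+

text \<open>
  The end \<open>X t\<close> of the run is the first maximum of \<open>Gamma\<close>, and \<open>u\<close> is determined by it.  If two
  descriptions had different lengths, the first element \<open>X 0\<close> of the shorter run would be one of the
  later elements of the longer one, where the entry of row 1 of the same index is not below it; but
  before the shorter run all entries of row 1 are below \<open>X 0\<close>.
\<close>

lemma shifted_by_unique:
  assumes rc: "row_chains \<rho>" and s1: "shifted_by \<rho> \<rho>1 q u t X Y" and s2: "shifted_by \<rho> \<rho>2 q' u' t' X' Y'"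
    and z: "z \<in> P"
  shows "\<rho>1 z = \<rho>2 z"
proof -
  note X = shifted_byD(1)[OF s1] and Y = shifted_byD(2)[OF s1] and Z = shifted_byD(3)[OF s1 z]
    and L = shifted_byD(4)[OF s1] and G = shifted_byD(5)[OF s1] and U = shifted_byD(6)[OF s1]
  note X' = shifted_byD(1)[OF s2] and Y' = shifted_byD(2)[OF s2] and Z' = shifted_byD(3)[OF s2 z]
    and L' = shifted_byD(4)[OF s2] and G' = shifted_byD(5)[OF s2] and U' = shifted_byD(6)[OF s2]
    have Xt: "X t \<in> P" "\<rho> (X t) = 2" "rank \<rho> (X t) = q" using X[of t] by auto
    have Xt': "X' t' \<in> P" "\<rho> (X' t') = 2" "rank \<rho> (X' t') = q'" using X'[of t'] by auto
    have qq: "q = q'"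
      using G[OF Xt'(1,2)] G'[OF Xt(1,2)] Xt(3) Xt'(3) by (cases q q' rule: linorder_cases) auto
    have "X t = X' t'" by (rule rank_inj[OF rc]) (use Xt Xt' qq in auto)
    then have uu: "u = u'" using U U' by simp
    have eqX: "X i = X' j" if "i \<le> t" "j \<le> t'" "i + t' = j + t" for i j
      by (rule rank_inj[OF rc]) (use X[OF that(1)] X'[OF that(2)] that(3) qq in auto)
    have eqY: "Y i = Y' j" if "1 \<le> i" "1 \<le> j" "i \<le> t" "j \<le> t'" "i + t' = j + t" for i j
      by (rule rank_inj[OF rc]) (use Y[OF that(1,3)] Y'[OF that(2,4)] that(5) uu in auto)
    have "\<not> t < t'"
    proof
      assume lt: "t < t'"
      define s where "s = t' - t"
      have s: "1 \<le> s" "s \<le> t'" "s + t = t'" using lt by (auto simp: s_def)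
      have "X 0 = X' s" using eqX[of 0 s] s by simp
      moreover have "Y' s \<prec> X 0" using L[of "Y' s"] Y'[of s] s uu by simp
      ultimately show False using Y'[of s] s by simp
    qed
    moreover have "\<not> t' < t"
    proof
      assume lt: "t' < t"
      define s where "s = t - t'"
      have s: "1 \<le> s" "s \<le> t" "s + t' = t" using lt by (auto simp: s_def)
      have "X' 0 = X s" using eqX[of s 0] s by simp
      moreover have "Y s \<prec> X' 0" using L'[of "Y s"] Y[of s] s uu by simp
      ultimately show False using Y[of s] s by simp
    qed
    ultimately have tt: "t = t'" by simp
    have "X ` {0..t} = X' ` {0..t'}" using eqX tt by (intro image_cong) auto
    moreover have "Y ` {1..t} = Y' ` {1..t'}" using eqY tt by (intro image_cong) auto
    ultimately show ?thesis using Z Z' tt by simp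
qed

end

context filled begin

text \<open>An entry \<open>b e\<close> in row 1 is flipped, because row 1 contains no lower cell of a two-element column, and
  flipped entries are below everything to their right.\<close>

lemma upper_not_above:
  assumes x: "x \<in> P" "\<rho> x = 1" and y: "y \<in> P" "\<rho> y = 2" and c: "col x \<le> col y"
  shows "\<not> y \<prec> x"
  using x(1)
proof (cases rule: P_cases)
  case xa: (a e)
  from y(1) show ?thesis
  proof (cases rule: P_cases)
    case (a d)
    then show ?thesis using a_mono[of e d] lt_asym[of "a e" "a d"] c xa by (cases "e = d") auto
  next
    case yb: (b d)
    have "e \<le> d" using c xa yb by simp
    then have "a e = a d \<or> a e \<prec> a d" using a_mono[of e d] xa S_range[OF yb(1)] by (cases "e = d") auto
    then show ?thesis using same_column[OF yb(1)] lt_trans[of "b d" "a e" "a d"] xa yb by auto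
  qed
next
  case xb: (b e)
  have "tp D e < lw D e" "1 \<le> tp D e" using tp_less_lw xb cells_range[OF tp_cell[of e]] S_range[of e] by auto
  then have "flip D e" using x xb by (auto simp: row_b split: if_splits)
  then have l: "link e" by (rule flip_link)
  from y(1) show ?thesis
  proof (cases rule: P_cases)
    case ya: (a d)
    have "e \<le> d" using c xb ya by simp
    then consider "e = d" | "e < d" by linarith
    then show ?thesis
    proof cases
      case 1 then show ?thesis using link_not_less[OF l] xb ya by simp
    next
      case 2
      then have "b e \<prec> a d" using link_b_less[OF l] ya by simp
      then show ?thesis using lt_asym xb ya by blast
    qed
  next
    case (b d)
    then show ?thesis using b_mono[of e d] lt_asym[of "b e" "b d"] c xb by (cases "e = d") auto
  qed
qed

lemma Gamma_le_excess:
  assumes y: "y \<in> P" "\<rho> y = 2" shows "Gamma \<rho> y \<le> excess D 1 (col y)"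
proof -
  have "{x \<in> P. \<rho> x = 1 \<and> col x \<le> col y} \<subseteq> {x \<in> P. \<rho> x = 1 \<and> \<not> y \<prec> x}"
    using upper_not_above y by blast
  then have "cnt D 1 (col y) \<le> card {x \<in> P. \<rho> x = 1 \<and> \<not> y \<prec> x}"
    unfolding card_row_prefix[symmetric] using finP by (intro card_mono) auto
  then show ?thesis using rank_eq_cnt[OF y(1)] y(2) by (simp add: Gamma_def excess_def numeral_2_eq_2)
qed

lemma arr_row_eq_Some: "arr \<rho> (i, k) = Some x \<longleftrightarrow> x \<in> P \<and> \<rho> x = i \<and> cnt D i (col x) = k"
  using arr_eq_Some[OF row_chains_row] rank_eq_cnt by metis

lemma inj_arr: "inj_on (arr \<rho>) (dom (arr \<rho>))" and ran_arr: "ran (arr \<rho>) = P"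
  using arr_in_P_arrays[OF row_chains_row] by (auto simp: P_arrays_def)

text \<open>Positions in the array are thereby translated into columns of the diagram.\<close>

lemma row_listing:
  obtains \<alpha> where "\<And>k. arr \<rho> (i, k) = (if 1 \<le> k \<and> k \<le> cnt D i m then Some (\<alpha> k) else None)"
    and "\<And>k l. 1 \<le> k \<Longrightarrow> k < l \<Longrightarrow> l \<le> cnt D i m \<Longrightarrow> \<alpha> k \<prec> \<alpha> l"
    and "\<And>k. 1 \<le> k \<Longrightarrow> k \<le> cnt D i m \<Longrightarrow> \<alpha> k \<in> P \<and> \<rho> (\<alpha> k) = i \<and> cnt D i (col (\<alpha> k)) = k"
    and "\<And>x. x \<in> P \<Longrightarrow> \<rho> x = i \<Longrightarrow> \<alpha> (cnt D i (col x)) = x"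
proof -
  obtain \<alpha> M where e: "\<And>k. arr \<rho> (i, k) = (if 1 \<le> k \<and> k \<le> M then Some (\<alpha> k) else None)"
    and mono: "\<And>k l. 1 \<le> k \<Longrightarrow> k < l \<Longrightarrow> l \<le> M \<Longrightarrow> \<alpha> k \<prec> \<alpha> l"
    by (rule row_enumeration[OF arr_in_P_arrays[OF row_chains_row], of i]) (rule that; assumption)
  have "{x \<in> P. \<rho> x = i} = {x \<in> P. \<rho> x = i \<and> col x \<le> m}" using col_range by auto
  then have card: "card {x \<in> P. \<rho> x = i} = cnt D i m" using card_row_prefix[of i m] by simp
  have iff: "k \<le> M \<longleftrightarrow> k \<le> cnt D i m" if "1 \<le> k" for k
    using arr_defined_iff[OF row_chains_row, of i k] e[of k] that unfolding card by (auto split: if_splits)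
  have "M \<le> cnt D i m" using iff[of M] by (cases M) auto
  moreover have "cnt D i m \<le> M" using iff[of "cnt D i m"] by (cases "cnt D i m") auto
  ultimately have MM: "M = cnt D i m" by simp
  have some: "\<alpha> k \<in> P \<and> \<rho> (\<alpha> k) = i \<and> cnt D i (col (\<alpha> k)) = k" if "1 \<le> k" "k \<le> M" for k
    using e[of k] that arr_row_eq_Some[of i k "\<alpha> k"] by simp
  have inv: "\<alpha> (cnt D i (col x)) = x" if "x \<in> P" "\<rho> x = i" for x
    using e[of "cnt D i (col x)"] arr_row_eq_Some[of i "cnt D i (col x)" x] that by (auto split: if_splits)
  show thesis by (rule that[OF e[unfolded MM] mono[unfolded MM] some[unfolded MM] inv])
qed

lemma cnt_less:
  assumes "(i, d) \<in> D" "c < d" shows "cnt D i c < cnt D i d"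
proof -
  have "cnt D i c \<le> cnt D i (d - 1)" using assms(2) by (intro cnt_mono) simp
  also have "\<dots> < cnt D i d" using cnt_pred[of d D i] assms by simp
  finally show ?thesis .
qed

end

lemma replace_in_pair:
  fixes t l t' l' r :: nat
  assumes "t < l" "t' < l'" "{t', l'} = insert (Suc r) ({t, l} - {r})" "r = t \<or> r = l" "Suc r \<noteq> t" "Suc r \<noteq> l"
  shows "t' = (if t = r then Suc r else t) \<and> l' = (if l = r then Suc r else l)"
proof -
  from assms(4) have "t' = Suc r \<and> l' = l \<and> r = t \<or> t' = t \<and> l' = Suc r \<and> r = l"
  proof
    assume h: "r = t"
    have "{t, l} - {r} = {l}" using h assms(1) by auto
    then have "{t', l'} = {Suc r, l}" using assms(3) by simp
    then have "t' = Suc r \<and> l' = l \<or> t' = l \<and> l' = Suc r" unfolding doubleton_eq_iff by blast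
    then show ?thesis using h assms(1,2,6) by linarith
  next
    assume h: "r = l"
    have "{t, l} - {r} = {t}" using h assms(1) by auto
    then have "{t', l'} = {Suc r, t}" using assms(3) by simp
    then have "t' = Suc r \<and> l' = t \<or> t' = t \<and> l' = Suc r" unfolding doubleton_eq_iff by blast
    then show ?thesis using h assms(1,2,5) by linarith
  qed
  then show ?thesis using assms(1) by auto
qed

text \<open>The diagram \<open>D\<close> is \<open>e\<^sub>r\<close> of \<open>E\<close>.  The order of the cells of column \<open>c\<close> is not affected, because this
  column has no other cell in rows \<open>r\<close> and \<open>r + 1\<close>.\<close>

locale raised = aligned P le m S a b + E: filled P le m S a b E
  for P :: "'a set" and le m S a b and E :: diagram +
  fixes r c :: nat
  assumes r: "1 \<le> r" and copivot: "copivot E r c"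
begin

definition D where "D = move (Suc r) r c E"

lemma good_D: "good m S D" unfolding D_def by (rule good_move_up[OF E.good copivot r])

sublocale D: filled P le m S a b D by unfold_locales (rule good_D)

lemma cells_c: "(Suc r, c) \<in> E" "(r, c) \<notin> E" "(r, c) \<in> D" "(Suc r, c) \<notin> D"
  using copivot_cells[OF copivot] by (auto simp: D_def move_def)

lemma pivot_D: "pivot D r c" unfolding D_def by (rule copivot_move[OF copivot])

lemma c_range: "1 \<le> c" "c \<le> m" using E.cells_range[OF cells_c(1)] by auto

lemma cells_E: "(i, d) \<in> E \<longleftrightarrow> (if d = c \<and> i = r then False else if d = c \<and> i = Suc r then True else (i, d) \<in> D)"
  using copivot_cells[OF copivot] by (auto simp: D_def move_def)

lemma tp_other: "d \<noteq> c \<Longrightarrow> tp E d = tp D d" and lw_other: "d \<noteq> c \<Longrightarrow> lw E d = lw D d"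
  by (simp_all add: tp_def lw_def cells_E)

lemma column_E: "{i. (i, c) \<in> E} = insert (Suc r) ({i. (i, c) \<in> D} - {r})"
  using cells_c by (auto simp: cells_E)

lemma tp_lw_c: "tp E c = (if tp D c = r then Suc r else tp D c) \<and> lw E c = (if lw D c = r then Suc r else lw D c)"
proof (cases "c \<in> S")
  case True
  have D: "{i. (i, c) \<in> D} = {tp D c, lw D c}" "tp D c < lw D c" using D.column_double[OF True] by auto
  have E: "{i. (i, c) \<in> E} = {tp E c, lw E c}" "tp E c < lw E c" using E.column_double[OF True] by auto
  have rD: "r = tp D c \<or> r = lw D c" "Suc r \<noteq> tp D c" "Suc r \<noteq> lw D c"
    using cells_c(3,4) D.cell_iff[of r c] D.cell_iff[of "Suc r" c] c_range True by auto
  have eq: "{tp E c, lw E c} = insert (Suc r) ({tp D c, lw D c} - {r})"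
    using column_E unfolding D(1) E(1) .
  show ?thesis by (rule replace_in_pair[OF D(2) E(2) eq rD])
next
  case False
  have D: "{i. (i, c) \<in> D} = {tp D c}" "lw D c = tp D c" using D.column_single[OF c_range False] by auto
  have E: "{i. (i, c) \<in> E} = {tp E c}" "lw E c = tp E c" using E.column_single[OF c_range False] by auto
  have "tp D c = r" using cells_c(3) D.cell_iff[of r c] False by simp
  moreover have "tp E c = Suc r" using cells_c(1) E.cell_iff[of "Suc r" c] False by simp
  ultimately show ?thesis using D E by simp
qed

text \<open>As long as the bits agree, the filling changes only by the moved cell.\<close>

lemma row_same_flip:
  assumes x: "x \<in> P" and f: "flip D (col x) = flip E (col x)"
  shows "row E x = (if row D x = r \<and> col x = c then Suc r else row D x)"
proof (cases "col x = c")
  case True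
  then show ?thesis using tp_lw_c f by (auto simp: row_def)
next
  case False
  then show ?thesis using tp_other lw_other f by (auto simp: row_def)
qed

end

context raised begin

text \<open>
  A criterion for \<open>f\<^sub>r\<close> to lead from the array of \<open>D\<close> to that of \<open>E\<close> when the filling exchanges a run
  \<open>X 0, \<dots>, X t\<close> of row \<open>r\<close>, in the columns \<open>c, \<dots>, c + t\<close>, with entries \<open>Y 1, \<dots>, Y t\<close> of row \<open>r + 1\<close>.
  The chains of the two rows are cut at column \<open>c\<close>.  By \<open>not_above\<close>, the elements \<open>\<beta> j\<close> below \<open>\<alpha> k\<close> are
  in columns before that of \<open>\<alpha> k\<close>, so the conditions of \<open>two_chains\<close> become inequalities for the excess
  of \<open>D\<close>, which hold because \<open>c\<close> is a pivot.  The relations at the two ends of the run hold because the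
  elements concerned lie in one row of the filling of \<open>E\<close>.
\<close>

lemma f_array_raised:
  assumes not_above: "\<And>x y. \<lbrakk>x \<in> P; row D x = r; y \<in> P; row D y = Suc r; col x \<le> col y\<rbrakk> \<Longrightarrow> \<not> y \<prec> x"
    and X: "\<And>i. i \<le> t \<Longrightarrow> X i \<in> P \<and> row D (X i) = r \<and> col (X i) = c + i"
    and Y: "\<And>i. 1 \<le> i \<Longrightarrow> i \<le> t \<Longrightarrow> Y i \<in> P \<and> row D (Y i) = Suc r \<and> col (Y i) = c + i"
    and linked: "\<And>i. 1 \<le> i \<Longrightarrow> i \<le> t \<Longrightarrow> \<not> X (i - 1) \<prec> Y i"
    and blocked: "\<And>i z. \<lbrakk>1 \<le> i; i \<le> t; z \<in> P; row D z = r; c + i < col z\<rbrakk> \<Longrightarrow> Y i \<prec> z"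
    and rowE: "\<And>z. z \<in> P \<Longrightarrow>
      row E z = (if z \<in> X ` {0..t} then Suc r else if z \<in> Y ` {1..t} then r else row D z)"
  shows "f_array le r (arr (row D)) = Some (arr (row E))"
proof -
  define M n p B where "M = cnt D r m" and "n = cnt D (Suc r) m"
    and "p = cnt D r c" and "B = cnt D (Suc r) c"
  obtain \<alpha> where al: "\<And>k. arr (row D) (r, k) = (if 1 \<le> k \<and> k \<le> M then Some (\<alpha> k) else None)"
    and al_mono: "\<And>k l. 1 \<le> k \<Longrightarrow> k < l \<Longrightarrow> l \<le> M \<Longrightarrow> \<alpha> k \<prec> \<alpha> l"
    and al_in: "\<And>k. 1 \<le> k \<Longrightarrow> k \<le> M \<Longrightarrow> \<alpha> k \<in> P \<and> row D (\<alpha> k) = r \<and> cnt D r (col (\<alpha> k)) = k"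
    and al_inv: "\<And>x. x \<in> P \<Longrightarrow> row D x = r \<Longrightarrow> \<alpha> (cnt D r (col x)) = x"
    by (rule D.row_listing[of r, folded M_def]) (rule that; assumption)
  obtain \<beta> where be: "\<And>k. arr (row D) (Suc r, k) = (if 1 \<le> k \<and> k \<le> n then Some (\<beta> k) else None)"
    and be_mono: "\<And>k l. 1 \<le> k \<Longrightarrow> k < l \<Longrightarrow> l \<le> n \<Longrightarrow> \<beta> k \<prec> \<beta> l"
    and be_in: "\<And>k. 1 \<le> k \<Longrightarrow> k \<le> n \<Longrightarrow> \<beta> k \<in> P \<and> row D (\<beta> k) = Suc r \<and> cnt D (Suc r) (col (\<beta> k)) = k"
    and be_inv: "\<And>x. x \<in> P \<Longrightarrow> row D x = Suc r \<Longrightarrow> \<beta> (cnt D (Suc r) (col x)) = x"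
    by (rule D.row_listing[of "Suc r", folded n_def]) (rule that; assumption)
  have p1: "cnt D r (c - 1) + 1 = p" unfolding p_def using cnt_pred[OF c_range(1), of D r] cells_c(3) by simp
  have B1: "cnt D (Suc r) (c - 1) = B" unfolding B_def using cnt_pred[OF c_range(1), of D "Suc r"] cells_c(4) by simp
  have pM: "p \<le> M" and Bn: "B \<le> n" unfolding p_def M_def B_def n_def by (rule cnt_mono[OF c_range(2)])+
  have after: "cnt D (Suc r) d + p \<le> B + cnt D r d" if "c \<le> d" for d
  proof -
    have "excess D r d < excess D r (c - 1)" using pivot_D that unfolding pivot_def by blast
    then show ?thesis using p1 B1 by (simp add: excess_def)
  qed
  have upto: "cnt D (Suc r) d + p \<le> B + cnt D r d + 1" if "d < c" for d
  proof -
    have "excess D r d \<le> excess D r (c - 1)" using pivot_D that unfolding pivot_def by blast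
    then show ?thesis using p1 B1 by (simp add: excess_def)
  qed
  have key: "j \<le> cnt D (Suc r) (col (\<alpha> k) - 1) \<and> cnt D r (col (\<alpha> k) - 1) + 1 = k"
    if h: "1 \<le> k" "k \<le> M" "1 \<le> j" "j \<le> n" "\<beta> j \<prec> \<alpha> k" for j k
  proof -
    have "\<not> col (\<alpha> k) \<le> col (\<beta> j)" using not_above[of "\<alpha> k" "\<beta> j"] al_in[OF h(1,2)] be_in[OF h(3,4)] h(5) by blast
    then have "cnt D (Suc r) (col (\<beta> j)) \<le> cnt D (Suc r) (col (\<alpha> k) - 1)" by (intro cnt_mono) simp
    moreover have "(r, col (\<alpha> k)) \<in> D" "1 \<le> col (\<alpha> k)"
      using D.row_cell[of "\<alpha> k"] col_range[of "\<alpha> k"] al_in[OF h(1,2)] by auto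
    ultimately show ?thesis using cnt_pred[of "col (\<alpha> k)" D r] al_in[OF h(1,2)] be_in[OF h(3,4)] by simp
  qed
  have colX: "cnt D r (c + i) = p + i" if "i \<le> t" for i
    using that
  proof (induction i)
    case (Suc i)
    have "(r, c + Suc i) \<in> D" using X[of "Suc i"] D.row_cell[of "X (Suc i)"] Suc.prems by simp
    then show ?case using Suc cnt_Suc[of D r "c + i"] by simp
  qed (simp add: p_def)
  have colY: "cnt D (Suc r) (c + i) = B + i" if "i \<le> t" for i
    using that
  proof (induction i)
    case (Suc i)
    have "(Suc r, c + Suc i) \<in> D" using Y[of "Suc i"] D.row_cell[of "Y (Suc i)"] Suc.prems by simp
    then show ?case using Suc cnt_Suc[of D "Suc r" "c + i"] by simp
  qed (simp add: B_def)
  have aX: "\<alpha> (p + i) = X i" if "i \<le> t" for i using al_inv[of "X i"] X[OF that] colX[OF that] by simp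
  have bY: "\<beta> (B + i) = Y i" if "1 \<le> i" "i \<le> t" for i using be_inv[of "Y i"] Y[OF that] colY[of i] that by simp
  have le_m: "c + i \<le> m" if "i \<le> t" for i using X[OF that] col_range[of "X i"] by simp
  have XY_col: "z \<notin> X ` {0..t} \<and> z \<notin> Y ` {1..t}" if "col z < c \<or> c + t < col z" for z
    using X Y that by fastforce
  have X0: "X 0 \<in> P" "row D (X 0) = r" "col (X 0) = c" "row E (X 0) = Suc r"
    using X[of 0] rowE[of "X 0"] by auto
  have k_before: "col (\<alpha> k) < c" if "1 \<le> k" "k < p" for k
  proof (rule ccontr)
    assume "\<not> ?thesis"
    then have "p \<le> cnt D r (col (\<alpha> k))" unfolding p_def by (intro cnt_mono) simp
    then show False using al_in[of k] that pM by simp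
  qed
  have k_after: "c < col (\<alpha> k)" if "p < k" "k \<le> M" for k
  proof (rule ccontr)
    assume "\<not> ?thesis"
    then have "cnt D r (col (\<alpha> k)) \<le> p" unfolding p_def by (intro cnt_mono) simp
    then show False using al_in[of k] that p1 by simp
  qed
  have p_ge: "1 \<le> p" using p1 by simp
  have strict: "j + p < B + k" if h: "p < k" "k \<le> M" "1 \<le> j" "j \<le> n" "\<beta> j \<prec> \<alpha> k" for j k
  proof -
    have "c \<le> col (\<alpha> k) - 1" using k_after[OF h(1,2)] by simp
    from after[OF this] key[of k j] h p_ge show ?thesis by simp
  qed
  interpret T: two_chains P le "arr (row D)" r \<alpha> \<beta> M n p B
  proof unfold_locales
    show "inj_on (arr (row D)) (dom (arr (row D)))" by (rule D.inj_arr)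
    show "1 \<le> p" by (rule p_ge)
    show "p \<le> M + 1" using pM by simp
    show "B \<le> n" by (rule Bn)
    show "p \<le> B + 1" using upto[of 0] c_range cnt_0[OF D.diagram] by simp
    show "n + p \<le> B + M + 1" using after[OF c_range(2)] by (simp add: n_def M_def)
    show "\<beta> B \<prec> \<alpha> p" if "p \<le> M" "1 \<le> B"
    proof -
      have b: "\<beta> B \<in> P" "row D (\<beta> B) = Suc r" "cnt D (Suc r) (col (\<beta> B)) = B"
        using be_in[of B] that Bn by auto
      have "col (\<beta> B) < c"
      proof (rule ccontr)
        assume "\<not> ?thesis"
        moreover have "col (\<beta> B) \<noteq> c" using D.row_cell[OF b(1)] b(2) cells_c(4) by auto
        moreover have "(Suc r, col (\<beta> B)) \<in> D" using D.row_cell[OF b(1)] b(2) by simp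
        ultimately have "cnt D (Suc r) c < cnt D (Suc r) (col (\<beta> B))" by (intro D.cnt_less) auto
        then show False using b(3) by (simp add: B_def)
      qed
      then have "row E (\<beta> B) = Suc r" using rowE[OF b(1)] XY_col[of "\<beta> B"] b(2) by simp
      moreover have "\<alpha> p = X 0" using aX[of 0] by simp
      ultimately show ?thesis using E.row_increasing[OF b(1) X0(1)] X0 \<open>col (\<beta> B) < c\<close> by simp
    qed
    show "j + (p - k) \<le> B" if h: "1 \<le> k" "k < p" "1 \<le> j" "j \<le> n" "\<beta> j \<prec> \<alpha> k" for k j
    proof -
      have "col (\<alpha> k) - 1 < c" using k_before[OF h(1,2)] by simp
      from upto[OF this] key[of k j] h pM have "j + p \<le> B + k" by simp
      then show ?thesis using h(2) by simp
    qed
    show "j + p \<le> B + k" if h: "p \<le> k" "k \<le> M" "1 \<le> j" "j \<le> n" "\<beta> j \<prec> \<alpha> k" for k j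
    proof (cases "k = p")
      case True
      have "\<alpha> p = X 0" using aX[of 0] by simp
      then show ?thesis using key[of k j] h True p_ge X0 B1 by simp
    next
      case False then show ?thesis using strict[of k j] h by simp
    qed
  qed (use al be al_mono be_mono in auto)
  have "p + t \<le> M" unfolding M_def using cnt_mono[OF le_m[of t], of D r] colX[of t] by simp
  moreover have "B + t \<le> n" unfolding n_def using cnt_mono[OF le_m[of t], of D "Suc r"] colY[of t] by simp
  ultimately have tt: "p + t \<le> M" "B + t \<le> n" by auto
  have "f_array le r (arr (row D)) = Some (array_of_rows (ran (arr (row D))) le
    (\<lambda>x. if x \<in> \<alpha> ` {p..p + t} then r + 1 else if x \<in> \<beta> ` {B + 1..B + t} then r else row_of (arr (row D)) x))"
  proof (rule T.f_array_pivot[OF pM strict _ tt])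
    show "n + p \<le> B + M" using after[OF c_range(2)] by (simp add: n_def M_def)
  next
    fix i assume i: "1 \<le> i" "i \<le> t"
    have "p + i - 1 = p + (i - 1)" using i by simp
    then show "\<not> \<alpha> (p + i - 1) \<prec> \<beta> (B + i)" using aX[of "i - 1"] bY[OF i] linked[OF i] i by simp
  next
    fix i assume i: "1 \<le> i" "i \<le> t" "p + i + 1 \<le> M"
    have z: "\<alpha> (p + i + 1) \<in> P" "row D (\<alpha> (p + i + 1)) = r" "cnt D r (col (\<alpha> (p + i + 1))) = p + i + 1"
      using al_in[of "p + i + 1"] i by auto
    have "c + i < col (\<alpha> (p + i + 1))"
    proof (rule ccontr)
      assume "\<not> ?thesis"
      then have "cnt D r (col (\<alpha> (p + i + 1))) \<le> cnt D r (c + i)" by (intro cnt_mono) simp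
      then show False using z(3) colX[OF i(2)] by simp
    qed
    then show "\<beta> (B + i) \<prec> \<alpha> (p + i + 1)" using blocked[OF i(1,2) z(1,2)] bY[OF i(1,2)] by simp
  next
    assume n: "B + t + 1 \<le> n"
    have z: "\<beta> (B + t + 1) \<in> P" "row D (\<beta> (B + t + 1)) = Suc r" "cnt D (Suc r) (col (\<beta> (B + t + 1))) = B + t + 1"
      using be_in[of "B + t + 1"] n by auto
    have c: "c + t < col (\<beta> (B + t + 1))"
    proof (rule ccontr)
      assume "\<not> ?thesis"
      then have "cnt D (Suc r) (col (\<beta> (B + t + 1))) \<le> cnt D (Suc r) (c + t)" by (intro cnt_mono) simp
      then show False using z(3) colY[of t] by simp
    qed
    have "row E (\<beta> (B + t + 1)) = Suc r" using rowE[OF z(1)] XY_col c z(2) by simp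
    moreover have Xt: "X t \<in> P" "row E (X t) = Suc r" "col (X t) = c + t" using X[of t] rowE[of "X t"] by auto
    ultimately show "\<alpha> (p + t) \<prec> \<beta> (B + t + 1)"
      using E.row_increasing[OF Xt(1) z(1)] c aX[of t] by simp
  qed
  also have "array_of_rows (ran (arr (row D))) le
    (\<lambda>x. if x \<in> \<alpha> ` {p..p + t} then r + 1 else if x \<in> \<beta> ` {B + 1..B + t} then r else row_of (arr (row D)) x)
    = arr (row E)"
    unfolding D.ran_arr
  proof (rule array_of_rows_cong)
    fix x assume x: "x \<in> P"
    have "\<alpha> ` {p..p + t} = X ` {0..t}"
    proof -
      have "{p..p + t} = (\<lambda>i. p + i) ` {0..t}" by (simp add: add.commute)
      then show ?thesis unfolding \<open>{p..p + t} = _\<close> image_image using aX by (intro image_cong) auto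
    qed
    moreover have "\<beta> ` {B + 1..B + t} = Y ` {1..t}"
    proof -
      have "{B + 1..B + t} = (\<lambda>i. B + i) ` {1..t}" by simp
      then show ?thesis unfolding \<open>{B + 1..B + t} = _\<close> image_image using bY by (intro image_cong) auto
    qed
    ultimately show "(if x \<in> \<alpha> ` {p..p + t} then r + 1 else if x \<in> \<beta> ` {B + 1..B + t} then r
        else row_of (arr (row D)) x) = row E x"
      using rowE[OF x] row_of_arr[OF D.row_chains_row x] by simp
  qed
  finally show ?thesis .
qed

text \<open>
  The bits compare lower cells with upper cells of the previous column, and only a comparison of cells
  in rows \<open>r\<close> and \<open>r + 1\<close>, the one in row \<open>r + 1\<close> being to the right, could change its outcome.  There is
  none, as row \<open>r + 1\<close> lies to the left of row \<open>r\<close>.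
\<close>

lemma raised_last:
  assumes last: "\<And>e. (Suc r, e) \<in> E \<Longrightarrow> e \<le> c" and right: "\<And>e. (r, e) \<in> E \<Longrightarrow> c < e"
  shows "f_array le r (arr (row D)) = Some (arr (row E))"
    and "\<And>x. x \<in> P \<Longrightarrow> row D x = (if row E x = Suc r \<and> col x = c then r else row E x)"
proof -
  have flips: "flip D e = flip E e" for e
  proof (induction e)
    case (Suc e)
    show ?case
    proof (cases "link (Suc e)")
      case True
      then have e: "Suc e \<in> S" "1 \<le> e" by (auto simp: link_def)
      then have em: "Suc e \<le> m" "e \<le> m" using S_range[of "Suc e"] by auto
      have "lw D (Suc e) \<le> tp D e \<longleftrightarrow> lw E (Suc e) \<le> tp E e"
      proof (cases "e = c")
        case ec: True
        have "lw E (Suc c) \<noteq> Suc r" using last[of "Suc c"] E.lw_cell[of "Suc c"] em ec by auto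
        then show ?thesis using tp_lw_c lw_other[of "Suc c"] ec by auto
      next
        case ne: False
        show ?thesis
        proof (cases "Suc e = c")
          case ec: True
          have "tp E e \<noteq> r" using right[of e] E.tp_cell[of e] e em ec by auto
          then show ?thesis using tp_lw_c tp_other[OF ne] ec by auto
        next
          case False then show ?thesis using tp_other[OF ne] lw_other[OF False] by simp
        qed
      qed
      then show ?thesis using Suc by simp
    qed simp
  qed simp
  have rowE: "row E x = (if row D x = r \<and> col x = c then Suc r else row D x)" if "x \<in> P" for x
    using row_same_flip[OF that] flips by simp
  show "row D x = (if row E x = Suc r \<and> col x = c then r else row E x)" if x: "x \<in> P" for x
  proof -
    have "row D x = Suc r \<Longrightarrow> col x \<noteq> c" using D.row_cell[OF x] cells_c(4) by auto
    then show ?thesis using rowE[OF x] by auto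
  qed
  obtain x0 where x0: "x0 \<in> P" "row D x0 = r" "col x0 = c" using D.cell_element[OF cells_c(3)] by blast
  show "f_array le r (arr (row D)) = Some (arr (row E))"
  proof (rule f_array_raised[of 0 "\<lambda>_. x0" "\<lambda>_. x0"])
    fix x y assume h: "x \<in> P" "row D x = r" "y \<in> P" "row D y = Suc r" "col x \<le> col y"
    have "(r, col x) \<in> D" "(Suc r, col y) \<in> D" using D.row_cell h by metis+
    then have "(col x = c \<or> (r, col x) \<in> E) \<and> (Suc r, col y) \<in> E \<and> col y \<noteq> c"
      using cells_c by (auto simp: cells_E)
    then show "\<not> y \<prec> x" using last[of "col y"] right[of "col x"] h(5) by linarith
  next
    fix z assume z: "z \<in> P"
    have "z = x0 \<longleftrightarrow> row D z = r \<and> col z = c" using x0 D.row_col_inj[OF z x0(1)] by auto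
    then show "row E z = (if z \<in> (\<lambda>_. x0) ` {0..0::nat} then Suc r else if z \<in> (\<lambda>_. x0) ` {1..0::nat} then r else row D z)"
      using rowE[OF z] by simp
  qed (use x0 in auto)
qed

end

text \<open>
  The moved cell is the upper, or the only, cell of column \<open>c\<close> of \<open>D\<close>.  Its entry drags entries of the
  following linked columns along as soon as it reaches row 2, provided that these columns have their
  lower cell in row 2; the columns of this run are \<open>{1, 2}\<close>, as a cell further down would create a
  forbidden triple.
\<close>

locale raised_first = raised P le m S a b E 1 c
  for P :: "'a set" and le m S a b E c
begin

lemma cells1: "(2, c) \<in> E" "(1, c) \<notin> E" "(1, c) \<in> D" "(2, c) \<notin> D"
  using cells_c unfolding Suc_1 by auto

text \<open>The number of columns whose bit changes.  If column \<open>c\<close> is flipped already, the following linked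
  columns are flipped as well, and nothing else changes.\<close>

definition t where "t = (if flip D c then 0 else LEAST t. \<not> (link (c + t + 1) \<and> (2, c + t + 1) \<in> D))"

lemma run: assumes "1 \<le> i" "i \<le> t" shows "\<not> flip D c" "link (c + i)" "(2, c + i) \<in> D" "c + i \<in> S"
proof -
  show f: "\<not> flip D c" using assms by (auto simp: t_def)
  have "i - 1 < (LEAST t. \<not> (link (c + t + 1) \<and> (2, c + t + 1) \<in> D))" using assms f by (simp add: t_def)
  from not_less_Least[OF this] assms(1) show "link (c + i)" "(2, c + i) \<in> D" by auto
  then show "c + i \<in> S" by (simp add: link_def)
qed

lemma run_stop: assumes "\<not> flip D c" shows "\<not> (link (c + t + 1) \<and> (2, c + t + 1) \<in> D)"
proof -
  let ?Q = "\<lambda>t. \<not> (link (c + t + 1) \<and> (2, c + t + 1) \<in> D)"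
  have "?Q m" using S_range[of "c + m + 1"] by (auto simp: link_def)
  then have "?Q (LEAST t. ?Q t)" by (rule LeastI)
  then show ?thesis using assms by (simp add: t_def)
qed

lemma tp_ge_1: "1 \<le> d \<Longrightarrow> d \<le> m \<Longrightarrow> 1 \<le> tp D d" using D.cells_range[OF D.tp_cell[of d]] by simp

lemma tp_c: "tp D c = 1"
  using cells1(3) D.cell_iff[of 1 c] D.tp_less_lw[of c] tp_ge_1[OF c_range] by auto

lemma run_column: assumes "1 \<le> i" "i \<le> t" shows "tp D (c + i) = 1" "lw D (c + i) = 2"
proof -
  note i = run[OF assms]
  have ci: "1 \<le> c + i" "c + i \<le> m" using S_range[OF i(4)] by auto
  have lt: "tp D (c + i) < lw D (c + i)" by (rule D.tp_less_lw[OF i(4)])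
  have "lw D (c + i) \<le> 2"
    using D.no_triple[OF cells1(3) i(3) D.lw_cell[OF ci]] by (force simp: not_le[symmetric])
  then show "tp D (c + i) = 1" "lw D (c + i) = 2" using lt tp_ge_1[OF ci] by auto
qed

lemma tp_run: "i \<le> t \<Longrightarrow> tp D (c + i) = 1"
  using run_column[of i] tp_c by (cases i) auto

lemma flip_D_run: "\<not> flip D c \<Longrightarrow> i \<le> t \<Longrightarrow> \<not> flip D (c + i)"
proof (induction i)
  case (Suc i)
  then show ?case using tp_run[of i] run_column(2)[of "Suc i"] by simp
qed simp

lemma flip_left: "e \<le> c \<Longrightarrow> flip E e = flip D e"
proof (induction e)
  case (Suc e)
  have te: "tp E e = tp D e" using Suc.prems by (intro tp_other) simp
  show ?case
  proof (cases "link (Suc e)")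
    case True
    then have eS: "Suc e \<in> S" by (simp add: link_def)
    have "lw E (Suc e) = lw D (Suc e)"
    proof (cases "Suc e = c")
      case ec: True
      have "1 < lw D c" using D.tp_less_lw[of c] tp_c eS ec by simp
      then show ?thesis using tp_lw_c ec by simp
    next
      case False then show ?thesis by (rule lw_other)
    qed
    then show ?thesis using Suc te by simp
  qed simp
qed simp

lemma tp_E_c: "tp E c = 2" using tp_lw_c tp_c by simp

lemma flip_E_run: "1 \<le> i \<Longrightarrow> i \<le> t \<Longrightarrow> flip E (c + i)"
proof (induction i rule: dec_induct)
  case base
  have "lw E (c + 1) = 2" using lw_other[of "c + 1"] run_column(2)[of 1] base by simp
  then show ?case using tp_E_c run(2)[of 1] base by simp
next
  case (step i)
  then show ?case using run(2)[of "Suc i"] by simp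
qed

text \<open>A linked column after the run has its lower cell below row 2.  Then the run is empty, by the absence
  of forbidden triples, and neither position of the upper cell of column \<open>c\<close> reaches that lower cell.\<close>

lemma flip_stop: assumes "\<not> flip D c" shows "\<not> flip D (c + t + 1) \<and> \<not> flip E (c + t + 1)"
proof (cases "link (c + t + 1)")
  case True
  then have S': "c + t + 1 \<in> S" by (simp add: link_def)
  then have cm: "1 \<le> c + t + 1" "c + t + 1 \<le> m" using S_range[OF S'] by auto
  have "(2, c + t + 1) \<notin> D" using run_stop[OF assms] True by blast
  then have "lw D (c + t + 1) \<noteq> 2" using D.lw_cell[OF cm] by metis
  then have lw3: "2 < lw D (c + t + 1)" using D.tp_less_lw[OF S'] tp_ge_1[OF cm] by linarith
  have "t = 0"
  proof (rule ccontr)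
    assume "t \<noteq> 0"
    then show False using D.no_triple[OF cells1(3) run(3)[of 1] D.lw_cell[OF cm]] lw3 by simp
  qed
  then show ?thesis
    using assms lw3 tp_c tp_E_c flip_left[of c] lw_other[of "c + 1"] by simp
next
  case False then show ?thesis using flip_link by blast
qed

lemma flip_right: "c + t + 1 \<le> e \<Longrightarrow> flip E e = flip D e"
proof (induction e rule: dec_induct)
  case base
  show ?case
  proof (cases "flip D c")
    case True
    then have "t = 0" by (simp add: t_def)
    then show ?thesis using True flip_left[of c] by simp
  next
    case False then show ?thesis using flip_stop by blast
  qed
next
  case (step e)
  have ne: "e \<noteq> c" "Suc e \<noteq> c" using step.hyps by auto
  have "tp E e = tp D e" "lw E (Suc e) = lw D (Suc e)" by (rule tp_other[OF ne(1)], rule lw_other[OF ne(2)])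
  then show ?case using step by simp
qed

definition X where "X i = (if i = 0 then (if flip D c then b c else a c) else a (c + i))"
definition Y where "Y i = b (c + i)"

lemma X0: "X 0 \<in> P \<and> row D (X 0) = 1 \<and> col (X 0) = c"
proof (cases "flip D c")
  case True
  then have "c \<in> S" by (rule flip_S)
  then show ?thesis using True bP tp_c by (simp add: X_def row_b)
next
  case False then show ?thesis using aP c_range tp_c by (simp add: X_def row_a)
qed

lemma X: assumes "i \<le> t" shows "X i \<in> P \<and> row D (X i) = 1 \<and> col (X i) = c + i"
proof (cases "i = 0")
  case True then show ?thesis using X0 by simp
next
  case False
  then have i: "1 \<le> i" by simp
  note R = run[OF i assms]
  have "\<not> flip D (c + i)" by (rule flip_D_run[OF R(1) assms])
  then show ?thesis using False aP[of "c + i"] S_range[OF R(4)] run_column(1)[OF i assms] by (simp add: X_def row_a)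
qed

lemma X_a: "\<not> flip D c \<Longrightarrow> X i = a (c + i)" by (simp add: X_def)

lemma Y: assumes i: "1 \<le> i" "i \<le> t" shows "Y i \<in> P \<and> row D (Y i) = 2 \<and> col (Y i) = c + i"
proof -
  note R = run[OF i]
  have "\<not> flip D (c + i)" by (rule flip_D_run[OF R(1) i(2)])
  then show ?thesis using bP[OF R(4)] R(4) run_column(2)[OF i] by (simp add: Y_def row_b)
qed

lemma row_E: assumes z: "z \<in> P"
  shows "row E z = (if z \<in> X ` {0..t} then 2 else if z \<in> Y ` {1..t} then 1 else row D z)"
proof (cases "c < col z \<and> col z \<le> c + t")
  case True
  define i where "i = col z - c"
  have i: "1 \<le> i" "i \<le> t" "col z = c + i" using True by (auto simp: i_def)
  note R = run[OF i(1,2)] and f = flip_E_run[OF i(1,2)]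
  have ci: "1 \<le> c + i" "c + i \<le> m" using S_range[OF R(4)] by auto
  have eq: "tp E (c + i) = 1" "lw E (c + i) = 2"
    using tp_other[of "c + i"] lw_other[of "c + i"] run_column[OF i(1,2)] i by auto
  from z show ?thesis
  proof (cases rule: P_cases)
    case (a d)
    then have "d = c + i" using i by simp
    then have "z = X i" using a i by (simp add: X_def)
    moreover have "row E z = 2" using a \<open>d = c + i\<close> f eq by (simp add: row_a)
    ultimately show ?thesis using i by auto
  next
    case (b d)
    then have d: "d = c + i" using i by simp
    then have zY: "z = Y i" using b by (simp add: Y_def)
    have "z \<noteq> X j" if "j \<le> t" for j
    proof
      assume "z = X j"
      then have "row D z = 1" using X[OF that] by simp
      moreover have "row D z = 2" using zY Y[OF i(1,2)] by simp
      ultimately show False by simp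
    qed
    then have "z \<notin> X ` {0..t}" by (metis atLeastAtMost_iff imageE)
    moreover have "row E z = 1" using b d f eq by (simp add: row_b)
    ultimately show ?thesis using zY i by auto
  qed
next
  case False
  then have f: "flip D (col z) = flip E (col z)" using flip_left[of "col z"] flip_right[of "col z"] by fastforce
  have i0: "i = 0" if "z = X i" "i \<le> t" for i using X[OF that(2)] that False by auto
  have "z \<in> X ` {0..t} \<longleftrightarrow> z = X 0"
  proof
    assume "z \<in> X ` {0..t}"
    then obtain i where i: "z = X i" "i \<le> t" by auto
    then have "i = 0" by (rule i0)
    then show "z = X 0" using i by simp
  qed simp
  also have "\<dots> \<longleftrightarrow> row D z = 1 \<and> col z = c" using X0 D.row_col_inj[OF z, of "X 0"] by auto
  finally have zX: "z \<in> X ` {0..t} \<longleftrightarrow> row D z = 1 \<and> col z = c" .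
  have zY: "z \<notin> Y ` {1..t}" using Y False by fastforce
  show ?thesis using row_same_flip[OF z f] zX zY unfolding Suc_1 by simp
qed

lemma linked: assumes i: "1 \<le> i" "i \<le> t" shows "\<not> X (i - 1) \<prec> Y i"
proof -
  note R = run[OF i]
  have "c + i - 1 = c + (i - 1)" using i by simp
  then show ?thesis using R(2) X_a[OF R(1), of "i - 1"] by (simp add: link_def Y_def)
qed

lemma link_less_right: assumes l: "link d" and z: "z \<in> P" "d < col z" shows "b d \<prec> z"
  using z(1)
proof (cases rule: P_cases)
  case (a e) then show ?thesis using link_b_less[OF l, of e] z by simp
next
  case (b e) then show ?thesis using b_mono[of d e] l z by (simp add: link_def)
qed

lemma f_array_eq: "f_array le 1 (arr (row D)) = Some (arr (row E))"
proof (rule f_array_raised[of t X Y])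
  show "\<And>x y. \<lbrakk>x \<in> P; row D x = 1; y \<in> P; row D y = Suc 1; col x \<le> col y\<rbrakk> \<Longrightarrow> \<not> y \<prec> x"
    unfolding Suc_1 by (rule D.upper_not_above)
  show "\<And>i. i \<le> t \<Longrightarrow> X i \<in> P \<and> row D (X i) = 1 \<and> col (X i) = c + i" by (rule X)
  show "\<And>i. 1 \<le> i \<Longrightarrow> i \<le> t \<Longrightarrow> Y i \<in> P \<and> row D (Y i) = Suc 1 \<and> col (Y i) = c + i"
    unfolding Suc_1 by (rule Y)
  show "\<And>i. 1 \<le> i \<Longrightarrow> i \<le> t \<Longrightarrow> \<not> X (i - 1) \<prec> Y i" by (rule linked)
  show "\<And>i z. \<lbrakk>1 \<le> i; i \<le> t; z \<in> P; row D z = 1; c + i < col z\<rbrakk> \<Longrightarrow> Y i \<prec> z"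
    unfolding Y_def using link_less_right run(2) by blast
  show "\<And>z. z \<in> P \<Longrightarrow>
      row E z = (if z \<in> X ` {0..t} then Suc 1 else if z \<in> Y ` {1..t} then 1 else row D z)"
    unfolding Suc_1 by (rule row_E)
qed

lemma row_E_X: "i \<le> t \<Longrightarrow> row E (X i) = 2" using row_E[of "X i"] X[of i] by auto

lemma row_E_Y: assumes i: "1 \<le> i" "i \<le> t" shows "row E (Y i) = 1"
proof -
  have "Y i \<noteq> X j" if "j \<le> t" for j
  proof
    assume "Y i = X j"
    then show False using X[OF that] Y[OF i] by simp
  qed
  then have "Y i \<notin> X ` {0..t}" by (metis atLeastAtMost_iff imageE)
  then show ?thesis using row_E[of "Y i"] Y[OF i] i by auto
qed

lemma cnt_E_run:
  assumes "i \<le> t" shows "cnt E 2 (c + i) = cnt E 2 c + i \<and> cnt E 1 (c + i) = cnt E 1 c + i"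
  using assms
proof (induction i)
  case (Suc i)
  have i: "1 \<le> Suc i" "Suc i \<le> t" using Suc.prems by auto
  have "(2, Suc (c + i)) \<in> E" using E.row_cell[of "X (Suc i)"] X[OF i(2)] row_E_X[OF i(2)] by simp
  moreover have "(1, Suc (c + i)) \<in> E" using E.row_cell[of "Y (Suc i)"] Y[OF i] row_E_Y[OF i] by simp
  ultimately show ?case using Suc cnt_Suc[of E 2 "c + i"] cnt_Suc[of E 1 "c + i"] by simp
qed simp

lemma excess_E: "excess E 1 e = int (cnt E 2 e) - int (cnt E 1 e)"
  unfolding excess_def Suc_1 ..

text \<open>After the run, an entry \<open>b d\<close> of a linked column that is not above \<open>X t\<close> would have to be flipped in
  order to lie in row 1, contrary to \<open>flip_stop\<close>.\<close>

lemma X_last_less: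
  assumes x: "x \<in> P" "row E x = 1" "c + t < col x" shows "X t \<prec> x"
proof (cases "flip D c")
  case True
  then have "t = 0" "X t = b c" by (auto simp: t_def X_def)
  then show ?thesis using link_less_right[OF flip_link[OF True] x(1)] x(3) by simp
next
  case False
  then have Xt: "X t = a (c + t)" by (rule X_a)
  from x(1) show ?thesis
  proof (cases rule: P_cases)
    case (a d) then show ?thesis using a_mono[of "c + t" d] Xt x(3) c_range by simp
  next
    case (b d)
    have d: "c + t < d" using b x(3) by simp
    have "1 \<le> tp E d" using E.cells_range[OF E.tp_cell[of d]] S_range[OF b(1)] by simp
    then have "flip E d" using x(2) b E.tp_less_lw[OF b(1)] by (auto simp: row_b split: if_splits)
    then have "d \<noteq> c + t + 1" using flip_stop[OF False] by blast
    then show ?thesis using a_less_b[of "c + t" d] d b c_range Xt by simp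
  qed
qed

lemma card_not_above_X: "card {x \<in> P. row E x = 1 \<and> \<not> X t \<prec> x} = cnt E 1 (c + t)"
proof -
  have "{x \<in> P. row E x = 1 \<and> \<not> X t \<prec> x} = {x \<in> P. row E x = 1 \<and> col x \<le> c + t}"
    using X_last_less E.upper_not_above[of _ "X t"] X[of t] row_E_X[of t] by (auto simp: not_le[symmetric])
  then show ?thesis by (simp add: E.card_row_prefix)
qed

lemma rank_E_X: "i \<le> t \<Longrightarrow> rank (row E) (X i) = cnt E 2 c + i"
  using E.rank_eq_cnt[of "X i"] X[of i] row_E_X[of i] cnt_E_run[of i] by simp

lemma Gamma_X: "Gamma (row E) (X t) = excess E 1 c"
  unfolding Gamma_def card_not_above_X excess_E using rank_E_X[of t] cnt_E_run[of t] by simp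

text \<open>
  In the columns of the run, \<open>E\<close> has one cell in each of rows 1 and 2, so its excess is constant there,
  equal to its maximum.  The array, however, reaches this maximum only at \<open>X t\<close>, because \<open>Y (i + 1)\<close> is
  not above \<open>X i\<close> although it lies to its right.
\<close>

lemma shifted_by_rows: "shifted_by (row E) (row D) (cnt E 2 (c + t)) (cnt E 1 (c + t)) t X Y"
  unfolding shifted_by_def
proof (intro conjI allI ballI impI)
  fix i assume "i \<le> t"
  then show "X i \<in> P" "row E (X i) = 2" "rank (row E) (X i) + t = cnt E 2 (c + t) + i"
    using X row_E_X rank_E_X cnt_E_run[of t] by auto
next
  fix i assume "1 \<le> i \<and> i \<le> t"
  then have i: "1 \<le> i" "i \<le> t" by auto
  note R = run[OF i]
  show "Y i \<in> P" "row E (Y i) = 1" using Y[OF i] row_E_Y[OF i] by auto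
  then show "rank (row E) (Y i) + t = cnt E 1 (c + t) + i"
    using E.rank_eq_cnt[of "Y i"] Y[OF i] cnt_E_run[OF i(2)] cnt_E_run[of t] by simp
  show "\<not> Y i \<prec> X i" using same_column[OF R(4)] X_a[OF R(1)] by (simp add: Y_def)
next
  fix z assume z: "z \<in> P"
  have "z \<in> X ` {0..t} \<Longrightarrow> row D z = 1" using X by auto
  moreover have "z \<in> Y ` {1..t} \<Longrightarrow> row D z = 2" using Y by auto
  ultimately show "row D z = (if z \<in> X ` {0..t} then 1 else if z \<in> Y ` {1..t} then 2 else row E z)"
    using row_E[OF z] by auto
next
  fix z assume z: "z \<in> P" and "row E z = 1 \<and> rank (row E) z + t \<le> cnt E 1 (c + t)"
  then have z1: "row E z = 1" "cnt E 1 (col z) \<le> cnt E 1 c" using E.rank_eq_cnt[OF z] cnt_E_run[of t] by auto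
  have zc: "(1, col z) \<in> E" using E.row_cell[OF z] z1 by simp
  have "col z \<noteq> c" using zc cells1(2) by auto
  moreover have "\<not> c < col z" using E.cnt_less[OF zc, of c] z1 by auto
  ultimately have lt: "col z < c" by simp
  then have "z \<notin> X ` {0..t} \<and> z \<notin> Y ` {1..t}" using X Y by fastforce
  then have "row D z = 1" using row_E[OF z] z1 by simp
  then show "z \<prec> X 0" using D.row_increasing[OF z, of "X 0"] X0 lt by simp
next
  fix y assume y: "y \<in> P" "row E y = 2"
  have le: "Gamma (row E) y \<le> excess E 1 (col y)" by (rule E.Gamma_le_excess[OF y])
  have "excess E 1 (col y) \<le> excess E 1 c"
    using copivot unfolding copivot_def by (cases "col y" c rule: linorder_cases) (auto intro: less_imp_le)
  with le show "Gamma (row E) y \<le> Gamma (row E) (X t)" unfolding Gamma_X by simp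
  assume r: "rank (row E) y < cnt E 2 (c + t)"
  show "Gamma (row E) y < Gamma (row E) (X t)"
  proof (cases "col y < c")
    case True
    then have "excess E 1 (col y) < excess E 1 c" using copivot unfolding copivot_def by blast
    then show ?thesis using le unfolding Gamma_X by simp
  next
    case False
    have "\<not> c + t \<le> col y" using r E.rank_eq_cnt[OF y(1)] y(2) cnt_mono[of "c + t" "col y" E 2] by auto
    define i where "i = col y - c"
    have i: "i < t" "col y = c + i" using False \<open>\<not> c + t \<le> col y\<close> by (auto simp: i_def)
    have yX: "y = X i"
      using E.row_col_inj[of y "X i"] y X[of i] row_E_X[of i] i by simp
    have i1: "1 \<le> i + 1" "i + 1 \<le> t" using i by auto
    have "insert (Y (i + 1)) {x \<in> P. row E x = 1 \<and> col x \<le> c + i} \<subseteq> {x \<in> P. row E x = 1 \<and> \<not> y \<prec> x}"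
      using E.upper_not_above[of _ y] y i linked[OF i1] Y[OF i1] row_E_Y[OF i1] yX by auto
    then have "card (insert (Y (i + 1)) {x \<in> P. row E x = 1 \<and> col x \<le> c + i})
        \<le> card {x \<in> P. row E x = 1 \<and> \<not> y \<prec> x}"
      using finP by (intro card_mono) auto
    moreover have "Y (i + 1) \<notin> {x \<in> P. row E x = 1 \<and> col x \<le> c + i}" using Y[OF i1] by simp
    ultimately have "Suc (cnt E 1 (c + i)) \<le> card {x \<in> P. row E x = 1 \<and> \<not> y \<prec> x}"
      using finP by (simp add: E.card_row_prefix)
    then show ?thesis
      unfolding Gamma_X excess_E using rank_E_X[of i] cnt_E_run[of i] i yX by (simp add: Gamma_def)
  qed
qed (rule card_not_above_X)

end

section \<open>Two-row tableaux\<close>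

context finite_poset begin

text \<open>
  In a tableau, \<open>\<beta> j\<close> below \<open>a k\<close> forces \<open>j < k\<close>, so \<open>two_chains\<close> applies with the empty division \<open>p = 1\<close>
  and \<open>B = 0\<close>.  Its invariant fixes the first row, and the absence of further moves is the condition
  \<open>stuck\<close>.
\<close>

lemma tableau_aligned:
  assumes free: "three_plus_one_free P le" and T: "T \<in> two_row_tableaux P le"
  obtains m S a b where "aligned P le m S a b"
    "\<And>c. 1 \<le> c \<Longrightarrow> c \<le> m \<Longrightarrow> alignment le T 1 (a c) = Some (1, c) \<and> row_of T (a c) = 1"
    "\<And>c. c \<in> S \<Longrightarrow> alignment le T 1 (b c) = Some (2, c) \<and> row_of T (b c) = 2"
    "\<And>x. x \<notin> P \<Longrightarrow> alignment le T 1 x = None"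
proof -
  have TA: "T \<in> P_arrays P le"
    and tab: "\<And>i j x. T (i, j) = Some x \<Longrightarrow> i > 1 \<Longrightarrow> \<exists>y. T (i - 1, j) = Some y \<and> \<not> x \<prec> y"
    and wt0: "\<And>i. i > 2 \<Longrightarrow> wt_array T i = 0"
    using T unfolding two_row_tableaux_def P_tableaux_def by auto
  have dom: "dom T \<subseteq> {1..} \<times> {1..}" and ran: "ran T = P" and inj: "inj_on T (dom T)"
    using TA unfolding P_arrays_def by auto
  obtain a m where a: "\<And>k. T (1, k) = (if 1 \<le> k \<and> k \<le> m then Some (a k) else None)"
    and a_mono: "\<And>k l. 1 \<le> k \<Longrightarrow> k < l \<Longrightarrow> l \<le> m \<Longrightarrow> a k \<prec> a l"
    by (rule row_enumeration[OF TA, of 1]) (rule that; assumption)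
  obtain \<beta> n where be: "\<And>k. T (2, k) = (if 1 \<le> k \<and> k \<le> n then Some (\<beta> k) else None)"
    and be_mono: "\<And>k l. 1 \<le> k \<Longrightarrow> k < l \<Longrightarrow> l \<le> n \<Longrightarrow> \<beta> k \<prec> \<beta> l"
    by (rule row_enumeration[OF TA, of 2]) (rule that; assumption)
  have rows: "i = 1 \<or> i = 2" if h: "T (i, k) = Some x" for i k x
  proof (rule ccontr)
    assume "\<not> ?thesis"
    moreover have "(i, k) \<in> dom T" using h by auto
    then have "1 \<le> i" using dom by auto
    ultimately have "2 < i" by auto
    obtain \<gamma> M where g: "\<And>k. T (i, k) = (if 1 \<le> k \<and> k \<le> M then Some (\<gamma> k) else None)"
      by (rule row_enumeration[OF TA, of i]) (rule that; assumption)
    have "finite {k. T (i, k) \<noteq> None}" by (rule finite_subset[of _ "{..M}"]) (auto simp: g)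
    then have "{k. T (i, k) \<noteq> None} = {}" using wt0[OF \<open>2 < i\<close>] by (simp add: wt_array_def)
    then show False using h by auto
  qed
  have P_eq: "P = a ` {1..m} \<union> \<beta> ` {1..n}"
  proof (intro equalityI subsetI)
    fix x assume "x \<in> P"
    then obtain i k where ik: "T (i, k) = Some x" unfolding ran[symmetric] by (auto simp: ran_def)
    then show "x \<in> a ` {1..m} \<union> \<beta> ` {1..n}"
      using rows[OF ik] a[of k] be[of k] by (auto split: if_splits)
  next
    fix x assume "x \<in> a ` {1..m} \<union> \<beta> ` {1..n}"
    then consider k where "1 \<le> k" "k \<le> m" "x = a k" | k where "1 \<le> k" "k \<le> n" "x = \<beta> k" by auto
    then show "x \<in> P"
      unfolding ran[symmetric] using a be by cases (auto intro: ranI[of T "(1, _)"] ranI[of T "(2, _)"])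
  qed
  have below: "k \<le> m \<and> \<not> \<beta> k \<prec> a k" if k: "1 \<le> k" "k \<le> n" for k
  proof -
    have "T (2, k) = Some (\<beta> k)" using be k by simp
    from tab[OF this] obtain y where "T (1, k) = Some y" "\<not> \<beta> k \<prec> y" by auto
    then show ?thesis using a[of k] by (auto split: if_splits)
  qed
  have nm: "n \<le> m" using below[of n] by (cases n) auto
  interpret T: two_chains P le T 1 a \<beta> m n 1 0
  proof unfold_locales
    show "inj_on T (dom T)" by (rule inj)
    show "T (1, k) = (if 1 \<le> k \<and> k \<le> m then Some (a k) else None)" for k by (rule a)
    show "T (Suc 1, k) = (if 1 \<le> k \<and> k \<le> n then Some (\<beta> k) else None)" for k
      unfolding Suc_1 by (rule be)
    show "j + 1 \<le> 0 + k" if h: "1 \<le> k" "k \<le> m" "1 \<le> j" "j \<le> n" "\<beta> j \<prec> a k" for k j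
    proof (rule ccontr)
      assume "\<not> ?thesis"
      then have "a k = a j \<or> a k \<prec> a j" using a_mono[of k j] h below[of j] by (cases "k = j") auto
      then show False using below[of j] h lt_trans[of "\<beta> j" "a k" "a j"] by auto
    qed
  qed (use a_mono be_mono nm in auto)
  obtain \<gamma> where I: "T.invariant \<gamma>" and al: "alignment le T 1 = T.placed \<gamma>" and no_move: "\<And>x. \<not> T.can_move \<gamma> x"
    using T.alignment_invariant by blast
  have ga: "\<gamma> (a i) = i" if "1 \<le> i" "i \<le> m" for i using T.invariantD(1)[OF I, of i] that by simp
  have gb: "j \<le> \<gamma> (\<beta> j) \<and> \<gamma> (\<beta> j) \<le> m" if "1 \<le> j" "j \<le> n" for j
    using T.invariantD(5)[OF I, of j] that by simp
  have gmono: "\<gamma> (\<beta> j) < \<gamma> (\<beta> l)" if "1 \<le> j" "j < l" "l \<le> n" for j l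
    using that(2,3)
  proof (induction l)
    case (Suc l)
    have "\<gamma> (\<beta> l) < \<gamma> (\<beta> (l + 1))" using T.invariantD(6)[OF I, of l] Suc.prems that(1) by simp
    then show ?case using Suc by (cases "j = l") auto
  qed simp
  define S where "S = (\<lambda>j. \<gamma> (\<beta> j)) ` {1..n}"
  define ix where "ix c = (THE j. 1 \<le> j \<and> j \<le> n \<and> \<gamma> (\<beta> j) = c)" for c
  have ix: "ix (\<gamma> (\<beta> j)) = j" if "1 \<le> j" "j \<le> n" for j
    unfolding ix_def
  proof (rule the_equality)
    fix l assume "1 \<le> l \<and> l \<le> n \<and> \<gamma> (\<beta> l) = \<gamma> (\<beta> j)"
    then show "l = j" using gmono[of l j] gmono[of j l] that by (cases l j rule: linorder_cases) auto
  qed (use that in simp)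
  define b where "b c = \<beta> (ix c)" for c
  have SE: "\<exists>j. 1 \<le> j \<and> j \<le> n \<and> c = \<gamma> (\<beta> j) \<and> b c = \<beta> j" if "c \<in> S" for c
    using that ix by (auto simp: S_def b_def)
  have b_eq: "b (\<gamma> (\<beta> j)) = \<beta> j" "\<gamma> (\<beta> j) \<in> S" if "1 \<le> j" "j \<le> n" for j
    using ix[OF that] that by (auto simp: S_def b_def)
  have "aligned P le m S a b"
  proof (unfold_locales, rule free)
    show "P = a ` {1..m} \<union> b ` S"
    proof -
      have "b ` S = \<beta> ` {1..n}" unfolding S_def image_image using b_eq(1) by (intro image_cong) auto
      then show ?thesis using P_eq by simp
    qed
    show "S \<subseteq> {1..m}" using gb by (fastforce simp: S_def)
    show "a i \<noteq> b j" if "1 \<le> i" "i \<le> m" "j \<in> S" for i j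
      using SE[OF that(3)] T.rows_disjoint[of i] that by metis
    show "a i \<prec> a j" if "1 \<le> i" "i < j" "j \<le> m" for i j by (rule a_mono[OF that])
    show "b i \<prec> b j" if ij: "i \<in> S" "j \<in> S" "i < j" for i j
    proof -
      obtain k l where kl: "1 \<le> k" "k \<le> n" "i = \<gamma> (\<beta> k)" "b i = \<beta> k"
        "1 \<le> l" "l \<le> n" "j = \<gamma> (\<beta> l)" "b j = \<beta> l"
        using SE[OF ij(1)] SE[OF ij(2)] by blast
      have "k < l"
      proof (rule ccontr)
        assume "\<not> ?thesis"
        then have "j \<le> i" using gmono[of l k] kl by (cases "k = l") auto
        then show False using ij by simp
      qed
      then show ?thesis using be_mono[of k l] kl by simp
    qed
    show "\<not> b c \<prec> a c" if c: "c \<in> S" for c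
    proof -
      obtain j where j: "1 \<le> j" "j \<le> n" "c = \<gamma> (\<beta> j)" "b c = \<beta> j" using SE[OF c] by blast
      then show ?thesis using T.invariantD(7)[OF I, of j c] gb[of j] by simp
    qed
    show "b c \<prec> a (c + 1) \<or> c + 1 \<in> S" if c: "c \<in> S" "c < m" for c
    proof -
      obtain j where j: "1 \<le> j" "j \<le> n" "c = \<gamma> (\<beta> j)" "b c = \<beta> j" using SE[OF c(1)] by blast
      have "a (c + 1) \<in> T.elems" "\<gamma> (a (c + 1)) = \<gamma> (\<beta> j) + 1"
        using T.in_elems(1)[of "c + 1"] ga[of "c + 1"] c j by auto
      moreover have "\<beta> j \<in> T.elems" using T.in_elems(2) j by simp
      ultimately obtain y where y: "y \<in> T.elems" "\<gamma> y = c + 1" "\<beta> j \<prec> y"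
        using no_move[of "\<beta> j"] j(3) unfolding T.can_move_def by auto
      then consider i where "1 \<le> i" "i \<le> m" "y = a i" | l where "1 \<le> l" "l \<le> n" "y = \<beta> l"
        by (auto simp: T.elems_def)
      then show ?thesis
      proof cases
        case 1 then show ?thesis using ga[of i] y j by simp
      next
        case 2 then show ?thesis using b_eq(2)[of l] y by simp
      qed
    qed
  qed
  moreover have "alignment le T 1 (a c) = Some (1, c) \<and> row_of T (a c) = 1" if "1 \<le> c" "c \<le> m" for c
    using T.placed_upper[of c \<gamma>] ga[of c] row_of_eq[OF inj, of 1 c] a[of c] that al by simp
  moreover have "alignment le T 1 (b c) = Some (2, c) \<and> row_of T (b c) = 2" if c: "c \<in> S" for c
  proof -
    obtain j where j: "1 \<le> j" "j \<le> n" "c = \<gamma> (\<beta> j)" "b c = \<beta> j" using SE[OF c] by blast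
    have "T.placed \<gamma> (\<beta> j) = Some (2, c)" using T.placed_lower[OF j(1,2), of \<gamma>] j(3) unfolding Suc_1 by simp
    moreover have "row_of T (\<beta> j) = 2" using row_of_eq[OF inj, of 2 j] be[of j] j by simp
    ultimately show ?thesis using al j(4) by simp
  qed
  moreover have "alignment le T 1 x = None" if "x \<notin> P" for x
    using that P_eq unfolding al T.placed_def by simp
  ultimately show thesis by (rule that)
qed

end

section \<open>Raising a diagram to the highest weight\<close>

definition row_sum :: "diagram \<Rightarrow> nat" where "row_sum D = (\<Sum>z\<in>D. fst z)"

lemma row_sum_f_diagram:
  assumes D: "is_diagram D" and f: "f_diagram r D = Some E" shows "row_sum D < row_sum E"
proof -
  obtain c where c: "pivot D r c" "E = move r (Suc r) c D" using f_diagram_eq_Some_iff[OF D] f by blast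
  note cells = pivot_cells[OF c(1)]
  have fin: "finite D" using D by (simp add: is_diagram_def)
  have "row_sum D = r + (\<Sum>z\<in>D - {(r, c)}. fst z)"
    unfolding row_sum_def using sum.remove[OF fin, of "(r, c)" fst] cells by simp
  moreover have "row_sum E = Suc r + (\<Sum>z\<in>D - {(r, c)}. fst z)"
    unfolding row_sum_def c(2) move_def using fin cells by simp
  ultimately show ?thesis by simp
qed

context aligned begin

text \<open>An edge of the diagram crystal that is also an edge of the array crystal.\<close>

definition raises_to :: "nat \<Rightarrow> diagram \<Rightarrow> diagram \<Rightarrow> bool" where
  "raises_to r E D \<longleftrightarrow> 1 \<le> r \<and> is_diagram D \<and> good m S D \<and> f_diagram r D = Some E \<and>
     f_array le r (arr (row D)) = Some (arr (row E))"

lemma filledI: "good m S E \<Longrightarrow> filled P le m S a b E"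
  by unfold_locales

lemma raise_first:
  assumes E: "good m S E" and pos: "0 < excess E 1 c0"
  shows "\<exists>D q u t X Y. raises_to 1 E D \<and> shifted_by (row E) (row D) q u t X Y"
proof -
  interpret E: filled P le m S a b E by (rule filledI[OF E])
  obtain c where c: "copivot E 1 c" using copivot_exists[OF E.diagram pos] by blast
  interpret R: raised_first P le m S a b E c by unfold_locales (use c in auto)
  have "f_diagram 1 R.D = Some E"
    unfolding R.D_def by (rule f_diagram_copivot(1)[OF E.diagram _ c]) simp
  then have "raises_to 1 E R.D"
    unfolding raises_to_def using R.good_D R.D.diagram R.f_array_eq by blast
  then show ?thesis using R.shifted_by_rows by blast
qed

text \<open>Whether \<open>e\<^sub>1\<close> applies to a diagram can thus be decided from its array.\<close>

lemma excess_pos_iff: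
  assumes E: "good m S E"
  shows "(\<exists>c. 0 < excess E 1 c) \<longleftrightarrow> (\<exists>y\<in>P. row E y = 2 \<and> 0 < Gamma (row E) y)"
proof -
  interpret E: filled P le m S a b E by (rule filledI[OF E])
  show ?thesis
  proof
    assume "\<exists>c. 0 < excess E 1 c"
    then obtain c where c: "copivot E 1 c" "0 < excess E 1 c" using copivot_exists[OF E.diagram] by blast
    interpret R: raised_first P le m S a b E c by unfold_locales (use c in auto)
    show "\<exists>y\<in>P. row E y = 2 \<and> 0 < Gamma (row E) y"
      using R.X[of R.t] R.row_E_X[of R.t] R.Gamma_X c(2) by (intro bexI[of _ "R.X R.t"]) auto
  next
    assume "\<exists>y\<in>P. row E y = 2 \<and> 0 < Gamma (row E) y"
    then show "\<exists>c. 0 < excess E 1 c" using E.Gamma_le_excess by (meson less_le_trans)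
  qed
qed

text \<open>Nonpositive excess puts a cell of row 1 weakly left of each cell of row 2, which by the absence of
  forbidden triples excludes later rows from the columns weakly to the right.\<close>

lemma raise_last:
  assumes E: "good m S E" and ex: "\<And>c. excess E 1 c \<le> 0" and r: "2 \<le> r"
    and empty: "\<And>i c. (i, c) \<in> E \<Longrightarrow> 3 \<le> i \<Longrightarrow> r < i" and ne: "(Suc r, c0) \<in> E"
  shows "\<exists>D. raises_to r E D \<and> (\<forall>z\<in>P. row D z =
    (if row E z = Suc r \<and> (\<forall>w\<in>P. row E w = Suc r \<longrightarrow> w = z \<or> w \<prec> z) then r else row E z))"
proof -
  interpret E: filled P le m S a b E by (rule filledI[OF E])
  let ?C = "{e. (Suc r, e) \<in> E}"
  have finC: "finite ?C" by (rule finite_subset[of _ "{..m}"]) (use E.cells_range in auto)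
  define c where "c = Max ?C"
  have c: "(Suc r, c) \<in> E" and last: "\<And>e. (Suc r, e) \<in> E \<Longrightarrow> e \<le> c"
    unfolding c_def using Max_in[OF finC] Max_ge[OF finC] ne by auto
  have right: "c < e" if e: "(r, e) \<in> E" for e
  proof (rule ccontr)
    assume n: "\<not> c < e"
    have r2: "r = 2" using empty[OF e] r by (cases "3 \<le> r") auto
    have e1: "1 \<le> e" using E.cells_range[OF e] by simp
    have "cnt E 2 (e - 1) < cnt E 2 e" using E.cnt_less[of 2 e "e - 1"] e r2 e1 by simp
    then have "0 < cnt E 1 e" using ex[of e] unfolding excess_def Suc_1 by simp
    then have "{d. d \<le> e \<and> (1, d) \<in> E} \<noteq> {}" unfolding cnt_def by (metis card.empty less_irrefl)
    then obtain d where "d \<le> e" "(1, d) \<in> E" by blast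
    then show False using E.no_triple[OF _ e c] r2 n by force
  qed
  have cop: "copivot E r c"
    unfolding copivot_def
  proof (intro conjI allI impI)
    show "1 \<le> c" using E.cells_range[OF c] by simp
    have left0: "cnt E r e = 0" if "e \<le> c" for e
    proof -
      have "{f. f \<le> e \<and> (r, f) \<in> E} = {}" using right that by fastforce
      then show ?thesis unfolding cnt_def by (metis card.empty)
    qed
    fix e assume "e < c"
    then show "excess E r e < excess E r c" using left0[of e] left0[of c] E.cnt_less[OF c, of e] by (simp add: excess_def)
  next
    fix d assume d: "c < d"
    have "{f. c < f \<and> f \<le> d \<and> (Suc r, f) \<in> E} = {}" using last by fastforce
    then have "cnt E (Suc r) d = cnt E (Suc r) c" using cnt_split[of c d E "Suc r"] d by (metis add.right_neutral card.empty less_imp_le)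
    moreover have "cnt E r c \<le> cnt E r d" using d by (intro cnt_mono) simp
    ultimately show "excess E r d \<le> excess E r c" by (simp add: excess_def)
  qed
  interpret R: raised P le m S a b E r c by unfold_locales (use r cop in auto)
  have "raises_to r E R.D"
    unfolding raises_to_def
    using R.good_D R.D.diagram R.raised_last(1)[OF last right] f_diagram_copivot(1)[OF E.diagram _ cop] r
    by (simp add: R.D_def)
  moreover have "row R.D z =
      (if row E z = Suc r \<and> (\<forall>w\<in>P. row E w = Suc r \<longrightarrow> w = z \<or> w \<prec> z) then r else row E z)" if z: "z \<in> P" for z
  proof -
    have "col z = c \<longleftrightarrow> (\<forall>w\<in>P. row E w = Suc r \<longrightarrow> w = z \<or> w \<prec> z)" if rz: "row E z = Suc r"
    proof
      assume cz: "col z = c"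
      show "\<forall>w\<in>P. row E w = Suc r \<longrightarrow> w = z \<or> w \<prec> z"
      proof (intro ballI impI)
        fix w assume w: "w \<in> P" "row E w = Suc r"
        then have "col w \<le> c" using E.row_cell[of w] last by simp
        then show "w = z \<or> w \<prec> z"
          using E.row_increasing[OF w(1) z] E.row_col_inj[OF w(1) z] w rz cz by (cases "col w = c") auto
      qed
    next
      assume h: "\<forall>w\<in>P. row E w = Suc r \<longrightarrow> w = z \<or> w \<prec> z"
      obtain w where w: "w \<in> P" "row E w = Suc r" "col w = c" using E.cell_element[OF c] by blast
      have "col z \<le> c" using E.row_cell[OF z] rz last by simp
      moreover have "w = z \<or> w \<prec> z" using h w by blast
      ultimately show "col z = c" using E.less_iff_col[OF w(1) z] w rz by auto
    qed
    then show ?thesis using R.raised_last(2)[OF last right z] by auto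
  qed
  ultimately show ?thesis by blast
qed

lemma raise_exists:
  assumes E: "good m S E" and ne: "E \<noteq> highest m S"
  shows "\<exists>r D. raises_to r E D"
proof (cases "\<exists>c. 0 < excess E 1 c")
  case True then show ?thesis using raise_first[OF E] by blast
next
  case False
  then have ex: "\<And>c. excess E 1 c \<le> 0" by (simp add: not_less)
  let ?Q = "\<lambda>i. 3 \<le> i \<and> (\<exists>c. (i, c) \<in> E)"
  have "\<exists>i. ?Q i"
  proof (rule ccontr)
    assume "\<nexists>i. ?Q i"
    then have "i \<le> 2" if "(i, c) \<in> E" for i c using that by (metis not_less_eq_eq numeral_2_eq_2 numeral_3_eq_3)
    from good_eq_highest[OF E this ex] ne show False by simp
  qed
  then have L: "?Q (LEAST i. ?Q i)" by (rule LeastI_ex)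
  define r where "r = (LEAST i. ?Q i) - 1"
  have r: "2 \<le> r" "Suc r = (LEAST i. ?Q i)" using L by (auto simp: r_def)
  have "r < i" if "(i, c) \<in> E" "3 \<le> i" for i c
    using Least_le[of ?Q i] that r(2) by fastforce
  moreover obtain c0 where "(Suc r, c0) \<in> E" using L r(2) by auto
  ultimately show ?thesis using raise_last[OF E ex r(1)] by blast
qed

lemma row_highest:
  "1 \<le> c \<Longrightarrow> c \<le> m \<Longrightarrow> row (highest m S) (a c) = 1" "c \<in> S \<Longrightarrow> row (highest m S) (b c) = 2"
proof -
  interpret H: filled P le m S a b "highest m S" by (rule filledI[OF highest_good[OF S_sub]])
  have tp: "tp (highest m S) c = 1" if c: "1 \<le> c" "c \<le> m" for c
  proof -
    have h: "(1, c) \<in> highest m S" using c by (auto simp: highest_def)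
    have "1 \<le> tp (highest m S) c" using H.cells_range[OF H.tp_cell[OF c]] by simp
    then show ?thesis using h H.cell_iff[of 1 c] H.tp_less_lw[of c] by auto
  qed
  have lw: "lw (highest m S) c = 2" if c: "c \<in> S" for c
  proof -
    have h: "(2, c) \<in> highest m S" using c by (auto simp: highest_def)
    show ?thesis using h H.cell_iff[of 2 c] tp[of c] S_range[OF c] by auto
  qed
  have nf: "\<not> flip (highest m S) c" for c
  proof (induction c)
    case (Suc c)
    show ?case
    proof
      assume h: "flip (highest m S) (Suc c)"
      then have l: "link (Suc c)" by simp
      then have c: "Suc c \<in> S" "1 \<le> c" by (auto simp: link_def)
      have "c \<le> m" using S_range[OF c(1)] by simp
      then show False using h Suc lw[OF c(1)] tp[OF c(2)] by simp
    qed
  qed simp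
  show "row (highest m S) (a c) = 1" if "1 \<le> c" "c \<le> m" using that tp[OF that] nf by (simp add: row_a)
  show "row (highest m S) (b c) = 2" if "c \<in> S" using that lw[OF that] nf by (simp add: row_b)
qed

end

locale two_aligned = A: aligned P le m S a b + B: aligned P le m' S' a' b'
  for P :: "'a set" and le m S a b m' S' a' b'
begin

text \<open>
  Both diagrams are raised in parallel.  Their arrays being equal, they agree on the kind of the next
  step, by \<open>excess_pos_iff\<close> and because they occupy the same rows, and on its effect.
\<close>

lemma rows_determine_highest:
  assumes "good m S E" "good m' S' E'" "\<And>x. x \<in> P \<Longrightarrow> A.row E x = B.row E' x" "x \<in> P"
  shows "A.row (highest m S) x = B.row (highest m' S') x"
  using assms
proof (induction "row_sum E" arbitrary: E E' x rule: less_induct)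
  case less
  note E = less.prems(1) and E' = less.prems(2) and eq = less.prems(3)
  interpret E: filled P le m S a b E by (rule A.filledI[OF E])
  interpret E': filled P le m' S' a' b' E' by (rule B.filledI[OF E'])
  have step: "A.row (highest m S) x = B.row (highest m' S') x"
    if D: "A.raises_to r E D" "B.raises_to r E' D'" and rows: "\<And>x. x \<in> P \<Longrightarrow> A.row D x = B.row D' x" for r D D'
  proof (rule less.hyps[OF _ _ _ rows less.prems(4)])
    show "row_sum D < row_sum E" using D(1) row_sum_f_diagram unfolding A.raises_to_def by blast
    show "good m S D" using D(1) unfolding A.raises_to_def by blast
    show "good m' S' D'" using D(2) unfolding B.raises_to_def by blast
  qed
  have rank_eq: "A.rank (A.row E) y = A.rank (B.row E') y" if y: "y \<in> P" for y
    unfolding A.rank_def by (rule arg_cong[of _ _ card]) (use eq y in auto)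
  have Gamma_eq: "A.Gamma (A.row E) y = A.Gamma (B.row E') y" if y: "y \<in> P" for y
  proof -
    have "{x \<in> P. A.row E x = 1 \<and> \<not> lt le y x} = {x \<in> P. B.row E' x = 1 \<and> \<not> lt le y x}" using eq by auto
    then show ?thesis unfolding A.Gamma_def rank_eq[OF y] by simp
  qed
  have pos: "(\<exists>c. 0 < excess E 1 c) \<longleftrightarrow> (\<exists>c. 0 < excess E' 1 c)"
    unfolding A.excess_pos_iff[OF E] B.excess_pos_iff[OF E'] using eq Gamma_eq by auto
  have cells: "(\<exists>c. (i, c) \<in> E) \<longleftrightarrow> (\<exists>c. (i, c) \<in> E')" for i
  proof -
    have "(\<exists>c. (i, c) \<in> E) \<longleftrightarrow> (\<exists>x\<in>P. A.row E x = i)" using E.cell_element E.row_cell by blast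
    also have "\<dots> \<longleftrightarrow> (\<exists>x\<in>P. B.row E' x = i)" using eq by auto
    also have "\<dots> \<longleftrightarrow> (\<exists>c. (i, c) \<in> E')" using E'.cell_element E'.row_cell by blast
    finally show ?thesis .
  qed
  show ?case
  proof (cases "\<exists>c. 0 < excess E 1 c")
    case True
    then obtain c where c: "0 < excess E 1 c" by blast
    obtain c' where c': "0 < excess E' 1 c'" using True pos by blast
    obtain D q u t X Y where D: "A.raises_to 1 E D" "A.shifted_by (A.row E) (A.row D) q u t X Y"
      using A.raise_first[OF E c] by blast
    obtain D' q' u' t' X' Y' where D': "B.raises_to 1 E' D'" "A.shifted_by (B.row E') (B.row D') q' u' t' X' Y'"
      using B.raise_first[OF E' c'] by blast
    have "A.shifted_by (A.row E) (B.row D') q' u' t' X' Y'"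
    proof -
      have c: "{x \<in> P. A.row E x = 1 \<and> \<not> lt le y x} = {x \<in> P. B.row E' x = 1 \<and> \<not> lt le y x}" for y
        using eq by auto
      note sb = A.shifted_byD[OF D'(2)]
      have XP: "X' i \<in> P" if "i \<le> t'" for i using sb(1)[OF that] by simp
      have YP: "Y' i \<in> P" if "1 \<le> i" "i \<le> t'" for i using sb(2)[OF that] by simp
      show ?thesis
        unfolding A.shifted_by_def c
        using sb XP YP eq rank_eq Gamma_eq by simp
    qed
    then have "A.row D z = B.row D' z" if "z \<in> P" for z
      using A.shifted_by_unique[OF E.row_chains_row D(2) _ that] by blast
    then show ?thesis using step D(1) D'(1) by blast
  next
    case False
    have ex: "excess E 1 c \<le> 0" "excess E' 1 c \<le> 0" for c using False pos not_less by blast+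
    let ?Q = "\<lambda>i. 3 \<le> i \<and> (\<exists>c. (i, c) \<in> E)"
    show ?thesis
    proof (cases "\<exists>i. ?Q i")
      case Q: True
      then have L: "?Q (LEAST i. ?Q i)" by (rule LeastI_ex)
      define r where "r = (LEAST i. ?Q i) - 1"
      have r: "2 \<le> r" "Suc r = (LEAST i. ?Q i)" using L by (auto simp: r_def)
      have emp: "r < i" if "(i, c) \<in> E" "3 \<le> i" for i c using Least_le[of ?Q i] that r(2) by fastforce
      have emp': "r < i" if "(i, c) \<in> E'" "3 \<le> i" for i c using emp cells[of i] that by blast
      obtain c0 where c0: "(Suc r, c0) \<in> E" using L r(2) by auto
      obtain c0' where c0': "(Suc r, c0') \<in> E'" using c0 cells by blast
      have "\<exists>D. A.raises_to r E D \<and> (\<forall>z\<in>P. A.row D z =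
          (if A.row E z = Suc r \<and> (\<forall>w\<in>P. A.row E w = Suc r \<longrightarrow> w = z \<or> lt le w z) then r else A.row E z))"
        by (rule A.raise_last[OF E ex(1) r(1) _ c0]) (rule emp)
      then obtain D where D: "A.raises_to r E D" "\<And>z. z \<in> P \<Longrightarrow> A.row D z =
          (if A.row E z = Suc r \<and> (\<forall>w\<in>P. A.row E w = Suc r \<longrightarrow> w = z \<or> lt le w z) then r else A.row E z)"
        by blast
      have "\<exists>D'. B.raises_to r E' D' \<and> (\<forall>z\<in>P. B.row D' z =
          (if B.row E' z = Suc r \<and> (\<forall>w\<in>P. B.row E' w = Suc r \<longrightarrow> w = z \<or> lt le w z) then r else B.row E' z))"
        by (rule B.raise_last[OF E' ex(2) r(1) _ c0']) (rule emp')
      then obtain D' where D': "B.raises_to r E' D'" "\<And>z. z \<in> P \<Longrightarrow> B.row D' z =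
          (if B.row E' z = Suc r \<and> (\<forall>w\<in>P. B.row E' w = Suc r \<longrightarrow> w = z \<or> lt le w z) then r else B.row E' z)"
        by blast
      have "A.row D z = B.row D' z" if z: "z \<in> P" for z
        unfolding D(2)[OF z] D'(2)[OF z] using eq z by simp
      then show ?thesis using step D(1) D'(1) by blast
    next
      case nQ: False
      then have le2: "i \<le> 2" if "(i, c) \<in> E" for i c
        using that by (metis not_less_eq_eq numeral_2_eq_2 numeral_3_eq_3)
      have le2': "i \<le> 2" if "(i, c) \<in> E'" for i c using that le2 cells[of i] by blast
      have "E = highest m S" "E' = highest m' S'"
        using good_eq_highest[OF E le2 ex(1)] good_eq_highest[OF E' le2' ex(2)] by auto
      then show ?thesis using eq less.prems(4) by simp
    qed
  qed
qed

end

section \<open>Bijectivity and connectedness\<close>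

locale tableau = aligned P le m S a b for P :: "'a set" and le m S a b +
  fixes T :: "'a array"
  assumes align_a: "\<And>c. 1 \<le> c \<Longrightarrow> c \<le> m \<Longrightarrow> alignment le T 1 (a c) = Some (1, c) \<and> row_of T (a c) = 1"
    and align_b: "\<And>c. c \<in> S \<Longrightarrow> alignment le T 1 (b c) = Some (2, c) \<and> row_of T (b c) = 2"
    and align_None: "\<And>x. x \<notin> P \<Longrightarrow> alignment le T 1 x = None"
begin

lemma alignment_eq: "alignment le T 1 = phi"
proof
  fix x show "alignment le T 1 x = phi x"
  proof (cases "x \<in> P")
    case True
    then show ?thesis by (cases rule: P_cases) (simp_all add: align_a align_b phi_a phi_b del: One_nat_def)
  next
    case False then show ?thesis using align_None[OF False] by (simp add: phi_def)
  qed
qed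

lemma component_eq:
  "diagram_component le T = {D. (highest m S, D) \<in> (diagram_crystal_edges \<union> diagram_crystal_edges\<inverse>)\<^sup>*}"
proof -
  have "ran phi = highest m S"
  proof (intro equalityI subrelI)
    fix i c assume "(i, c) \<in> ran phi"
    then obtain x where "phi x = Some (i, c)" by (auto simp: ran_def)
    then show "(i, c) \<in> highest m S" using phi_eq by (auto simp: highest_def)
  next
    fix i c assume "(i, c) \<in> highest m S"
    then consider "i = 1" "1 \<le> c" "c \<le> m" | "i = 2" "c \<in> S" by (auto simp: highest_def)
    then show "(i, c) \<in> ran phi"
    proof cases
      case 1 then show ?thesis using phi_a[of c] ranI[of phi "a c"] by simp
    next
      case 2 then show ?thesis using phi_b[of c] ranI[of phi "b c"] by simp
    qed
  qed
  then show ?thesis unfolding diagram_component_def tableau_diagram_def alignment_eq by simp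
qed

lemma component_good: "D \<in> diagram_component le T \<Longrightarrow> good m S D"
  using good_component[OF _ S_sub] unfolding component_eq by blast

lemma filling_array: "D \<in> diagram_component le T \<Longrightarrow> array_of_filling (diagram_filling le T D) = arr (row D)"
proof -
  assume "D \<in> diagram_component le T"
  then interpret filled P le m S a b D by (intro filledI component_good)
  show ?thesis by (rule array_eq[OF alignment_eq])
qed

lemma row_of_T: "x \<in> P \<Longrightarrow> row (highest m S) x = row_of T x"
  using row_highest align_a align_b by (auto elim!: P_cases)

lemma DFA_of_eq: "DFA_of le T = (\<lambda>D. arr (row D)) ` diagram_component le T"
  unfolding DFA_of_def using filling_array by (auto simp: image_iff) metis+

lemma weights:
  assumes D: "D \<in> diagram_component le T"
  shows "wt_diagram D = wt_array (array_of_filling (diagram_filling le T D))"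
proof
  interpret filled P le m S a b D by (rule filledI[OF component_good[OF D]])
  fix i show "wt_diagram D i = wt_array (array_of_filling (diagram_filling le T D)) i"
    unfolding filling_array[OF D] wt_arr[OF row_chains_row] card_row ..
qed

lemma connected: "connected_subset (P_arrays P le) (array_crystal_edges P le) (DFA_of le T)"
proof -
  let ?E = "array_crystal_edges P le"
  define R where "R = (?E \<union> ?E\<inverse>) \<inter> DFA_of le T \<times> DFA_of le T"
  have sub: "arr (row D) \<in> P_arrays P le" if "D \<in> diagram_component le T" for D
  proof -
    interpret filled P le m S a b D by (rule filledI[OF component_good[OF that]])
    show ?thesis by (rule arr_in_P_arrays[OF row_chains_row])
  qed
  have path: "(arr (row (highest m S)), arr (row E)) \<in> R\<^sup>*" if "E \<in> diagram_component le T" for E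
    using that
  proof (induction "row_sum E" arbitrary: E rule: less_induct)
    case less
    note gE = component_good[OF less.prems]
    show ?case
    proof (cases "E = highest m S")
      case False
      then obtain r D where D: "raises_to r E D" using raise_exists[OF gE] by blast
      then have D': "1 \<le> r" "is_diagram D" "f_diagram r D = Some E" "f_array le r (arr (row D)) = Some (arr (row E))"
        unfolding raises_to_def by auto
      have "is_diagram E" using gE by (simp add: good_def)
      then have "(D, E) \<in> diagram_crystal_edges" using D' by (auto simp: diagram_crystal_edges_def)
      then have DC: "D \<in> diagram_component le T"
        using less.prems unfolding component_eq by (auto intro: rtrancl_into_rtrancl)
      have "(arr (row (highest m S)), arr (row D)) \<in> R\<^sup>*"
        by (rule less.hyps[OF row_sum_f_diagram[OF D'(2,3)] DC])
      moreover have "(arr (row D), arr (row E)) \<in> R"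
        unfolding R_def DFA_of_eq array_crystal_edges_def
        using D'(1,4) sub[OF DC] sub[OF less.prems] DC less.prems by blast
      ultimately show ?thesis by (rule rtrancl_into_rtrancl)
    qed simp
  qed
  have "sym R" unfolding R_def sym_def by blast
  then have symR: "sym (R\<^sup>*)" by (rule sym_rtrancl)
  show ?thesis
    unfolding connected_subset_def R_def[symmetric]
  proof (intro conjI ballI)
    show "DFA_of le T \<subseteq> P_arrays P le" unfolding DFA_of_eq using sub by blast
    fix x y assume "x \<in> DFA_of le T" "y \<in> DFA_of le T"
    then obtain D E where DE: "D \<in> diagram_component le T" "x = arr (row D)" "E \<in> diagram_component le T" "y = arr (row E)"
      unfolding DFA_of_eq by blast
    show "(x, y) \<in> R\<^sup>*"
      using rtrancl_trans[OF symD[OF symR path[OF DE(1)]] path[OF DE(3)]] DE(2,4) by simp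
  qed
qed

end

context finite_poset begin

lemma tableau_exists:
  assumes "three_plus_one_free P le" "T \<in> two_row_tableaux P le"
  obtains m S a b where "tableau P le m S a b T"
proof -
  obtain m S a b where "aligned P le m S a b"
    "\<And>c. 1 \<le> c \<Longrightarrow> c \<le> m \<Longrightarrow> alignment le T 1 (a c) = Some (1, c) \<and> row_of T (a c) = 1"
    "\<And>c. c \<in> S \<Longrightarrow> alignment le T 1 (b c) = Some (2, c) \<and> row_of T (b c) = 2"
    "\<And>x. x \<notin> P \<Longrightarrow> alignment le T 1 x = None"
    by (rule tableau_aligned[OF assms]) (rule that; assumption)
  then have "tableau P le m S a b T" unfolding tableau_def tableau_axioms_def by blast
  then show thesis by (rule that)
qed

text \<open>Climbing to the highest weight recovers \<open>T\<close>; the alignment of \<open>T\<close> gives the column of each element,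
  and the array gives its row, hence together the cells of \<open>D\<close>.\<close>

lemma filling_array_injective:
  assumes free: "three_plus_one_free P le"
    and T: "T \<in> two_row_tableaux P le" "D \<in> diagram_component le T"
    and T': "T' \<in> two_row_tableaux P le" "D' \<in> diagram_component le T'"
    and eq: "array_of_filling (diagram_filling le T D) = array_of_filling (diagram_filling le T' D')"
  shows "T = T' \<and> D = D'"
proof -
  obtain m S a b where "tableau P le m S a b T" using tableau_exists[OF free T(1)] by blast
  then interpret A: tableau P le m S a b T .
  obtain m' S' a' b' where "tableau P le m' S' a' b' T'" using tableau_exists[OF free T'(1)] by blast
  then interpret B: tableau P le m' S' a' b' T' .
  interpret two_aligned P le m S a b m' S' a' b' ..
  interpret D: filled P le m S a b D by (rule A.filledI[OF A.component_good[OF T(2)]])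
  interpret D': filled P le m' S' a' b' D' by (rule B.filledI[OF B.component_good[OF T'(2)]])
  have "arr (A.row D) = arr (B.row D')" using eq A.filling_array[OF T(2)] B.filling_array[OF T'(2)] by simp
  then have rows: "A.row D x = B.row D' x" if "x \<in> P" for x
    using row_of_arr[OF D.row_chains_row that] row_of_arr[OF D'.row_chains_row that] by simp
  have "row_of T x = row_of T' x" if "x \<in> P" for x
    using rows_determine_highest[OF D.good D'.good rows that] A.row_of_T[OF that] B.row_of_T[OF that] by simp
  then have "arr (row_of T) = arr (row_of T')" by (rule array_of_rows_cong)
  then have TT: "T = T'"
    using P_array_eq_arr(2)[of T] P_array_eq_arr(2)[of T'] T(1) T'(1)
    unfolding two_row_tableaux_def P_tableaux_def by auto
  have colA: "alignment le T 1 x = Some (i, c) \<Longrightarrow> A.col x = c" for x i c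
    using A.alignment_eq by (auto simp: A.phi_def split: if_splits)
  have colB: "alignment le T' 1 x = Some (i, c) \<Longrightarrow> B.col x = c" for x i c
    using B.alignment_eq by (auto simp: B.phi_def split: if_splits)
  have cols: "A.col x = B.col x" if x: "x \<in> P" for x
  proof -
    obtain i c where "alignment le T 1 x = Some (i, c)" using A.alignment_eq x by (auto simp: A.phi_def)
    then show ?thesis using colA colB TT by metis
  qed
  have "D = (\<lambda>x. (A.row D x, A.col x)) ` P"
    using D.cell_element D.row_cell by (force simp: image_iff)
  also have "\<dots> = (\<lambda>x. (B.row D' x, B.col x)) ` P" using rows cols by (intro image_cong) auto
  also have "\<dots> = D'" using D'.cell_element D'.row_cell by (force simp: image_iff)
  finally show ?thesis using TT by simp
qed

end

theorem theorem8p12: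
  fixes P :: "'a set" and le :: "'a rel"
  assumes "finite P"
    and "partial_order_on P le"
    and "three_plus_one_free P le"
  shows "bij_betw (\<lambda>(T, D). array_of_filling (diagram_filling le T D))
           (SIGMA T:two_row_tableaux P le. diagram_component le T) (DFA P le)
       \<and> (\<forall>T\<in>two_row_tableaux P le. \<forall>D\<in>diagram_component le T.
            wt_diagram D = wt_array (array_of_filling (diagram_filling le T D)))
       \<and> (\<forall>T\<in>two_row_tableaux P le.
            connected_subset (P_arrays P le) (array_crystal_edges P le) (DFA_of le T))"
proof -
  interpret finite_poset P le by unfold_locales (rule assms)+
  have "inj_on (\<lambda>(T, D). array_of_filling (diagram_filling le T D))
      (SIGMA T:two_row_tableaux P le. diagram_component le T)"
  proof (rule inj_onI, clarify)
    fix T D T' D'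
    assume "T \<in> two_row_tableaux P le" "D \<in> diagram_component le T" "T' \<in> two_row_tableaux P le"
      "D' \<in> diagram_component le T'"
      "array_of_filling (diagram_filling le T D) = array_of_filling (diagram_filling le T' D')"
    from filling_array_injective[OF assms(3) this] show "T = T' \<and> D = D'" .
  qed
  moreover have "(\<lambda>(T, D). array_of_filling (diagram_filling le T D)) `
      (SIGMA T:two_row_tableaux P le. diagram_component le T) = DFA P le"
    unfolding DFA_def DFA_of_def by force
  moreover have "(\<forall>D\<in>diagram_component le T. wt_diagram D = wt_array (array_of_filling (diagram_filling le T D)))
      \<and> connected_subset (P_arrays P le) (array_crystal_edges P le) (DFA_of le T)"
    if T: "T \<in> two_row_tableaux P le" for T
  proof -
    obtain m S a b where "tableau P le m S a b T" using tableau_exists[OF assms(3) T] by blast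
    then interpret tableau P le m S a b T .
    show ?thesis using weights connected by blast
  qed
  ultimately show ?thesis unfolding bij_betw_def by blast
qed

end
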